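(* Let $\tau\in\mathbb{C}$ with $\operatorname{Im}\tau>0$ be such that $\mathbb{C}/(\mathbb{Z}+\tau\mathbb{Z})$ is not of modulus represented by a pure imaginary number (that is, $\tau$ is not $SL_2(\mathbb{Z})$-equivalent to a number in $\sqrt{-1}\,\mathbb{R}_{>0}$). Then there exist an integer $n\ge 5$, a real number $h>0$, an integer $\ell\in\{2,\dots,n-3\}$ and real numbers $\rho,\sigma$ satisfying either $$\sigma=\rho+\frac{\ell}{n}\quad\text{and}\quad -\frac12<\rho<-\frac{\ell}{2n}-\frac1n,$$ or $$\sigma=\rho-\frac{\ell}{n}\quad\text{and}\quad \frac{\ell}{2n}<\rho<\frac12-\frac1n,$$ such that $A_n^\rho\cup A_n^\sigma\subset\mathbb{C}\times\mathbb{R}$ is an origami embedded flat torus of modulus $\tau$.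
   Context: Identify 3-dimensional Euclidean space with $\mathbb{C}\times\mathbb{R}$. For an integer $n\ge 3$, a real number $h>0$ and a real number $\rho$ with $-\frac12<\rho<\frac12-\frac1n$, put, for $k=0,\dots,n$, $$P_k=(e^{2\pi\sqrt{-1}k/n},0),\qquad Q_k^\rho=(e^{2\pi\sqrt{-1}\rho+2\pi\sqrt{-1}k/n},h)$$ (so $P_n=P_0$, $Q^\rho_n=Q^\rho_0$), and let $$A_n^\rho=\bigcup_{k=0}^{n-1}\left(\triangle P_kP_{k+1}Q_{k+1}^\rho\cup\triangle Q_{k+1}^\rho Q_k^\rho P_k\right),$$ where $\triangle XYZ$ is the solid triangle (convex hull) with vertices $X,Y,Z$. The set $A_n^\rho$ depends also on $h$; in $A_n^\rho\cup A_n^\sigma$ the same $n$ and the same $h$ are used for both pieces. When $\sigma-\rho\in\frac1n\mathbb{Z}$, the two surfaces have the same boundary (the boundaries of the two regular $n$-gons in $\mathbb{C}\times\{0\}$ and $\mathbb{C}\times\{h\}$), and the surfaces are pasted along it. A flat torus is a quotient of the Euclidean plane $\mathbb{C}$ by a lattice; it has modulus $\tau$ ($\operatorname{Im}\tau>0$) if it is similar (isometric up to scaling) to $\mathbb{C}/(\mathbb{Z}+\tau\mathbb{Z})$. The number $\tau$ is determined up to $SL_2(\mathbb{Z})$-equivalence. An origami embedded flat torus of modulus $\tau$ is a subset of $\mathbb{C}\times\mathbb{R}$ that is the image of an injective continuous map from a flat torus of modulus $\tau$ which is isometric on each triangle of some finite triangulation of the torus by flat triangles, each mapped onto a Euclidean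 triangle. *)

theory Defs
  imports "HOL-Analysis.Analysis"
begin

definition lattice_gen :: "complex \<Rightarrow> complex \<Rightarrow> complex set" where
  "lattice_gen \<omega>1 \<omega>2 = {of_int a * \<omega>1 + of_int b * \<omega>2 | a b :: int. True}"

text \<open>\<^term>\<open>independent\<close> is linear independence over the reals.\<close>

definition is_lattice :: "complex set \<Rightarrow> bool" where
  "is_lattice \<Lambda> \<longleftrightarrow>
     (\<exists>\<omega>1 \<omega>2. \<omega>1 \<noteq> \<omega>2 \<and> independent {\<omega>1, \<omega>2} \<and> \<Lambda> = lattice_gen \<omega>1 \<omega>2)"

definition lattice_rel :: "complex set \<Rightarrow> (complex \<times> complex) set" where
  "lattice_rel \<Lambda> = {(z, w). w - z \<in> \<Lambda>}"

definition torus :: "complex set \<Rightarrow> complex set set" where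
  "torus \<Lambda> = UNIV // lattice_rel \<Lambda>"

definition torus_proj :: "complex set \<Rightarrow> complex \<Rightarrow> complex set" where
  "torus_proj \<Lambda> z = lattice_rel \<Lambda> `` {z}"

definition torus_topology :: "complex set \<Rightarrow> complex set topology" where
  "torus_topology \<Lambda> = topology (\<lambda>U. U \<subseteq> torus \<Lambda> \<and> open (torus_proj \<Lambda> -` U))"

text \<open>The defining predicate really is a topology, namely the quotient topology.\<close>

lemma openin_torus_topology:
  "openin (torus_topology \<Lambda>) U \<longleftrightarrow> U \<subseteq> torus \<Lambda> \<and> open (torus_proj \<Lambda> -` U)"
proof -
  have "istopology (\<lambda>U. U \<subseteq> torus \<Lambda> \<and> open (torus_proj \<Lambda> -` U))"
    unfolding istopology_def by (auto simp: vimage_Union)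
  then show ?thesis
    unfolding torus_topology_def by (simp add: topology_inverse')
qed

text \<open>
  Points of a torus are cosets, so the flat quotient distance between two points is the
  distance \<^term>\<open>setdist\<close> of two subsets of the plane.  Flat tori carry the orientation of the
  plane, and similarities preserve it; this is what makes the modulus well defined up to
  \<open>SL\<^sub>2(\<int>)\<close> and not merely up to \<open>GL\<^sub>2(\<int>)\<close>.  Among the maps that scale distances, the
  orientation preserving ones are those with a holomorphic lift to the plane.
\<close>

definition torus_similarity ::
    "complex set \<Rightarrow> complex set \<Rightarrow> (complex set \<Rightarrow> complex set) \<Rightarrow> bool" where
  "torus_similarity \<Lambda> \<Lambda>' f \<longleftrightarrow>
     bij_betw f (torus \<Lambda>) (torus \<Lambda>') \<and>
     (\<exists>c>0. \<forall>x\<in>torus \<Lambda>. \<forall>y\<in>torus \<Lambda>. setdist (f x) (f y) = c * setdist x y) \<and>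
     (\<exists>g. g holomorphic_on UNIV \<and> (\<forall>z. f (torus_proj \<Lambda> z) = torus_proj \<Lambda>' (g z)))"

definition torus_has_modulus :: "complex set \<Rightarrow> complex \<Rightarrow> bool" where
  "torus_has_modulus \<Lambda> \<tau> \<longleftrightarrow>
     Im \<tau> > 0 \<and> (\<exists>f. torus_similarity \<Lambda> (lattice_gen 1 \<tau>) f)"

definition SL2Z_equivalent :: "complex \<Rightarrow> complex \<Rightarrow> bool" where
  "SL2Z_equivalent \<tau> \<tau>' \<longleftrightarrow>
     (\<exists>a b c d :: int. a * d - b * c = 1 \<and>
        \<tau>' = (of_int a * \<tau> + of_int b) / (of_int c * \<tau> + of_int d))"

definition triangle_vertices :: "'a::real_vector set \<Rightarrow> bool" where
  "triangle_vertices S \<longleftrightarrow> card S = 3 \<and> \<not> affine_dependent S"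

text \<open>
  A flat triangle of the torus is the injective image of a triangle of the plane, and is given
  here by the vertex set of such a lift.  Distinct triangles meet in a common proper face: the
  empty set, a vertex or an edge.
\<close>

definition flat_triangulation :: "complex set \<Rightarrow> complex set set \<Rightarrow> bool" where
  "flat_triangulation \<Lambda> K \<longleftrightarrow>
     finite K \<and>
     (\<forall>S\<in>K. triangle_vertices S \<and> inj_on (torus_proj \<Lambda>) (convex hull S)) \<and>
     (\<Union>S\<in>K. torus_proj \<Lambda> ` (convex hull S)) = torus \<Lambda> \<and>
     (\<forall>S\<in>K. \<forall>S'\<in>K. S \<noteq> S' \<longrightarrow>
        (\<exists>V V'. V \<subset> S \<and> V' \<subset> S' \<and>
           torus_proj \<Lambda> ` (convex hull S) \<inter> torus_proj \<Lambda> ` (convex hull S')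
             = torus_proj \<Lambda> ` (convex hull V) \<and>
           torus_proj \<Lambda> ` (convex hull V) = torus_proj \<Lambda> ` (convex hull V')))"

text \<open>
  Isometry on a triangle refers to the Euclidean metric of the triangle itself, hence to the
  distance in its lift; the quotient distance of the torus can be smaller.  The norm on
  \<^typ>\<open>complex \<times> real\<close> is the Euclidean one.
\<close>

definition origami_map ::
    "complex set \<Rightarrow> (complex set \<Rightarrow> complex \<times> real) \<Rightarrow> bool" where
  "origami_map \<Lambda> F \<longleftrightarrow>
     continuous_map (torus_topology \<Lambda>) euclidean F \<and>
     inj_on F (torus \<Lambda>) \<and>
     (\<exists>K. flat_triangulation \<Lambda> K \<and>
        (\<forall>S\<in>K.
           (\<forall>z\<in>convex hull S. \<forall>w\<in>convex hull S.
              dist (F (torus_proj \<Lambda> z)) (F (torus_proj \<Lambda> w)) = dist z w) \<and>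
           (\<exists>T. triangle_vertices T \<and>
              F ` torus_proj \<Lambda> ` (convex hull S) = convex hull T)))"

definition origami_embedded_flat_torus :: "complex \<Rightarrow> (complex \<times> real) set \<Rightarrow> bool" where
  "origami_embedded_flat_torus \<tau> M \<longleftrightarrow>
     (\<exists>\<Lambda> F. is_lattice \<Lambda> \<and> torus_has_modulus \<Lambda> \<tau> \<and>
        origami_map \<Lambda> F \<and> F ` torus \<Lambda> = M)"

definition P_pt :: "nat \<Rightarrow> nat \<Rightarrow> complex \<times> real" where
  "P_pt n k = (cis (2 * pi * real k / real n), 0)"

definition Q_pt :: "nat \<Rightarrow> real \<Rightarrow> real \<Rightarrow> nat \<Rightarrow> complex \<times> real" where
  "Q_pt n h \<rho> k = (cis (2 * pi * \<rho> + 2 * pi * real k / real n), h)"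

definition annulus :: "nat \<Rightarrow> real \<Rightarrow> real \<Rightarrow> (complex \<times> real) set" where
  "annulus n h \<rho> =
     (\<Union>k<n. convex hull {P_pt n k, P_pt n (k + 1), Q_pt n h \<rho> (k + 1)} \<union>
             convex hull {Q_pt n h \<rho> (k + 1), Q_pt n h \<rho> k, P_pt n k})"

end

theory Submission
  imports Defs
begin

text \<open>
  Put \<open>\<epsilon> = \<pi> / n\<close> and describe an annulus by the angle \<open>\<psi> = 2 \<pi> \<rho> + \<epsilon>\<close> instead of \<open>\<rho>\<close>.  All its
  triangles are congruent, so it unrolls to a flat strip between two parallel lines.  The strip has
  circumference \<open>2 n sin \<epsilon>\<close>, its height is the square root of \<open>h\<^sup>2 + (cos \<epsilon> - cos \<psi>)\<^sup>2\<close>, and the top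
  vertex \<open>Q\<^sub>k\<close> is displaced horizontally by \<open>sin \<psi> - sin \<epsilon>\<close> against the bottom vertex \<open>P\<^sub>k\<close>.
  Take \<open>\<sigma> = \<rho> + l / n\<close> and put \<open>\<phi> = - \<pi> (2 \<rho> + (l + 1) / n)\<close>, so that the two angles are
  \<open>- \<phi> - l \<epsilon>\<close> and \<open>- \<phi> + l \<epsilon>\<close>.  Stacking the second strip, turned upside down, on the first gives a flat
  torus with periods \<open>\<omega>1 = 2 n sin \<epsilon>\<close> and \<open>\<omega>2\<close>, where the real part of \<open>\<omega>2 / \<omega>1\<close> is
  \<open>l / n - cos \<phi> sin (l \<epsilon>) / (n sin \<epsilon>)\<close> and the imaginary part is the sum of the heights divided by the
  circumference.

  \<^bold>\<open>Every modulus occurs.\<close>  Minimality of a lattice vector gives a representative of \<open>\<tau>\<close> with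
  \<open>0 \<le> Re < 1\<close> and \<open>Im\<^sup>2 \<ge> 3/4\<close> (\<open>SL2Z_reduced_representative\<close>); its real part is not \<open>0\<close>, for otherwise the
  modulus would be purely imaginary.  If \<open>n\<close> tends to infinity with \<open>l / n\<close> tending to \<open>t\<close>, then the
  real part of \<open>\<omega>2 / \<omega>1\<close> tends to \<open>t - cos \<phi> sin (\<pi> t) / \<pi>\<close> with \<open>- cos (\<pi> t) < cos \<phi> < 1\<close>, and such numbers
  exhaust the open unit interval as \<open>t\<close> varies.  The admissible range of \<open>cos \<phi>\<close> is open, hence a finite \<open>n\<close>
  already reaches a given real part.  The imaginary part grows continuously to infinity with \<open>h\<close>,
  from a value below \<open>4 / 5\<close> at \<open>h = 0\<close> (\<open>exists_parameters\<close>).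

  \<^bold>\<open>The surface is embedded.\<close>  At height \<open>a h\<close> an annulus is cut in a closed polygon of \<open>2 n\<close>
  sides which are parallel, alternately, to the edges of the bottom and of the top \<open>n\<close>-gon.  If two sides
  of one polygon met, then rotating by half of the angle between their normals turns the coincidence
  into one inequality between sines, and a product formula contradicts it (\<open>sides_same_family_aux\<close>,
  \<open>sides_opposite_families_aux\<close>).  The polygons of the two annuli are disjoint because the first lies inside
  the second: all its vertices are closer to the axis than those of the second, so that a common point
  would be close to the foot of the perpendicular on a side of the second, but there the line of that side
  leaves all vertices of the first on the side of the axis (\<open>level_polygons_disjoint\<close>).

  \<^bold>\<open>The surface is a triangulated flat torus.\<close>  Both the unrolled surface and the surface in space are
  piecewise linear images of the plane with vertices at the integer points, triangulated by the lines
  \<open>x \<in> \<int>\<close>, \<open>y \<in> \<int>\<close> and \<open>x - y \<in> \<int>\<close>.  Everything about quotients of this triangulation is proved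
  once, in the locale \<open>kuhn_torus\<close>; the condition that triangles of the torus meet in a common
  face comes down to \<open>l + 1\<close> not being \<open>0\<close>, \<open>1\<close> or \<open>2\<close> modulo \<open>n\<close>.
\<close>

section \<open>Horizontal sections of an annulus are simple polygons\<close>

text \<open>
  Two lines at the same signed distance \<open>d\<close> from the origin, with normals at the angles \<open>t\<close> and
  \<open>- t\<close>, meet at the point with coordinates \<open>s = - d tan t\<close> and \<open>s' = d tan t\<close> along them.  If both lie in
  the half-open interval of half-length \<open>e\<close> around \<open>m\<close>, then \<open>\<bar>s\<bar> + \<bar>m\<bar> \<le> e\<close>, while
  \<open>\<bar>s\<bar> \<ge> d tan \<epsilon>\<close> because \<open>t\<close> keeps the distance \<open>\<epsilon>\<close> from \<open>0\<close> and \<open>\<pi>\<close>.  Inserting \<open>d\<close>, \<open>m\<close>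
  and \<open>e\<close> leaves \<open>a sin (\<epsilon> + \<bar>\<psi>\<bar>) \<le> 0\<close>, so \<open>a = 0\<close>; in that case the
  strict upper bounds make the inequality strict, which is impossible.
\<close>

lemma sides_same_family_aux:
  fixes a b \<epsilon> \<psi> t s s' d m e :: real
  assumes e: "0 < \<epsilon>" "\<epsilon> < pi / 2" and psi: "\<bar>\<psi>\<bar> < pi - \<epsilon>"
    and t: "\<epsilon> \<le> t" "t \<le> pi - \<epsilon>" and ab: "0 \<le> a" "0 \<le> b"
    and d_def: "d = a * cos \<psi> + b * cos \<epsilon>" and m_def: "m = a * sin \<psi>" and e_def: "e = b * sin \<epsilon>"
    and s: "m - e \<le> s" "s < m + e" and s': "m - e \<le> s'" "s' < m + e"
    and eq: "cis t * Complex d s = cis (- t) * Complex d s'"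
  shows False
proof -
  have sin_t: "sin t > 0" using t e by (intro sin_gt_zero) auto
  have sin_e: "sin \<epsilon> > 0" using e by (intro sin_gt_zero) auto
  have cos_e: "cos \<epsilon> > 0" using e by (intro cos_gt_zero_pi) auto
  have st: "sin \<epsilon> \<le> sin t"
  proof (cases "t \<le> pi / 2")
    case True then show ?thesis using t e by (intro sin_monotone_2pi_le) auto
  next
    case False
    have "sin \<epsilon> \<le> sin (pi - t)" using False t e by (intro sin_monotone_2pi_le) auto
    then show ?thesis by simp
  qed
  have ct: "\<bar>cos t\<bar> \<le> cos \<epsilon>"
  proof -
    have "cos t \<le> cos \<epsilon>" using t e by (intro cos_monotone_0_pi_le) auto
    moreover have "cos (pi - t) \<le> cos \<epsilon>" using t e by (intro cos_monotone_0_pi_le) auto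
    ultimately show ?thesis by (simp add: abs_if)
  qed
  have re: "d * cos t - s * sin t = d * cos t + s' * sin t"
    and im: "s * cos t + d * sin t = s' * cos t - d * sin t"
    using eq by (auto simp: complex_eq_iff algebra_simps)
  have "(s + s') * sin t = 0" using re by (simp add: algebra_simps)
  then have s'_eq: "s' = - s" using sin_t by auto
  have foot: "d * sin t = - s * cos t" using im s'_eq by (simp add: algebra_simps)
  have s_le: "\<bar>s\<bar> + \<bar>m\<bar> \<le> e" using s s' s'_eq by (auto simp: abs_if)
  have "d * sin \<epsilon> \<le> \<bar>d\<bar> * sin t" using st sin_e
    by (meson abs_ge_self abs_ge_zero less_imp_le mult_mono order_trans)
  also have "\<bar>d\<bar> * sin t = \<bar>s\<bar> * \<bar>cos t\<bar>"
    using foot sin_t by (metis abs_minus_cancel abs_mult abs_of_pos)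
  also have "\<dots> \<le> \<bar>s\<bar> * cos \<epsilon>" using ct by (intro mult_left_mono) auto
  finally have ds: "d * sin \<epsilon> \<le> \<bar>s\<bar> * cos \<epsilon>" .
  also have "\<dots> \<le> (e - \<bar>m\<bar>) * cos \<epsilon>" using s_le cos_e by (intro mult_right_mono) auto
  finally have "a * (cos \<psi> * sin \<epsilon> + \<bar>sin \<psi>\<bar> * cos \<epsilon>) \<le> 0"
    using ab unfolding d_def m_def e_def by (simp add: algebra_simps abs_mult)
  moreover have "cos \<psi> * sin \<epsilon> + \<bar>sin \<psi>\<bar> * cos \<epsilon> = sin (\<epsilon> + \<bar>\<psi>\<bar>)"
  proof (cases "\<psi> \<ge> 0")
    case True
    then have "sin \<psi> \<ge> 0" using psi e by (intro sin_ge_zero) auto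
    then show ?thesis using True by (simp add: sin_add algebra_simps)
  next
    case False
    then have "sin (-\<psi>) \<ge> 0" using psi e by (intro sin_ge_zero) auto
    then show ?thesis using False by (simp add: sin_diff algebra_simps)
  qed
  moreover have "sin (\<epsilon> + \<bar>\<psi>\<bar>) > 0" using psi e by (intro sin_gt_zero) auto
  ultimately have a0: "a = 0" using ab by (smt (verit) mult_pos_pos)
  then have "\<bar>s\<bar> < e" using s s' s'_eq m_def by (auto simp: abs_if)
  then have "d * sin \<epsilon> < e * cos \<epsilon>" using ds cos_e
    by (meson le_less_trans mult_strict_right_mono)
  then show False unfolding d_def e_def a0 by (simp add: algebra_simps)
qed

text \<open>
  Here the signed distances of the two lines add up to \<open>cos \<psi> + cos \<epsilon>\<close>, the centres of the two sides have
  coordinates differing by \<open>sin \<psi>\<close>, and the half-lengths add up to \<open>sin \<epsilon>\<close>: none of these sums depends on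
  the weights \<open>a\<close> and \<open>b\<close>, that is, on the height of the section.  The bisecting angle \<open>h\<close> isolates exactly
  these sums in the imaginary part of the equation.
\<close>

lemma sides_opposite_families_aux:
  fixes a b \<epsilon> \<psi> s s' :: real and k n :: int
  assumes n: "3 \<le> n" "\<epsilon> = pi / n" and psi: "\<bar>\<psi>\<bar> < pi - \<epsilon>"
    and k: "0 \<le> k" "k < n" and ab: "a + b = 1"
    and s: "a * sin \<psi> - b * sin \<epsilon> \<le> s" "s < a * sin \<psi> + b * sin \<epsilon>"
    and s': "- b * sin \<psi> - a * sin \<epsilon> \<le> s'" "s' < - b * sin \<psi> + a * sin \<epsilon>"
    and h: "2 * h = \<psi> - (2 * k + 1) * \<epsilon>"
    and eq: "cis (- h) * Complex (a * cos \<psi> + b * cos \<epsilon>) s = cis h * Complex (b * cos \<psi> + a * cos \<epsilon>) s'"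
  shows False
proof -
  define D where "D = (s - a * sin \<psi>) - (s' + b * sin \<psi>)"
  have ne: "n * \<epsilon> = pi" using n by simp
  have e0: "\<epsilon> > 0" using n by simp
  \<comment> \<open>imaginary part of \<open>eq\<close>\<close>
  have "(s - s') * cos h = ((a * cos \<psi> + b * cos \<epsilon>) + (b * cos \<psi> + a * cos \<epsilon>)) * sin h"
    using eq by (auto simp: complex_eq_iff algebra_simps)
  also have "\<dots> = (a + b) * (cos \<psi> + cos \<epsilon>) * sin h" by (simp add: algebra_simps)
  finally have ss: "(s - s') * cos h = (cos \<psi> + cos \<epsilon>) * sin h" using ab by simp
  have "D = s - s' - (a + b) * sin \<psi>" unfolding D_def by (simp add: algebra_simps)
  then have "D = s - s' - sin \<psi>" using ab by simp
  then have "D * cos h = (s - s') * cos h - sin \<psi> * cos h" by (simp add: left_diff_distrib)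
  then have "D * cos h = (cos \<psi> + cos \<epsilon>) * sin h - sin \<psi> * cos h"
    using ss by simp
  also have "\<dots> = sin (h - \<psi>) + cos \<epsilon> * sin h" by (simp add: sin_diff algebra_simps)
  also have "h - \<psi> = - (h + (2 * k + 1) * \<epsilon>)" using h by simp
  finally have D: "D * cos h = cos \<epsilon> * sin h - sin (h + (2 * k + 1) * \<epsilon>)"
    unfolding sin_minus by simp
  have "D < (a + b) * sin \<epsilon>" "- ((a + b) * sin \<epsilon>) < D"
    using s s' unfolding D_def by (simp_all add: algebra_simps)
  then have Dlt: "\<bar>D\<bar> < sin \<epsilon>" using ab by auto
  define U where "U = h + (2 * k + 1) * \<epsilon>"
  have "(D * cos h - sin \<epsilon> * cos h) * (D * cos h + sin \<epsilon> * cos h)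
      = (sin (h - \<epsilon>) - sin U) * (sin (h + \<epsilon>) - sin U)"
    unfolding D U_def[symmetric] by (simp add: sin_add sin_diff algebra_simps)
  also have "sin (h - \<epsilon>) - sin U = 2 * sin ((h - \<epsilon> - U) / 2) * cos ((h - \<epsilon> + U) / 2)"
    by (rule sin_diff_sin)
  also have "sin (h + \<epsilon>) - sin U = 2 * sin ((h + \<epsilon> - U) / 2) * cos ((h + \<epsilon> + U) / 2)"
    by (rule sin_diff_sin)
  also have "(h - \<epsilon> - U) / 2 = - ((k + 1) * \<epsilon>)" unfolding U_def by (simp add: field_simps)
  also have "(h + \<epsilon> - U) / 2 = - (k * \<epsilon>)" unfolding U_def by (simp add: algebra_simps)
  also have "(h - \<epsilon> + U) / 2 = (\<psi> - \<epsilon>) / 2" unfolding U_def using h by (simp add: algebra_simps)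
  also have "(h + \<epsilon> + U) / 2 = (\<psi> + \<epsilon>) / 2" unfolding U_def using h by (simp add: algebra_simps)
  finally have prod: "(D * cos h - sin \<epsilon> * cos h) * (D * cos h + sin \<epsilon> * cos h)
      = 4 * (sin ((k + 1) * \<epsilon>) * sin (k * \<epsilon>)) * (cos ((\<psi> - \<epsilon>) / 2) * cos ((\<psi> + \<epsilon>) / 2))"
    by simp
  \<comment> \<open>\<open>\<bar>D\<bar> < sin \<epsilon>\<close> makes this product negative, but its factorization shows that it is not\<close>
  have c1: "cos ((\<psi> - \<epsilon>) / 2) > 0" using psi e0 by (intro cos_gt_zero_pi) (auto simp: abs_if split: if_splits)
  have c2: "cos ((\<psi> + \<epsilon>) / 2) > 0" using psi e0 by (intro cos_gt_zero_pi) (auto simp: abs_if split: if_splits)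
  have k1: "(k + 1) * \<epsilon> \<le> pi"
    using k e0 ne by (metis less_eq_real_def mult_right_mono of_int_le_iff zless_imp_add1_zle of_int_1 of_int_add)
  have s1: "sin ((k + 1) * \<epsilon>) \<ge> 0" using k e0 k1 by (intro sin_ge_zero) auto
  have s0: "sin (k * \<epsilon>) \<ge> 0" using k e0 k1 by (intro sin_ge_zero) (auto simp: algebra_simps)
  have ge: "(D * cos h - sin \<epsilon> * cos h) * (D * cos h + sin \<epsilon> * cos h) \<ge> 0"
    unfolding prod using s0 s1 c1 c2 by simp
  have "(D * cos h - sin \<epsilon> * cos h) * (D * cos h + sin \<epsilon> * cos h) = (D\<^sup>2 - (sin \<epsilon>)\<^sup>2) * (cos h)\<^sup>2"
    by (simp add: algebra_simps power2_eq_square)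
  moreover have "D\<^sup>2 < (sin \<epsilon>)\<^sup>2" using Dlt by (metis abs_ge_zero power2_abs power_strict_mono zero_less_numeral)
  ultimately have "cos h = 0" using ge by (smt (verit) mult_neg_pos zero_less_power2)
  then have "sin ((k + 1) * \<epsilon>) * sin (k * \<epsilon>) = 0" using prod c1 c2 by simp
  then consider "k = 0" | "k = n - 1"
  proof -
    have False if "0 < k" "k < n - 1"
    proof -
      have "(k + 1) * \<epsilon> < n * \<epsilon>" using that e0 by (intro mult_strict_right_mono) linarith+
      then have "sin ((k + 1) * \<epsilon>) > 0" "sin (k * \<epsilon>) > 0"
        using that e0 ne by (auto intro!: sin_gt_zero mult_pos_pos simp: algebra_simps add_pos_pos)
      then show False using \<open>sin ((k + 1) * \<epsilon>) * sin (k * \<epsilon>) = 0\<close> by simp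
    qed
    then show thesis using k that by (cases "k = 0"; cases "k = n - 1") auto
  qed
  then show False
  proof cases
    case 1
    then have "h = (\<psi> - \<epsilon>) / 2" using h by simp
    then have "cos h > 0" using c1 by (simp only:)
    then show False using \<open>cos h = 0\<close> by simp
  next
    case 2
    have "h = (\<psi> + \<epsilon>) / 2 - n * \<epsilon>" using h 2 by (simp add: field_simps)
    then have "h = (\<psi> + \<epsilon>) / 2 - pi" using ne by simp
    then have "cos h = - cos ((\<psi> + \<epsilon>) / 2)" by (simp add: cos_diff)
    then show False using c2 \<open>cos h = 0\<close> by simp
  qed
qed

text \<open>
  The section with weight \<open>b\<close> on the bottom and \<open>a\<close> on the top has two kinds of sides, parallel to the edges
  of the bottom polygon or of the top polygon.  A point is given by the index \<open>k\<close> of its side, which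
  determines the direction of the normal, and by its coordinate \<open>s\<close> along the side, measured from the foot of
  the perpendicular from the axis; the first entry of \<^const>\<open>Complex\<close> is the signed distance of the side from
  the axis.
\<close>

definition bottom_side :: "real \<Rightarrow> real \<Rightarrow> real \<Rightarrow> real \<Rightarrow> int \<Rightarrow> real \<Rightarrow> complex" where
  "bottom_side \<epsilon> \<psi> a b k s = cis ((2 * k + 1) * \<epsilon>) * Complex (a * cos \<psi> + b * cos \<epsilon>) s"

definition top_side :: "real \<Rightarrow> real \<Rightarrow> real \<Rightarrow> real \<Rightarrow> int \<Rightarrow> real \<Rightarrow> complex" where
  "top_side \<epsilon> \<psi> a b k s = cis (\<psi> + 2 * k * \<epsilon>) * Complex (b * cos \<psi> + a * cos \<epsilon>) s"

definition level_polygon :: "real \<Rightarrow> real \<Rightarrow> real \<Rightarrow> real \<Rightarrow> complex set" where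
  "level_polygon \<epsilon> \<psi> a b =
     {bottom_side \<epsilon> \<psi> a b k s | k s. a * sin \<psi> - b * sin \<epsilon> \<le> s \<and> s \<le> a * sin \<psi> + b * sin \<epsilon>} \<union>
     {top_side \<epsilon> \<psi> a b k s | k s. - b * sin \<psi> - a * sin \<epsilon> \<le> s \<and> s \<le> - b * sin \<psi> + a * sin \<epsilon>}"

lemma bottom_side_mem:
  "a * sin \<psi> - b * sin \<epsilon> \<le> s \<Longrightarrow> s \<le> a * sin \<psi> + b * sin \<epsilon> \<Longrightarrow>
    bottom_side \<epsilon> \<psi> a b k s \<in> level_polygon \<epsilon> \<psi> a b"
  unfolding level_polygon_def by blast

lemma top_side_mem:
  "- b * sin \<psi> - a * sin \<epsilon> \<le> s \<Longrightarrow> s \<le> - b * sin \<psi> + a * sin \<epsilon> \<Longrightarrow>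
    top_side \<epsilon> \<psi> a b k s \<in> level_polygon \<epsilon> \<psi> a b"
  unfolding level_polygon_def by blast

lemma cis_period:
  fixes \<epsilon> :: real
  assumes "real_of_int n * \<epsilon> = pi" shows "cis (x + 2 * real_of_int (n * q) * \<epsilon>) = cis x"
proof -
  have "2 * real_of_int (n * q) * \<epsilon> = 2 * pi * q" using assms by (simp add: algebra_simps)
  moreover have "cis (2 * pi * q) = 1" by (simp add: cis_multiple_2pi)
  ultimately show ?thesis by (metis cis_mult mult.right_neutral)
qed

text \<open>
  Rotating both sides of a coincidence brings it into the symmetric form that the two lemmas on meeting sides
  expect.
\<close>

lemma cis_eq_rotate:
  assumes "cis x * z = cis y * w" shows "cis (x + t) * z = cis (y + t) * w"
proof -
  have "cis t * (cis x * z) = cis t * (cis y * w)" using assms by simp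
  then show ?thesis by (simp add: cis_mult[symmetric] mult_ac)
qed

lemma step_angle_bounds:
  fixes n :: int and \<epsilon> :: real
  assumes "3 \<le> n" "\<epsilon> = pi / n" shows "0 < \<epsilon>" "\<epsilon> < pi / 2"
proof -
  show "0 < \<epsilon>" using assms by simp
  have "pi / n \<le> pi / 3" using assms by (intro divide_left_mono) auto
  then show "\<epsilon> < pi / 2" using assms pi_gt_zero by linarith
qed

lemma index_angle_bounds:
  fixes n r :: int and \<epsilon> :: real
  assumes "0 < n" "\<epsilon> = pi / n" "1 \<le> r" "r < n"
  shows "\<epsilon> \<le> r * \<epsilon>" "r * \<epsilon> \<le> pi - \<epsilon>"
proof -
  have e0: "\<epsilon> > 0" using assms by simp
  have ne: "n * \<epsilon> = pi" using assms by simp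
  have "1 * \<epsilon> \<le> r * \<epsilon>" using assms e0 by (intro mult_right_mono) linarith+
  then show "\<epsilon> \<le> r * \<epsilon>" by simp
  have "(r + 1) * \<epsilon> \<le> n * \<epsilon>" using assms e0 by (intro mult_right_mono) linarith+
  then show "r * \<epsilon> \<le> pi - \<epsilon>" using ne by (simp add: algebra_simps)
qed

text \<open>
  Common form of the two statements that follow: exchanging the weights and replacing \<open>\<psi>\<close> by \<open>- \<psi>\<close>
  exchanges the roles of the two kinds of sides.
\<close>

lemma rotated_sides_injective:
  fixes n k j :: int and \<epsilon> :: real
  assumes n: "3 \<le> n" "\<epsilon> = pi / n" and psi: "\<bar>\<psi>\<bar> < pi - \<epsilon>" and ab: "0 \<le> a" "0 \<le> b"
    and s: "a * sin \<psi> - b * sin \<epsilon> \<le> s" "s < a * sin \<psi> + b * sin \<epsilon>"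
    and s': "a * sin \<psi> - b * sin \<epsilon> \<le> s'" "s' < a * sin \<psi> + b * sin \<epsilon>"
    and eq: "cis (x + 2 * k * \<epsilon>) * Complex (a * cos \<psi> + b * cos \<epsilon>) s
           = cis (x + 2 * j * \<epsilon>) * Complex (a * cos \<psi> + b * cos \<epsilon>) s'"
  shows "n dvd k - j \<and> s = s'"
proof -
  define r where "r = (k - j) mod n"
  define q where "q = (k - j) div n"
  have r: "0 \<le> r" "r < n" using n by (auto simp: r_def)
  have kj: "k = j + r + n * q" unfolding r_def q_def by simp
  have ne: "n * \<epsilon> = pi" using n by simp
  have "cis (x + 2 * k * \<epsilon>) = cis (x + 2 * (j + r) * \<epsilon>)"
    using cis_period[OF ne, of "x + 2 * (j + r) * \<epsilon>" q] unfolding kj by (simp add: algebra_simps)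
  with eq have "cis (x + 2 * (j + r) * \<epsilon>) * Complex (a * cos \<psi> + b * cos \<epsilon>) s
     = cis (x + 2 * j * \<epsilon>) * Complex (a * cos \<psi> + b * cos \<epsilon>) s'" by simp
  from cis_eq_rotate[OF this, of "- x - 2 * j * \<epsilon> - r * \<epsilon>"]
  have eq2: "cis (r * \<epsilon>) * Complex (a * cos \<psi> + b * cos \<epsilon>) s
           = cis (- (r * \<epsilon>)) * Complex (a * cos \<psi> + b * cos \<epsilon>) s'"
    by (simp add: algebra_simps)
  have "r = 0"
  proof (rule ccontr)
    assume "r \<noteq> 0"
    then have "1 \<le> r" using r by simp
    moreover have "0 < \<epsilon>" "\<epsilon> < pi / 2" using step_angle_bounds[OF n] by auto
    ultimately show False
      using sides_same_family_aux[OF _ _ psi _ _ ab refl refl refl s s' eq2] index_angle_bounds[of n \<epsilon> r] n r by simp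
  qed
  then show ?thesis using eq2 r_def by (auto simp: complex_eq_iff)
qed

lemma bottom_side_inj:
  fixes n k j :: int and \<epsilon> :: real
  assumes n: "3 \<le> n" "\<epsilon> = pi / n" and psi: "\<bar>\<psi>\<bar> < pi - \<epsilon>" and ab: "0 \<le> a" "0 \<le> b"
    and s: "a * sin \<psi> - b * sin \<epsilon> \<le> s" "s < a * sin \<psi> + b * sin \<epsilon>"
    and s': "a * sin \<psi> - b * sin \<epsilon> \<le> s'" "s' < a * sin \<psi> + b * sin \<epsilon>"
    and eq: "bottom_side \<epsilon> \<psi> a b k s = bottom_side \<epsilon> \<psi> a b j s'"
  shows "n dvd k - j \<and> s = s'"
  by (rule rotated_sides_injective[OF n psi ab s s', of \<epsilon>]) (use eq in \<open>simp add: bottom_side_def algebra_simps\<close>)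

lemma top_side_inj:
  fixes n k j :: int and \<epsilon> :: real
  assumes n: "3 \<le> n" "\<epsilon> = pi / n" and psi: "\<bar>\<psi>\<bar> < pi - \<epsilon>" and ab: "0 \<le> a" "0 \<le> b"
    and s: "- b * sin \<psi> - a * sin \<epsilon> \<le> s" "s < - b * sin \<psi> + a * sin \<epsilon>"
    and s': "- b * sin \<psi> - a * sin \<epsilon> \<le> s'" "s' < - b * sin \<psi> + a * sin \<epsilon>"
    and eq: "top_side \<epsilon> \<psi> a b k s = top_side \<epsilon> \<psi> a b j s'"
  shows "n dvd k - j \<and> s = s'"
  by (rule rotated_sides_injective[OF n, of "-\<psi>" b a _ _ \<psi>]) (use psi ab s s' eq in \<open>simp_all add: top_side_def\<close>)

lemma bottom_side_neq_top_side:
  fixes n k j :: int and \<epsilon> :: real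
  assumes n: "3 \<le> n" "\<epsilon> = pi / n" and psi: "\<bar>\<psi>\<bar> < pi - \<epsilon>" and ab: "a + b = 1"
    and s: "a * sin \<psi> - b * sin \<epsilon> \<le> s" "s < a * sin \<psi> + b * sin \<epsilon>"
    and s': "- b * sin \<psi> - a * sin \<epsilon> \<le> s'" "s' < - b * sin \<psi> + a * sin \<epsilon>"
  shows "bottom_side \<epsilon> \<psi> a b k s \<noteq> top_side \<epsilon> \<psi> a b j s'"
proof
  assume eq: "bottom_side \<epsilon> \<psi> a b k s = top_side \<epsilon> \<psi> a b j s'"
  define r where "r = (k - j) mod n"
  define q where "q = (k - j) div n"
  have r: "0 \<le> r" "r < n" using n by (auto simp: r_def)
  have kj: "k = j + r + n * q" unfolding r_def q_def by simp
  have ne: "n * \<epsilon> = pi" using n by simp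
  have "cis ((2 * k + 1) * \<epsilon>) = cis ((2 * (j + r) + 1) * \<epsilon>)"
    using cis_period[OF ne, of "(2 * (j + r) + 1) * \<epsilon>" q] unfolding kj by (simp add: algebra_simps)
  with eq have eq1: "cis ((2 * (j + r) + 1) * \<epsilon>) * Complex (a * cos \<psi> + b * cos \<epsilon>) s
     = cis (\<psi> + 2 * j * \<epsilon>) * Complex (b * cos \<psi> + a * cos \<epsilon>) s'"
    by (simp add: bottom_side_def top_side_def)
  define h where "h = (\<psi> - (2 * r + 1) * \<epsilon>) / 2"
  have h: "2 * h = \<psi> - (2 * r + 1) * \<epsilon>" by (simp add: h_def)
  from cis_eq_rotate[OF eq1, of "- h - (2 * (j + r) + 1) * \<epsilon>"]
  have "cis (- h) * Complex (a * cos \<psi> + b * cos \<epsilon>) s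
      = cis h * Complex (b * cos \<psi> + a * cos \<epsilon>) s'"
    by (simp add: h_def algebra_simps add_divide_distrib diff_divide_distrib)
  from sides_opposite_families_aux[OF n psi r ab s s' h this] show False .
qed

text \<open>
  One period of the polygon, traversed with constant speed from one vertex on the edge \<open>P\<^sub>k Q\<^sub>k\<close> to the next:
  first the side parallel to a top edge, of relative length \<open>a\<close>, then the side parallel to a bottom edge.
\<close>

definition level_curve :: "real \<Rightarrow> real \<Rightarrow> real \<Rightarrow> real \<Rightarrow> int \<Rightarrow> real \<Rightarrow> complex" where
  "level_curve \<epsilon> \<psi> a b k w =
     (if w < a then top_side \<epsilon> \<psi> a b k (- b * sin \<psi> - a * sin \<epsilon> + 2 * w * sin \<epsilon>)
      else bottom_side \<epsilon> \<psi> a b k (a * sin \<psi> - b * sin \<epsilon> + 2 * (w - a) * sin \<epsilon>))"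

lemma level_curve_inj:
  fixes n k j :: int and \<epsilon> :: real
  assumes n: "3 \<le> n" "\<epsilon> = pi / n" and psi: "\<bar>\<psi>\<bar> < pi - \<epsilon>" and ab: "0 \<le> a" "0 \<le> b" "a + b = 1"
    and w: "0 \<le> w" "w < 1" "0 \<le> w'" "w' < 1"
    and eq: "level_curve \<epsilon> \<psi> a b k w = level_curve \<epsilon> \<psi> a b j w'"
  shows "n dvd k - j \<and> w = w'"
proof -
  have se: "sin \<epsilon> > 0" using step_angle_bounds[OF n] by (intro sin_gt_zero) auto
  have Q: "- b * sin \<psi> - a * sin \<epsilon> \<le> - b * sin \<psi> - a * sin \<epsilon> + 2 * v * sin \<epsilon>"
    "- b * sin \<psi> - a * sin \<epsilon> + 2 * v * sin \<epsilon> < - b * sin \<psi> + a * sin \<epsilon>" if "0 \<le> v" "v < a" for v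
    using se that by (auto simp: algebra_simps)
  have P: "a * sin \<psi> - b * sin \<epsilon> \<le> a * sin \<psi> - b * sin \<epsilon> + 2 * (v - a) * sin \<epsilon>"
    "a * sin \<psi> - b * sin \<epsilon> + 2 * (v - a) * sin \<epsilon> < a * sin \<psi> + b * sin \<epsilon>" if v: "v < 1" "\<not> v < a" for v
  proof -
    show "a * sin \<psi> - b * sin \<epsilon> \<le> a * sin \<psi> - b * sin \<epsilon> + 2 * (v - a) * sin \<epsilon>" using se v by simp
    have "v - a < b" using v(1) ab(3) by linarith
    then have "(v - a) * sin \<epsilon> < b * sin \<epsilon>" using se by (rule mult_strict_right_mono)
    then show "a * sin \<psi> - b * sin \<epsilon> + 2 * (v - a) * sin \<epsilon> < a * sin \<psi> + b * sin \<epsilon>" by linarith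
  qed
  consider (QQ) "w < a" "w' < a" | (PP) "\<not> w < a" "\<not> w' < a" | (QP) "w < a" "\<not> w' < a" | (PQ) "\<not> w < a" "w' < a" by blast
  then show ?thesis
  proof cases
    case QQ
    with eq have "top_side \<epsilon> \<psi> a b k (- b * sin \<psi> - a * sin \<epsilon> + 2 * w * sin \<epsilon>) = top_side \<epsilon> \<psi> a b j (- b * sin \<psi> - a * sin \<epsilon> + 2 * w' * sin \<epsilon>)"
      by (simp add: level_curve_def)
    from top_side_inj[OF n psi ab(1,2) Q[OF w(1) QQ(1)] Q[OF w(3) QQ(2)] this]
    show ?thesis using se by simp
  next
    case PP
    with eq have "bottom_side \<epsilon> \<psi> a b k (a * sin \<psi> - b * sin \<epsilon> + 2 * (w - a) * sin \<epsilon>) = bottom_side \<epsilon> \<psi> a b j (a * sin \<psi> - b * sin \<epsilon> + 2 * (w' - a) * sin \<epsilon>)"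
      by (simp add: level_curve_def)
    from bottom_side_inj[OF n psi ab(1,2) P[OF w(2) PP(1)] P[OF w(4) PP(2)] this]
    show ?thesis using se by simp
  next
    case QP
    then show ?thesis using eq bottom_side_neq_top_side[OF n psi ab(3) P[OF w(4) QP(2)] Q[OF w(1) QP(1)], of j k]
      by (simp add: level_curve_def)
  next
    case PQ
    then show ?thesis using eq bottom_side_neq_top_side[OF n psi ab(3) P[OF w(2) PQ(1)] Q[OF w(3) PQ(2)], of k j]
      by (simp add: level_curve_def)
  qed
qed

lemma level_curve_mem:
  assumes "sin \<epsilon> > 0" "0 \<le> w" "w < 1" "a + b = 1"
  shows "level_curve \<epsilon> \<psi> a b k w \<in> level_polygon \<epsilon> \<psi> a b"
proof (cases "w < a")
  case True
  have "- b * sin \<psi> - a * sin \<epsilon> + 2 * w * sin \<epsilon> \<le> - b * sin \<psi> + a * sin \<epsilon>"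
    using True assms by (auto simp: algebra_simps)
  moreover have "- b * sin \<psi> - a * sin \<epsilon> \<le> - b * sin \<psi> - a * sin \<epsilon> + 2 * w * sin \<epsilon>" using assms by simp
  ultimately show ?thesis unfolding level_curve_def using True by (simp only: if_True) (rule top_side_mem)
next
  case False
  have "w - a \<le> b" using assms(3,4) by linarith
  then have "(w - a) * sin \<epsilon> \<le> b * sin \<epsilon>" using assms(1) by (intro mult_right_mono) auto
  then have "a * sin \<psi> - b * sin \<epsilon> + 2 * (w - a) * sin \<epsilon> \<le> a * sin \<psi> + b * sin \<epsilon>" by linarith
  moreover have "a * sin \<psi> - b * sin \<epsilon> \<le> a * sin \<psi> - b * sin \<epsilon> + 2 * (w - a) * sin \<epsilon>" using assms False by simp
  ultimately show ?thesis unfolding level_curve_def using False by (simp only: if_False) (rule bottom_side_mem)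
qed


section \<open>The inner annulus lies inside the outer one\<close>

text \<open>
  Equivalent to \<open>cot p - cot q < cot x + cot y\<close>, which holds since \<open>cot p < cot y\<close> and
  \<open>- cot q = cot (\<pi> - q) < cot x\<close>.  The difference of the two sides is written out below so that no quotient
  is needed.
\<close>

lemma sin_prod_less:
  fixes x y p q :: real
  assumes "0 < x" "0 < y" "y < p" "p < q" "x < pi - q"
  shows "sin (q - p) * (sin x * sin y) < sin (x + y) * (sin p * sin q)"
proof -
  have id: "sin (x + y) * (sin p * sin q) - sin (q - p) * (sin x * sin y)
     = sin x * sin q * sin (p - y) + sin y * sin p * sin (q + x)"
    by (simp add: sin_add sin_diff algebra_simps)
  have "sin x > 0" "sin q > 0" "sin y > 0" "sin p > 0" "sin (p - y) > 0" "sin (q + x) > 0"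
    using assms by (auto intro!: sin_gt_zero)
  then have "sin x * sin q * sin (p - y) + sin y * sin p * sin (q + x) > 0"
    by (simp add: add_pos_pos)
  then show ?thesis using id by linarith
qed

text \<open>
  If \<open>i \<epsilon>\<close> does not lie between \<open>l \<epsilon>\<close> and \<open>\<phi>\<close>, the left side is not positive, and it is negative when
  the right side vanishes.  Otherwise \<open>central\<close> bounds \<open>a\<close>, and \<open>sin_prod_less\<close> applies with \<open>p\<close> and
  \<open>q\<close> the two angles on the right and \<open>x\<close>, \<open>y\<close> the two angles on the left, whose sum does not depend on \<open>i\<close>.
\<close>

lemma inner_vertex_below_line_aux:
  fixes n l i c :: int and \<epsilon> \<phi> a b :: real
  assumes n: "3 \<le> n" "\<epsilon> = pi / n" and l: "2 \<le> l" "l + 1 < n"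
    and phi: "\<epsilon> < \<phi>" "\<phi> < pi - (l + 1) * \<epsilon>" and ab: "0 < a" "0 < b"
    and central: "a * \<bar>sin (\<phi> - l * \<epsilon>)\<bar> < b * sin \<epsilon>"
    and i: "0 \<le> i" "i < n" and c: "c = 1 \<or> c = - 1"
  shows "a * (sin (\<phi> - i * \<epsilon>) * sin ((i - l) * \<epsilon>)) < b * (sin (i * \<epsilon>) * sin ((i + c) * \<epsilon>))"
proof -
  have e0: "\<epsilon> > 0" using step_angle_bounds[OF n] by simp
  have ne: "n * \<epsilon> = pi" using n by simp
  have scale: "x * \<epsilon> < y * \<epsilon> \<longleftrightarrow> x < y" for x y using e0 by simp
  have up: "j * \<epsilon> < pi" if "j < n" for j :: int
    using that e0 ne by (metis mult_strict_right_mono of_int_less_iff)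
  have up1: "(j + 1) * \<epsilon> \<le> pi" if "j < n" for j :: int
    using that e0 ne by (metis less_eq_real_def mult_right_mono of_int_le_iff zless_imp_add1_zle of_int_1 of_int_add)
  have spos: "sin (j * \<epsilon>) > 0" if "0 < j" "j < n" for j :: int
    using that e0 up by (intro sin_gt_zero) auto
  have lpos: "0 < l * \<epsilon>" "2 * \<epsilon> \<le> l * \<epsilon>" using l e0 by (auto intro!: mult_right_mono)
  have phi_l: "l * \<epsilon> + \<phi> + \<epsilon> < pi" using phi by (simp add: algebra_simps)
  consider "i = 0" | "c = -1" "i = 1" | "c = 1" "i = n - 1" | "0 < i" "0 < i + c" "i + c < n"
    using i c by linarith
  then show ?thesis
  proof cases
    case 1
    have "sin \<phi> > 0" using phi_l phi(1) e0 lpos by (intro sin_gt_zero) linarith+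
    then have "a * (sin \<phi> * sin (l * \<epsilon>)) > 0" using ab spos[of l] l by simp
    then show ?thesis using 1 by simp
  next
    case 2
    have "sin (\<phi> - \<epsilon>) > 0" using phi_l phi(1) e0 lpos by (intro sin_gt_zero) linarith+
    moreover have "sin ((l - 1) * \<epsilon>) > 0" using spos[of "l - 1"] l by simp
    moreover have "(1 - l) * \<epsilon> = - ((l - 1) * \<epsilon>)" by (simp add: algebra_simps)
    then have "sin ((1 - l) * \<epsilon>) = - sin ((l - 1) * \<epsilon>)" by (simp only: sin_minus)
    ultimately show ?thesis using 2 ab by (simp add: mult_pos_pos)
  next
    case 3
    have "sin (\<phi> + \<epsilon>) > 0" using phi_l phi(1) e0 lpos by (intro sin_gt_zero) linarith+
    moreover have "i * \<epsilon> = pi - \<epsilon>" unfolding 3(2) using ne by (simp add: left_diff_distrib)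
    then have turn: "\<phi> - i * \<epsilon> = (\<phi> + \<epsilon>) - pi" by simp
    have "sin (\<phi> - i * \<epsilon>) = - sin (\<phi> + \<epsilon>)" unfolding turn by (simp add: sin_diff)
    moreover have "sin ((i - l) * \<epsilon>) > 0" using spos[of "i - l"] 3 l by simp
    moreover have "sin ((i + c) * \<epsilon>) = 0" using 3 ne by simp
    ultimately show ?thesis using ab by (simp add: mult_pos_pos)
  next
    case 4
    define R where "R = sin (i * \<epsilon>) * sin ((i + c) * \<epsilon>)"
    have R0: "R > 0" unfolding R_def using spos[of i] spos[of "i + c"] 4 i by simp
    define p where "p = min (i * \<epsilon>) ((i + c) * \<epsilon>)"
    define q where "q = max (i * \<epsilon>) ((i + c) * \<epsilon>)"
    have pq: "q - p = \<epsilon>" "p < q" "sin p * sin q = R"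
      using c e0 unfolding p_def q_def R_def by (auto simp: algebra_simps min_def max_def)
    have p_ge: "i * \<epsilon> - \<epsilon> \<le> p" and q_le: "q \<le> i * \<epsilon> + \<epsilon>"
      using c e0 unfolding p_def q_def by (auto simp: algebra_simps)
    have il: "(i - l) * \<epsilon> = i * \<epsilon> - l * \<epsilon>" by (simp add: algebra_simps)
    have ipos: "0 < i * \<epsilon>" using 4 e0 by simp
    have b_il: "- pi < (i - l) * \<epsilon>" "(i - l) * \<epsilon> < pi"
      using up[of i] up[of l] ipos i(2) l(2) lpos(1) unfolding il by linarith+
    have bphi: "- pi < \<phi> - i * \<epsilon>" "\<phi> - i * \<epsilon> < pi"
      using up[of i] i(2) ipos phi_l phi(1) lpos e0 by linarith+
    \<comment> \<open>\<open>x\<close> and \<open>y\<close> are, in some order, the distances of \<open>i \<epsilon>\<close> from \<open>\<phi>\<close> and \<open>l \<epsilon>\<close>\<close>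
    have core: "a * (sin x * sin y) < b * R"
      if xy: "0 < x" "0 < y" "y < p" "x < pi - q" "sin (x + y) = \<bar>sin (\<phi> - l * \<epsilon>)\<bar>" for x y
    proof -
      have "sin \<epsilon> * (sin x * sin y) < sin (x + y) * R"
        using sin_prod_less[OF xy(1-3) pq(2) xy(4)] pq by simp
      then have "a * (sin \<epsilon> * (sin x * sin y)) < (a * sin (x + y)) * R"
        using ab by (simp add: mult.assoc)
      also have "\<dots> < (b * sin \<epsilon>) * R" using central xy(5) R0 by simp
      finally have "sin \<epsilon> * (a * (sin x * sin y)) < sin \<epsilon> * (b * R)" by (simp add: algebra_simps)
      moreover have "sin \<epsilon> > 0" using e0 step_angle_bounds[OF n] by (intro sin_gt_zero) auto
      ultimately show ?thesis by simp
    qed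
    consider (outside) "sin (\<phi> - i * \<epsilon>) * sin ((i - l) * \<epsilon>) \<le> 0"
      | (above) "l * \<epsilon> < i * \<epsilon>" "i * \<epsilon> < \<phi>" | (below) "i * \<epsilon> < l * \<epsilon>" "\<phi> < i * \<epsilon>"
    proof -
      have "sin (\<phi> - i * \<epsilon>) * sin ((i - l) * \<epsilon>) \<le> 0"
        if "\<not> (l * \<epsilon> < i * \<epsilon> \<and> i * \<epsilon> < \<phi>)" "\<not> (i * \<epsilon> < l * \<epsilon> \<and> \<phi> < i * \<epsilon>)"
      proof -
        have nonneg: "sin t \<ge> 0" if "0 \<le> t" "t < pi" for t using that by (intro sin_ge_zero) auto
        have nonpos: "sin t \<le> 0" if "- pi < t" "t \<le> 0" for t
          using nonneg[of "- t"] that by simp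
        have "(0 \<le> \<phi> - i * \<epsilon> \<and> (i - l) * \<epsilon> \<le> 0) \<or> (\<phi> - i * \<epsilon> \<le> 0 \<and> 0 \<le> (i - l) * \<epsilon>)"
          using that unfolding il by linarith
        then show ?thesis
          using nonneg nonpos b_il bphi by (metis mult_nonneg_nonpos mult_nonneg_nonpos2)
      qed
      then show thesis using that by blast
    qed
    then show ?thesis
    proof cases
      case outside
      then have "a * (sin (\<phi> - i * \<epsilon>) * sin ((i - l) * \<epsilon>)) \<le> 0" using ab by (simp add: mult_nonneg_nonpos)
      also have "0 < b * R" using ab R0 by simp
      finally show ?thesis unfolding R_def .
    next
      case above
      have "sin ((\<phi> - i * \<epsilon>) + (i - l) * \<epsilon>) = \<bar>sin (\<phi> - l * \<epsilon>)\<bar>"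
      proof -
        have "sin (\<phi> - l * \<epsilon>) \<ge> 0" using above phi_l lpos e0 by (intro sin_ge_zero) linarith+
        then show ?thesis unfolding il by simp
      qed
      then have "a * (sin (\<phi> - i * \<epsilon>) * sin ((i - l) * \<epsilon>)) < b * R"
        using above p_ge q_le phi_l lpos e0 il by - (rule core; linarith)
      then show ?thesis unfolding R_def .
    next
      case below
      have "sin ((l * \<epsilon> - i * \<epsilon>) + (i * \<epsilon> - \<phi>)) = \<bar>sin (\<phi> - l * \<epsilon>)\<bar>"
      proof -
        have "sin (l * \<epsilon> - \<phi>) \<ge> 0" using below up[of l] phi(1) l(2) e0 by (intro sin_ge_zero) linarith+
        moreover have "sin (l * \<epsilon> - \<phi>) = - sin (\<phi> - l * \<epsilon>)" by (metis minus_diff_eq sin_minus)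
        ultimately show ?thesis by simp
      qed
      then have "a * (sin (l * \<epsilon> - i * \<epsilon>) * sin (i * \<epsilon> - \<phi>)) < b * R"
        using below p_ge q_le phi_l phi(1) lpos e0 by - (rule core; linarith)
      moreover have "sin (\<phi> - i * \<epsilon>) = - sin (i * \<epsilon> - \<phi>)" "sin ((i - l) * \<epsilon>) = - sin (l * \<epsilon> - i * \<epsilon>)"
        unfolding il by (metis minus_diff_eq sin_minus)+
      ultimately show ?thesis unfolding R_def by (simp add: mult.commute)
    qed
  qed
qed

text \<open>
  The cosines on the left give the projections of the vertices of the inner polygon (one kind for each value
  of \<open>c\<close>) to the normal of a side of the outer polygon, and the right side is the distance of that side from
  the axis.  The hypothesis \<open>central\<close> says that the foot of the perpendicular from the axis lies inside the
  side.
\<close>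

lemma inner_vertex_below_line:
  fixes n l i c :: int and \<epsilon> \<phi> a b :: real
  assumes n: "3 \<le> n" "\<epsilon> = pi / n" and l: "2 \<le> l" "l + 1 < n"
    and phi: "\<epsilon> < \<phi>" "\<phi> < pi - (l + 1) * \<epsilon>" and ab: "0 < a" "0 < b"
    and central: "a * \<bar>sin (l * \<epsilon> - \<phi>)\<bar> < b * sin \<epsilon>" and c: "c = 1 \<or> c = - 1"
  shows "b * cos ((2 * i + c) * \<epsilon>) + a * cos (- \<phi> - l * \<epsilon> + 2 * i * \<epsilon>)
       < a * cos (l * \<epsilon> - \<phi>) + b * cos \<epsilon>"
proof -
  define r where "r = i mod n"
  define q where "q = i div n"
  have r: "0 \<le> r" "r < n" using n by (auto simp: r_def)
  have i: "i = r + n * q" unfolding r_def q_def by simp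
  have ne: "n * \<epsilon> = pi" using n by simp
  have e1: "cos ((2 * i + c) * \<epsilon>) = cos ((2 * r + c) * \<epsilon>)"
    using cis_period[OF ne, of "(2 * r + c) * \<epsilon>" q] unfolding i
    by (simp add: complex_eq_iff algebra_simps)
  have e2: "cos (- \<phi> - l * \<epsilon> + 2 * i * \<epsilon>) = cos (- \<phi> - l * \<epsilon> + 2 * r * \<epsilon>)"
    using cis_period[OF ne, of "- \<phi> - l * \<epsilon> + 2 * r * \<epsilon>" q] unfolding i
    by (simp add: complex_eq_iff algebra_simps)
  have "\<bar>sin (\<phi> - l * \<epsilon>)\<bar> = \<bar>sin (l * \<epsilon> - \<phi>)\<bar>" by (metis abs_minus_cancel minus_diff_eq sin_minus)
  then have main: "a * (sin (\<phi> - r * \<epsilon>) * sin ((r - l) * \<epsilon>)) < b * (sin (r * \<epsilon>) * sin ((r + c) * \<epsilon>))"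
    using inner_vertex_below_line_aux[OF n l phi ab _ r c] central by simp
  have d1: "cos (- \<phi> - l * \<epsilon> + 2 * r * \<epsilon>) - cos (l * \<epsilon> - \<phi>) = 2 * (sin (\<phi> - r * \<epsilon>) * sin ((r - l) * \<epsilon>))"
  proof -
    have "cos (- \<phi> - l * \<epsilon> + 2 * r * \<epsilon>) - cos (l * \<epsilon> - \<phi>)
       = 2 * sin ((- \<phi> - l * \<epsilon> + 2 * r * \<epsilon> + (l * \<epsilon> - \<phi>)) / 2)
           * sin ((l * \<epsilon> - \<phi> - (- \<phi> - l * \<epsilon> + 2 * r * \<epsilon>)) / 2)" by (rule cos_diff_cos)
    also have "(- \<phi> - l * \<epsilon> + 2 * r * \<epsilon> + (l * \<epsilon> - \<phi>)) / 2 = - (\<phi> - r * \<epsilon>)" by (simp add: field_simps)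
    also have "(l * \<epsilon> - \<phi> - (- \<phi> - l * \<epsilon> + 2 * r * \<epsilon>)) / 2 = - ((r - l) * \<epsilon>)" by (simp add: field_simps)
    finally show ?thesis unfolding sin_minus by simp
  qed
  have d2: "cos \<epsilon> - cos ((2 * r + c) * \<epsilon>) = 2 * (sin (r * \<epsilon>) * sin ((r + c) * \<epsilon>))"
  proof -
    have "cos (c * \<epsilon>) - cos ((2 * r + c) * \<epsilon>)
       = 2 * sin ((c * \<epsilon> + (2 * r + c) * \<epsilon>) / 2) * sin (((2 * r + c) * \<epsilon> - c * \<epsilon>) / 2)" by (rule cos_diff_cos)
    also have "(c * \<epsilon> + (2 * r + c) * \<epsilon>) / 2 = (r + c) * \<epsilon>" by (simp add: field_simps)
    also have "((2 * r + c) * \<epsilon> - c * \<epsilon>) / 2 = r * \<epsilon>" by (simp add: field_simps)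
    finally show ?thesis using c by auto
  qed
  have "a * (cos (- \<phi> - l * \<epsilon> + 2 * r * \<epsilon>) - cos (l * \<epsilon> - \<phi>)) < b * (cos \<epsilon> - cos ((2 * r + c) * \<epsilon>))"
    unfolding d1 d2 using main by simp
  then show ?thesis unfolding e1 e2 by (simp add: algebra_simps)
qed

lemma affine_less_between:
  fixes s :: real
  assumes "lo \<le> s" "s \<le> hi" "\<alpha> + \<beta> * lo < \<delta>" "\<alpha> + \<beta> * hi < \<delta>"
  shows "\<alpha> + \<beta> * s < \<delta>"
proof (cases "\<beta> \<ge> 0")
  case True
  then have "\<beta> * s \<le> \<beta> * hi" using assms by (intro mult_left_mono) auto
  then show ?thesis using assms by linarith
next
  case False
  then have "\<beta> * s \<le> \<beta> * lo" using assms by (intro mult_left_mono_neg) auto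
  then show ?thesis using assms by linarith
qed

text \<open>
  A half-plane containing all vertices contains the polygon.  The bounds \<open>B\<close> and \<open>C\<close> are those for
  the vertices on the edges \<open>P\<^sub>i Q\<^sub>i\<close> and \<open>P\<^sub>i Q\<^sub>i\<^sub>+\<^sub>1\<close>, up to a shift of the index.
\<close>

lemma level_polygon_below_line:
  assumes x: "x \<in> level_polygon \<epsilon> \<psi> a b"
    and B: "\<And>i. b * cos ((2 * of_int i + 1) * \<epsilon>) + a * cos (\<psi> + 2 * of_int i * \<epsilon>) < \<delta>"
    and C: "\<And>i. b * cos ((2 * of_int i - 1) * \<epsilon>) + a * cos (\<psi> + 2 * of_int i * \<epsilon>) < \<delta>"
  shows "Re (cis (- (2 * of_int k + 1) * \<epsilon>) * x) < \<delta>"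
proof -
  have cis_m: "cis (- (2 * of_int k + 1) * \<epsilon>) * (cis t * z) = cis (t - (2 * of_int k + 1) * \<epsilon>) * z" for t z
    unfolding mult.assoc[symmetric] cis_mult by (simp add: algebra_simps)
  show ?thesis
    using x unfolding level_polygon_def
  proof (elim UnE CollectE exE conjE)
    fix j s assume x: "x = bottom_side \<epsilon> \<psi> a b j s" and s: "a * sin \<psi> - b * sin \<epsilon> \<le> s" "s \<le> a * sin \<psi> + b * sin \<epsilon>"
    define t where "t = 2 * of_int (j - k) * \<epsilon>"
    have "Re (cis (- (2 * of_int k + 1) * \<epsilon>) * x) = cos t * (a * cos \<psi> + b * cos \<epsilon>) + (- sin t) * s"
      unfolding x bottom_side_def cis_m t_def by (simp add: algebra_simps)
    moreover have "cos t * (a * cos \<psi> + b * cos \<epsilon>) + (- sin t) * s < \<delta>"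
    proof (rule affine_less_between[OF s])
      have "cos t * (a * cos \<psi> + b * cos \<epsilon>) + - sin t * (a * sin \<psi> - b * sin \<epsilon>)
          = b * cos (t - \<epsilon>) + a * cos (\<psi> + t)" by (simp add: cos_add cos_diff algebra_simps)
      then show "cos t * (a * cos \<psi> + b * cos \<epsilon>) + - sin t * (a * sin \<psi> - b * sin \<epsilon>) < \<delta>"
        using C[of "j - k"] by (simp add: t_def algebra_simps)
      have "cos t * (a * cos \<psi> + b * cos \<epsilon>) + - sin t * (a * sin \<psi> + b * sin \<epsilon>)
          = b * cos (t + \<epsilon>) + a * cos (\<psi> + t)" by (simp add: cos_add cos_diff algebra_simps)
      then show "cos t * (a * cos \<psi> + b * cos \<epsilon>) + - sin t * (a * sin \<psi> + b * sin \<epsilon>) < \<delta>"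
        using B[of "j - k"] by (simp add: t_def algebra_simps)
    qed
    ultimately show ?thesis by simp
  next
    fix j s assume x: "x = top_side \<epsilon> \<psi> a b j s" and s: "- b * sin \<psi> - a * sin \<epsilon> \<le> s" "s \<le> - b * sin \<psi> + a * sin \<epsilon>"
    define t where "t = \<psi> + 2 * of_int (j - k) * \<epsilon> - \<epsilon>"
    have "Re (cis (- (2 * of_int k + 1) * \<epsilon>) * x) = cos t * (b * cos \<psi> + a * cos \<epsilon>) + (- sin t) * s"
      unfolding x top_side_def cis_m t_def by (simp add: algebra_simps)
    moreover have "cos t * (b * cos \<psi> + a * cos \<epsilon>) + (- sin t) * s < \<delta>"
    proof (rule affine_less_between[OF s])
      have "cos t * (b * cos \<psi> + a * cos \<epsilon>) + - sin t * (- b * sin \<psi> - a * sin \<epsilon>)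
          = b * cos (t - \<psi>) + a * cos (t - \<epsilon>)" by (simp add: cos_add cos_diff algebra_simps)
      then show "cos t * (b * cos \<psi> + a * cos \<epsilon>) + - sin t * (- b * sin \<psi> - a * sin \<epsilon>) < \<delta>"
        using B[of "j - k - 1"] by (simp add: t_def algebra_simps)
      have "cos t * (b * cos \<psi> + a * cos \<epsilon>) + - sin t * (- b * sin \<psi> + a * sin \<epsilon>)
          = b * cos (t - \<psi>) + a * cos (t + \<epsilon>)" by (simp add: cos_add cos_diff algebra_simps)
      then show "cos t * (b * cos \<psi> + a * cos \<epsilon>) + - sin t * (- b * sin \<psi> + a * sin \<epsilon>) < \<delta>"
        using C[of "j - k"] by (simp add: t_def algebra_simps)
    qed
    ultimately show ?thesis by simp
  qed
qed

lemma square_le_max: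
  fixes s :: real
  assumes "lo \<le> s" "s \<le> hi" "lo\<^sup>2 < R" "hi\<^sup>2 < R" shows "s\<^sup>2 < R"
proof (cases "s \<ge> 0")
  case True then have "s\<^sup>2 \<le> hi\<^sup>2" using assms by (intro power_mono) auto
  then show ?thesis using assms by simp
next
  case False then have "(-s)\<^sup>2 \<le> (-lo)\<^sup>2" using assms by (intro power_mono) auto
  then show ?thesis using assms by simp
qed

text \<open>
  The ends of a side are the vertices of the polygon, whose distance from the axis depends on the kind
  of the vertex only.
\<close>

lemma bottom_side_end_radii:
  fixes a b :: real
  shows "(a * cos \<psi> + b * cos \<epsilon>)\<^sup>2 + (a * sin \<psi> - b * sin \<epsilon>)\<^sup>2 = a\<^sup>2 + b\<^sup>2 + 2 * (a * b) * cos (\<psi> + \<epsilon>)"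
    "(a * cos \<psi> + b * cos \<epsilon>)\<^sup>2 + (a * sin \<psi> + b * sin \<epsilon>)\<^sup>2 = a\<^sup>2 + b\<^sup>2 + 2 * (a * b) * cos (\<psi> - \<epsilon>)"
proof -
  have *: "(sin x)\<^sup>2 = 1 - (cos x)\<^sup>2" for x :: real by (simp add: sin_squared_eq)
  show "(a * cos \<psi> + b * cos \<epsilon>)\<^sup>2 + (a * sin \<psi> - b * sin \<epsilon>)\<^sup>2 = a\<^sup>2 + b\<^sup>2 + 2 * (a * b) * cos (\<psi> + \<epsilon>)"
    "(a * cos \<psi> + b * cos \<epsilon>)\<^sup>2 + (a * sin \<psi> + b * sin \<epsilon>)\<^sup>2 = a\<^sup>2 + b\<^sup>2 + 2 * (a * b) * cos (\<psi> - \<epsilon>)"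
    by (simp_all add: power2_sum power2_diff power_mult_distrib * cos_add cos_diff algebra_simps)
qed

lemma norm_bottom_side: "(norm (bottom_side \<epsilon> \<psi> a b k s))\<^sup>2 = (a * cos \<psi> + b * cos \<epsilon>)\<^sup>2 + s\<^sup>2"
  by (simp add: bottom_side_def norm_mult cmod_power2)

lemma norm_top_side: "(norm (top_side \<epsilon> \<psi> a b k s))\<^sup>2 = (b * cos \<psi> + a * cos \<epsilon>)\<^sup>2 + s\<^sup>2"
  by (simp add: top_side_def norm_mult cmod_power2)

lemma level_polygon_radius_less:
  assumes x: "x \<in> level_polygon \<epsilon> \<psi> a b"
    and R: "a\<^sup>2 + b\<^sup>2 + 2 * (a * b) * cos (\<psi> + \<epsilon>) < R" "a\<^sup>2 + b\<^sup>2 + 2 * (a * b) * cos (\<psi> - \<epsilon>) < R"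
  shows "(norm x)\<^sup>2 < R"
  using x unfolding level_polygon_def
proof (elim UnE CollectE exE conjE)
  fix j s assume x: "x = bottom_side \<epsilon> \<psi> a b j s" and s: "a * sin \<psi> - b * sin \<epsilon> \<le> s" "s \<le> a * sin \<psi> + b * sin \<epsilon>"
  have "s\<^sup>2 < R - (a * cos \<psi> + b * cos \<epsilon>)\<^sup>2"
    using R bottom_side_end_radii[of a \<psi> b \<epsilon>] by (intro square_le_max[OF s]) linarith+
  then show ?thesis unfolding x norm_bottom_side by simp
next
  fix j s assume x: "x = top_side \<epsilon> \<psi> a b j s" and s: "- b * sin \<psi> - a * sin \<epsilon> \<le> s" "s \<le> - b * sin \<psi> + a * sin \<epsilon>"
  have "(b * cos \<psi> + a * cos \<epsilon>)\<^sup>2 + (- b * sin \<psi> - a * sin \<epsilon>)\<^sup>2 < R"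
    "(b * cos \<psi> + a * cos \<epsilon>)\<^sup>2 + (- b * sin \<psi> + a * sin \<epsilon>)\<^sup>2 < R"
    using R bottom_side_end_radii[of b "-\<psi>" a \<epsilon>]
    by (simp_all add: mult.commute[of b a] add.commute[of "b\<^sup>2" "a\<^sup>2"] add.commute[of \<epsilon> \<psi>] cos_minus[symmetric, of "\<epsilon> - \<psi>"]
         cos_minus[symmetric, of "- \<psi> - \<epsilon>"])
  then have "s\<^sup>2 < R - (b * cos \<psi> + a * cos \<epsilon>)\<^sup>2" by (intro square_le_max[OF s]) linarith+
  then show ?thesis unfolding x norm_top_side by simp
qed

text \<open>
  The radius of a vertex is an increasing function of the cosine of \<open>\<psi> \<plusminus> \<epsilon>\<close>, so all vertices of the inner
  polygon are closer to the axis than all vertices of the outer one.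
\<close>

lemma inner_outer_cos:
  fixes n l :: int and \<epsilon> \<phi> c c' :: real
  assumes n: "3 \<le> n" "\<epsilon> = pi / n" and l: "2 \<le> l"
    and phi: "\<epsilon> < \<phi>" "\<phi> < pi - (l + 1) * \<epsilon>" and c: "c = 1 \<or> c = -1" "c' = 1 \<or> c' = -1"
  shows "cos (- \<phi> - l * \<epsilon> + c * \<epsilon>) < cos (l * \<epsilon> - \<phi> + c' * \<epsilon>)"
proof -
  have e0: "\<epsilon> > 0" using step_angle_bounds[OF n] by simp
  have phi_l: "l * \<epsilon> + \<phi> + \<epsilon> < pi" using phi by (simp add: algebra_simps)
  have l2: "2 * \<epsilon> \<le> l * \<epsilon>" using l e0 by (auto intro!: mult_right_mono)
  have "cos (l * \<epsilon> - \<phi> + c' * \<epsilon>) - cos (- \<phi> - l * \<epsilon> + c * \<epsilon>)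
      = 2 * sin ((l * \<epsilon> - \<phi> + c' * \<epsilon> + (- \<phi> - l * \<epsilon> + c * \<epsilon>)) / 2)
          * sin ((- \<phi> - l * \<epsilon> + c * \<epsilon> - (l * \<epsilon> - \<phi> + c' * \<epsilon>)) / 2)" by (rule cos_diff_cos)
  also have "(l * \<epsilon> - \<phi> + c' * \<epsilon> + (- \<phi> - l * \<epsilon> + c * \<epsilon>)) / 2 = - (\<phi> - (c + c') / 2 * \<epsilon>)"
    by (simp add: field_simps)
  also have "(- \<phi> - l * \<epsilon> + c * \<epsilon> - (l * \<epsilon> - \<phi> + c' * \<epsilon>)) / 2 = - (l * \<epsilon> - (c - c') / 2 * \<epsilon>)"
    by (simp add: field_simps)
  finally have eq: "cos (l * \<epsilon> - \<phi> + c' * \<epsilon>) - cos (- \<phi> - l * \<epsilon> + c * \<epsilon>)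
     = 2 * (sin (\<phi> - (c + c') / 2 * \<epsilon>) * sin (l * \<epsilon> - (c - c') / 2 * \<epsilon>))" unfolding sin_minus by simp
  have "sin (\<phi> - (c + c') / 2 * \<epsilon>) > 0" "sin (l * \<epsilon> - (c - c') / 2 * \<epsilon>) > 0"
    using c phi(1) phi_l l2 e0 by (elim disjE; intro sin_gt_zero; simp; linarith)+
  then have "2 * (sin (\<phi> - (c + c') / 2 * \<epsilon>) * sin (l * \<epsilon> - (c - c') / 2 * \<epsilon>)) > 0" by simp
  then show ?thesis using eq by linarith
qed

text \<open>
  A point of the inner polygon is closer to the axis than both ends of the outer side.  Being on that side, it
  forces the foot of the perpendicular into the side, and then the line of the side separates it from
  the inner polygon.
\<close>

lemma inner_polygon_off_outer_bottom_side:
  fixes n l k :: int and \<epsilon> \<phi> a b :: real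
  assumes n: "3 \<le> n" "\<epsilon> = pi / n" and l: "2 \<le> l" "l + 1 < n"
    and phi: "\<epsilon> < \<phi>" "\<phi> < pi - (l + 1) * \<epsilon>" and ab: "0 < a" "0 < b"
    and s: "a * sin (l * \<epsilon> - \<phi>) - b * sin \<epsilon> \<le> s" "s \<le> a * sin (l * \<epsilon> - \<phi>) + b * sin \<epsilon>"
  shows "bottom_side \<epsilon> (l * \<epsilon> - \<phi>) a b k s \<notin> level_polygon \<epsilon> (- \<phi> - l * \<epsilon>) a b"
proof
  define \<psi> where "\<psi> = l * \<epsilon> - \<phi>"
  define x where "x = bottom_side \<epsilon> \<psi> a b k s"
  define d where "d = a * cos \<psi> + b * cos \<epsilon>"
  assume "bottom_side \<epsilon> (l * \<epsilon> - \<phi>) a b k s \<in> level_polygon \<epsilon> (- \<phi> - l * \<epsilon>) a b"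
  then have xin: "x \<in> level_polygon \<epsilon> (- \<phi> - l * \<epsilon>) a b" unfolding x_def \<psi>_def .
  have R: "(norm x)\<^sup>2 < a\<^sup>2 + b\<^sup>2 + 2 * (a * b) * cos (\<psi> + c * \<epsilon>)" if c: "c = 1 \<or> c = - 1" for c
    using inner_outer_cos[OF n l(1) phi _ c, of 1] inner_outer_cos[OF n l(1) phi _ c, of "-1"] ab
    by (intro level_polygon_radius_less[OF xin]) (simp_all add: \<psi>_def)
  have "s\<^sup>2 < (a * sin \<psi> - b * sin \<epsilon>)\<^sup>2" "s\<^sup>2 < (a * sin \<psi> + b * sin \<epsilon>)\<^sup>2"
    using R[of 1] R[of "-1"] bottom_side_end_radii[of a \<psi> b \<epsilon>] unfolding x_def norm_bottom_side by simp_all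
  then have sq: "\<bar>s\<bar> < \<bar>a * sin \<psi> - b * sin \<epsilon>\<bar>" "\<bar>s\<bar> < \<bar>a * sin \<psi> + b * sin \<epsilon>\<bar>"
    by (metis abs_le_square_iff not_le)+
  \<comment> \<open>an interval around \<open>m\<close> that contains a number smaller in absolute value than both ends contains \<open>0\<close>\<close>
  have "\<bar>a * sin \<psi>\<bar> < b * sin \<epsilon>"
    using sq s unfolding \<psi>_def[symmetric] by linarith
  then have central: "a * \<bar>sin (l * \<epsilon> - \<phi>)\<bar> < b * sin \<epsilon>" using ab by (simp add: abs_mult \<psi>_def)
  have "Re (cis (- (2 * of_int k + 1) * \<epsilon>) * x) < d"
    unfolding d_def \<psi>_def
    using inner_vertex_below_line[OF n l phi ab central, of 1] inner_vertex_below_line[OF n l phi ab central, of "-1"]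
    by (intro level_polygon_below_line[OF xin]) simp_all
  moreover have "Re (cis (- (2 * of_int k + 1) * \<epsilon>) * x) = d"
    unfolding x_def bottom_side_def d_def mult.assoc[symmetric] cis_mult by (simp add: algebra_simps)
  ultimately show False by simp
qed

text \<open>
  Turning the annulus upside down about a horizontal axis, chosen so that \<open>P\<^sub>0\<close> and \<open>Q\<^sub>0\<close> are exchanged, maps it
  to itself and exchanges the two kinds of sides and the weights.
\<close>

lemma level_polygon_flip:
  fixes t :: real
  assumes t: "t = \<psi> - \<epsilon>" and x: "x \<in> level_polygon \<epsilon> \<psi> a b"
  shows "cis t * cnj x \<in> level_polygon \<epsilon> \<psi> b a"
  using x unfolding level_polygon_def[of _ _ a b]
proof (elim UnE CollectE exE conjE)
  fix j s assume x: "x = bottom_side \<epsilon> \<psi> a b j s" and s: "a * sin \<psi> - b * sin \<epsilon> \<le> s" "s \<le> a * sin \<psi> + b * sin \<epsilon>"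
  have "cis t * cnj x = top_side \<epsilon> \<psi> b a (- j - 1) (- s)"
    unfolding x bottom_side_def top_side_def complex_cnj_mult cis_cnj mult.assoc[symmetric] cis_mult t
    by (simp add: complex_eq_iff algebra_simps)
  then show ?thesis using s by (auto intro: top_side_mem)
next
  fix j s assume x: "x = top_side \<epsilon> \<psi> a b j s" and s: "- b * sin \<psi> - a * sin \<epsilon> \<le> s" "s \<le> - b * sin \<psi> + a * sin \<epsilon>"
  have "cis t * cnj x = bottom_side \<epsilon> \<psi> b a (- j - 1) (- s)"
    unfolding x bottom_side_def top_side_def complex_cnj_mult cis_cnj mult.assoc[symmetric] cis_mult t
    by (simp add: complex_eq_iff algebra_simps)
  then show ?thesis using s by (auto intro: bottom_side_mem)
qed

text \<open>
  The half turn that exchanges \<open>P\<^sub>0\<close> and \<open>Q\<^sub>0\<close> of the inner annulus maps the outer annulus to itself as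
  well, because their angles differ by a multiple of \<open>2 \<epsilon>\<close>.  Hence sides of the second kind reduce to
  those of the first.
\<close>

lemma level_polygons_disjoint:
  fixes n l :: int and \<epsilon> \<phi> a b :: real
  assumes n: "3 \<le> n" "\<epsilon> = pi / n" and l: "2 \<le> l" "l + 1 < n"
    and phi: "\<epsilon> < \<phi>" "\<phi> < pi - (l + 1) * \<epsilon>" and ab: "0 < a" "0 < b"
  shows "level_polygon \<epsilon> (- \<phi> - l * \<epsilon>) a b \<inter> level_polygon \<epsilon> (l * \<epsilon> - \<phi>) a b = {}"
proof (rule ccontr)
  assume "level_polygon \<epsilon> (- \<phi> - l * \<epsilon>) a b \<inter> level_polygon \<epsilon> (l * \<epsilon> - \<phi>) a b \<noteq> {}"
  then obtain x where x1: "x \<in> level_polygon \<epsilon> (- \<phi> - l * \<epsilon>) a b" and x2: "x \<in> level_polygon \<epsilon> (l * \<epsilon> - \<phi>) a b" by auto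
  show False using x2 unfolding level_polygon_def
  proof (elim UnE CollectE exE conjE)
    fix k s assume "x = bottom_side \<epsilon> (l * \<epsilon> - \<phi>) a b k s"
      and s: "a * sin (l * \<epsilon> - \<phi>) - b * sin \<epsilon> \<le> s" "s \<le> a * sin (l * \<epsilon> - \<phi>) + b * sin \<epsilon>"
    then show False using inner_polygon_off_outer_bottom_side[OF n l phi ab s, of k] x1 by simp
  next
    fix j s assume x: "x = top_side \<epsilon> (l * \<epsilon> - \<phi>) a b j s"
      and s: "- b * sin (l * \<epsilon> - \<phi>) - a * sin \<epsilon> \<le> s" "s \<le> - b * sin (l * \<epsilon> - \<phi>) + a * sin \<epsilon>"
    define t where "t = - \<phi> - l * \<epsilon> - \<epsilon>"
    have "cis t * cnj x = bottom_side \<epsilon> (l * \<epsilon> - \<phi>) b a (- l - j - 1) (- s)"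
      unfolding x bottom_side_def top_side_def complex_cnj_mult cis_cnj mult.assoc[symmetric] cis_mult t_def
      by (simp add: complex_eq_iff algebra_simps)
    moreover have "cis t * cnj x \<in> level_polygon \<epsilon> (- \<phi> - l * \<epsilon>) b a"
      by (rule level_polygon_flip[OF _ x1]) (simp add: t_def)
    ultimately show False
      using inner_polygon_off_outer_bottom_side[OF n l phi ab(2) ab(1), of "- s" "- l - j - 1"] s by simp
  qed
qed

section \<open>Piecewise linear maps on the Kuhn triangulation of the plane\<close>

definition node :: "int \<times> int \<Rightarrow> real \<times> real" where
  "node p = (of_int (fst p), of_int (snd p))"

definition mid :: "bool \<Rightarrow> int \<times> int \<Rightarrow> int \<times> int" where
  "mid b p = (if b then p + (1, 0) else p + (0, 1))"

text \<open>
  The triangle below (\<open>True\<close>) or above (\<open>False\<close>) the diagonal of a unit square, by its integer vertices.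
\<close>

definition tri :: "bool \<Rightarrow> int \<times> int \<Rightarrow> (int \<times> int) set" where
  "tri b p = {p, mid b p, p + (1, 1)}"

text \<open>
  The map with given values at the integer points that is affine on every triangle.
\<close>

definition pl :: "(int \<times> int \<Rightarrow> 'a::real_vector) \<Rightarrow> real \<times> real \<Rightarrow> 'a" where
  "pl X z = (let p = (\<lfloor>fst z\<rfloor>, \<lfloor>snd z\<rfloor>); u = frac (fst z); v = frac (snd z) in
     if v \<le> u then (1 - u) *\<^sub>R X p + (u - v) *\<^sub>R X (mid True p) + v *\<^sub>R X (p + (1, 1))
     else (1 - v) *\<^sub>R X p + (v - u) *\<^sub>R X (mid False p) + u *\<^sub>R X (p + (1, 1)))"

lemma node_add: "node (p + q) = node p + node q" by (simp add: node_def)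
lemma inj_node: "inj node" by (auto simp: inj_def node_def prod_eq_iff)

lemma floor_frac_unique: "0 \<le> u \<Longrightarrow> u < 1 \<Longrightarrow> \<lfloor>of_int i + u\<rfloor> = i \<and> frac (of_int i + u) = (u::real)"
  by (simp add: frac_def floor_unique)

text \<open>
  The defining formula, which is chosen by integer parts, is also correct on those edges of the closed triangle
  where the integer parts jump.  Continuity and all statements about common faces rest on this.
\<close>

lemma pl_tri:
  fixes \<alpha> \<beta> \<gamma> :: real
  assumes "0 \<le> \<alpha>" "0 \<le> \<beta>" "0 \<le> \<gamma>" "\<alpha> + \<beta> + \<gamma> = 1"
  shows "pl X (\<alpha> *\<^sub>R node p + \<beta> *\<^sub>R node (mid b p) + \<gamma> *\<^sub>R node (p + (1, 1)))
       = \<alpha> *\<^sub>R X p + \<beta> *\<^sub>R X (mid b p) + \<gamma> *\<^sub>R X (p + (1, 1))"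
proof -
  obtain i j where p: "p = (i, j)" by force
  define x where "x = of_int i + (if b then \<beta> + \<gamma> else \<gamma>)"
  define y where "y = of_int j + (if b then \<gamma> else \<beta> + \<gamma>)"
  have a: "\<alpha> = 1 - \<beta> - \<gamma>" using assms by simp
  have z: "\<alpha> *\<^sub>R node p + \<beta> *\<^sub>R node (mid b p) + \<gamma> *\<^sub>R node (p + (1, 1)) = (x, y)"
    unfolding a by (auto simp: node_def p mid_def x_def y_def algebra_simps)
  consider "\<beta> + \<gamma> < 1" | "\<beta> + \<gamma> = 1" "0 < \<beta>" | "\<beta> = 0" "\<gamma> = 1" using assms by fastforce
  then show ?thesis
  proof cases
    case 1
    then have "\<lfloor>x\<rfloor> = i" "\<lfloor>y\<rfloor> = j" "frac x = (if b then \<beta> + \<gamma> else \<gamma>)" "frac y = (if b then \<gamma> else \<beta> + \<gamma>)"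
      unfolding x_def y_def using assms floor_frac_unique[of "\<beta> + \<gamma>"] floor_frac_unique[of \<gamma>] by auto
    then show ?thesis unfolding z using assms by (auto simp: pl_def Let_def p mid_def a algebra_simps)
  next
    case 2
    have ab: "\<alpha> = 0" "\<beta> = 1 - \<gamma>" "\<gamma> < 1" using 2 assms by auto
    show ?thesis
    proof (cases b)
      case True
      have "x = of_int (i + 1) + 0" "y = of_int j + \<gamma>" using 2 True by (auto simp: x_def y_def)
      then have "\<lfloor>x\<rfloor> = i + 1" "frac x = 0" "\<lfloor>y\<rfloor> = j" "frac y = \<gamma>"
        using floor_frac_unique[of 0 "i + 1"] floor_frac_unique[of \<gamma> j] 2 assms by auto
      then show ?thesis unfolding z unfolding ab(1,2) using True assms(3) ab(3) by (auto simp: pl_def Let_def p mid_def algebra_simps simp del: frac_eq_0_iff)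
    next
      case False
      have "y = of_int (j + 1) + 0" "x = of_int i + \<gamma>" using 2 False by (auto simp: x_def y_def)
      then have "\<lfloor>y\<rfloor> = j + 1" "frac y = 0" "\<lfloor>x\<rfloor> = i" "frac x = \<gamma>"
        using floor_frac_unique[of 0 "j + 1"] floor_frac_unique[of \<gamma> i] 2 assms by auto
      then show ?thesis unfolding z unfolding ab(1,2) using False assms(3) ab(3) by (auto simp: pl_def Let_def p mid_def algebra_simps simp del: frac_eq_0_iff)
    qed
  next
    case 3
    have ab: "\<alpha> = 0" "\<beta> = 0" using 3 assms by auto
    have "x = of_int (i + 1) + 0" "y = of_int (j + 1) + 0" using 3 by (auto simp: x_def y_def)
    then have "\<lfloor>x\<rfloor> = i + 1" "frac x = 0" "\<lfloor>y\<rfloor> = j + 1" "frac y = 0"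
      using floor_frac_unique[of 0 "i + 1"] floor_frac_unique[of 0 "j + 1"] by auto
    then show ?thesis unfolding z unfolding ab using 3 by (auto simp: pl_def Let_def p mid_def algebra_simps simp del: frac_eq_0_iff)
  qed
qed

lemma pl_node: "pl X (node p) = X p"
  using pl_tri[of 1 0 0 X p True] by simp

lemma pl_shift: "pl X (z + node g) = pl (\<lambda>p. X (p + g)) z"
proof -
  obtain x y i j where z: "z = (x, y)" and g: "g = (i, j)" by (meson surj_pair)
  have fr: "frac (x + of_int i) = frac x" "frac (y + of_int j) = frac y" by (simp_all add: frac_def)
  show ?thesis
    by (simp add: z g pl_def Let_def node_def mid_def fr add_ac)
qed

lemma tri_distinct: "p \<noteq> mid b p \<and> p \<noteq> p + (1, 1) \<and> mid b p \<noteq> p + (1, 1)"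
  by (cases p) (auto simp: mid_def)

lemma finite_tri [simp]: "finite (tri b p)" by (simp add: tri_def)
lemma card_tri: "card (tri b p) = 3" using tri_distinct[of p b] by (simp add: tri_def)

lemma hull_triE:
  assumes "z \<in> convex hull (f ` tri b p)"
  obtains \<alpha> \<beta> \<gamma> where "0 \<le> \<alpha>" "0 \<le> \<beta>" "0 \<le> \<gamma>" "\<alpha> + \<beta> + \<gamma> = 1"
    "z = \<alpha> *\<^sub>R f p + \<beta> *\<^sub>R f (mid b p) + \<gamma> *\<^sub>R f (p + (1, 1))"
  using assms unfolding tri_def by (auto simp: convex_hull_3)

lemma hull_triI:
  "0 \<le> \<alpha> \<Longrightarrow> 0 \<le> \<beta> \<Longrightarrow> 0 \<le> \<gamma> \<Longrightarrow> \<alpha> + \<beta> + \<gamma> = 1 \<Longrightarrow>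
    \<alpha> *\<^sub>R f p + \<beta> *\<^sub>R f (mid b p) + \<gamma> *\<^sub>R f (p + (1, 1)) \<in> convex hull (f ` tri b p)"
  unfolding tri_def image_insert image_empty convex_hull_3 by blast

lemma ex_tri: "\<exists>b p. z \<in> convex hull (node ` tri b p)"
proof -
  define p where "p = (\<lfloor>fst z\<rfloor>, \<lfloor>snd z\<rfloor>)"
  define u where "u = frac (fst z)"
  define v where "v = frac (snd z)"
  have uv: "0 \<le> u" "u < 1" "0 \<le> v" "v < 1" by (auto simp: u_def v_def frac_lt_1)
  have z: "z = node p + (u, v)" by (simp add: p_def u_def v_def node_def frac_def prod_eq_iff)
  show ?thesis
  proof (cases "v \<le> u")
    case True
    have "z = (1 - u) *\<^sub>R node p + (u - v) *\<^sub>R node (mid True p) + v *\<^sub>R node (p + (1, 1))"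
      unfolding z by (cases p) (simp add: node_def mid_def algebra_simps)
    then have "z \<in> convex hull (node ` tri True p)"
      using True uv by (auto intro: hull_triI)
    then show ?thesis by blast
  next
    case False
    have "z = (1 - v) *\<^sub>R node p + (v - u) *\<^sub>R node (mid False p) + u *\<^sub>R node (p + (1, 1))"
      unfolding z by (cases p) (simp add: node_def mid_def algebra_simps)
    then have "z \<in> convex hull (node ` tri False p)"
      using False uv by (auto intro: hull_triI)
    then show ?thesis by blast
  qed
qed

lemma pl_affine_on_tri:
  "\<exists>L c. linear L \<and> (\<forall>z \<in> convex hull (node ` tri b p). pl X z = L z + c)"
proof -
  define A where "A = (if b then X (mid b p) - X p else X (p + (1, 1)) - X (mid b p))"
  define B where "B = (if b then X (p + (1, 1)) - X (mid b p) else X (mid b p) - X p)"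
  define L where "L = (\<lambda>w::real\<times>real. fst w *\<^sub>R A + snd w *\<^sub>R B)"
  have "linear L" unfolding L_def by (intro linearI) (auto simp: algebra_simps)
  moreover have "pl X z = L z + (X p - L (node p))" if z: "z \<in> convex hull (node ` tri b p)" for z
  proof -
    obtain \<alpha> \<beta> \<gamma> where c: "0 \<le> \<alpha>" "0 \<le> \<beta>" "0 \<le> \<gamma>" "\<alpha> + \<beta> + \<gamma> = 1"
      and zc: "z = \<alpha> *\<^sub>R node p + \<beta> *\<^sub>R node (mid b p) + \<gamma> *\<^sub>R node (p + (1, 1))" by (rule hull_triE[OF z])
    have a: "\<alpha> = 1 - \<beta> - \<gamma>" using c by simp
    have "z = node p + (if b then (\<beta> + \<gamma>, \<gamma>) else (\<gamma>, \<beta> + \<gamma>))"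
      unfolding zc a by (cases p) (auto simp: node_def mid_def algebra_simps)
    then have "L z = L (node p) + (if b then (\<beta> + \<gamma>) *\<^sub>R A + \<gamma> *\<^sub>R B else \<gamma> *\<^sub>R A + (\<beta> + \<gamma>) *\<^sub>R B)"
      by (simp add: L_def algebra_simps)
    moreover have "pl X z = \<alpha> *\<^sub>R X p + \<beta> *\<^sub>R X (mid b p) + \<gamma> *\<^sub>R X (p + (1, 1))"
      unfolding zc by (rule pl_tri[OF c])
    ultimately show ?thesis unfolding a A_def B_def by (auto simp: algebra_simps)
  qed
  ultimately show ?thesis by blast
qed

lemma pl_hull_image:
  assumes "V \<subseteq> tri b p"
  shows "pl X ` (convex hull (node ` V)) = convex hull (X ` V)"
proof -
  obtain L c where L: "linear L" and eq: "\<And>z. z \<in> convex hull (node ` tri b p) \<Longrightarrow> pl X z = L z + c"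
    using pl_affine_on_tri[of b p X] by blast
  have sub: "convex hull (node ` V) \<subseteq> convex hull (node ` tri b p)" using assms by (intro hull_mono image_mono)
  have "pl X ` (convex hull (node ` V)) = (\<lambda>z. c + z) ` L ` (convex hull (node ` V))"
    unfolding image_image using eq sub by (intro image_cong) (auto simp: add.commute)
  also have "\<dots> = convex hull ((\<lambda>z. c + z) ` L ` node ` V)"
    unfolding convex_hull_linear_image[OF L] convex_hull_translation ..
  also have "(\<lambda>z. c + z) ` L ` node ` V = X ` V"
  proof -
    have "c + L (node q) = X q" if "q \<in> V" for q
      using eq[of "node q"] hull_inc[of "node q" "node ` tri b p"] that assms pl_node[of X q] by (auto simp: add.commute)
    then show ?thesis unfolding image_image by (intro image_cong) auto
  qed
  finally show ?thesis .
qed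

text \<open>
  The weight of an integer point \<open>q\<close> in \<open>z\<close> is the interpolation at \<open>z\<close> of the indicator of \<open>q\<close>.  This is
  independent of the triangle used to compute it, so the weights of a common point of two triangles vanish
  outside their common vertices.
\<close>

lemma tri_inter:
  assumes z: "z \<in> convex hull (node ` tri b p)" and z': "z \<in> convex hull (node ` tri b' p')"
  shows "z \<in> convex hull (node ` (tri b p \<inter> tri b' p'))"
proof -
  define w :: "int \<times> int \<Rightarrow> real" where "w q = pl (\<lambda>x. if x = q then 1 else 0) z" for q
  have outside: "w q = 0" if zin: "z \<in> convex hull (node ` tri b p)" and q: "q \<notin> tri b p" for q b p
  proof -
    obtain \<alpha> \<beta> \<gamma> where c: "0 \<le> \<alpha>" "0 \<le> \<beta>" "0 \<le> \<gamma>" "\<alpha> + \<beta> + \<gamma> = 1"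
      and zc: "z = \<alpha> *\<^sub>R node p + \<beta> *\<^sub>R node (mid b p) + \<gamma> *\<^sub>R node (p + (1, 1))" by (rule hull_triE[OF zin])
    show ?thesis unfolding w_def zc pl_tri[OF c] using q by (auto simp: tri_def)
  qed
  have sums: "(\<Sum>q\<in>tri b p. w q) = 1" "\<And>q. w q \<ge> 0" "(\<Sum>q\<in>tri b p. w q *\<^sub>R node q) = z"
  proof -
    obtain \<alpha> \<beta> \<gamma> where c: "0 \<le> \<alpha>" "0 \<le> \<beta>" "0 \<le> \<gamma>" "\<alpha> + \<beta> + \<gamma> = 1"
      and zc: "z = \<alpha> *\<^sub>R node p + \<beta> *\<^sub>R node (mid b p) + \<gamma> *\<^sub>R node (p + (1, 1))" by (rule hull_triE[OF z])
    have w: "w p = \<alpha>" "w (mid b p) = \<beta>" "w (p + (1, 1)) = \<gamma>"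
      unfolding w_def zc pl_tri[OF c] using tri_distinct[of p b] by auto
    show "(\<Sum>q\<in>tri b p. w q) = 1" "(\<Sum>q\<in>tri b p. w q *\<^sub>R node q) = z"
      unfolding tri_def using tri_distinct[of p b] c by (simp_all add: w zc add_ac)
    show "w q \<ge> 0" for q
      unfolding w_def zc pl_tri[OF c] using c by auto
  qed
  let ?I = "tri b p \<inter> tri b' p'"
  have "(\<Sum>q\<in>?I. w q) = (\<Sum>q\<in>tri b p. w q)" "(\<Sum>q\<in>?I. w q *\<^sub>R node q) = (\<Sum>q\<in>tri b p. w q *\<^sub>R node q)"
    using outside[OF z'] by (intro sum.mono_neutral_left; force)+
  then have "z = (\<Sum>q\<in>?I. w q *\<^sub>R node q)" "(\<Sum>q\<in>?I. w q) = 1" using sums by auto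
  moreover have "(\<Sum>q\<in>?I. w q *\<^sub>R node q) \<in> convex hull (node ` ?I)"
    using sums(2) calculation(2) by (intro convex_sum) (auto intro: hull_inc)
  ultimately show ?thesis by simp
qed

lemma hull_tri_box:
  assumes "z \<in> convex hull (node ` tri b p)"
  shows "of_int (fst p) \<le> fst z" "fst z \<le> of_int (fst p) + 1" "of_int (snd p) \<le> snd z" "snd z \<le> of_int (snd p) + 1"
proof -
  have "convex hull (node ` tri b p) \<subseteq> {of_int (fst p)..of_int (fst p) + 1} \<times> {of_int (snd p)..of_int (snd p) + 1}"
    by (rule hull_minimal) (auto simp: tri_def mid_def node_def convex_Times)
  then show "of_int (fst p) \<le> fst z" "fst z \<le> of_int (fst p) + 1" "of_int (snd p) \<le> snd z" "snd z \<le> of_int (snd p) + 1"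
    using assms by auto
qed

text \<open>
  Every point has an open neighbourhood covered by finitely many closed triangles.
\<close>

lemma continuous_on_pl:
  fixes X :: "int \<times> int \<Rightarrow> 'a::real_normed_vector"
  shows "continuous_on UNIV (pl X)"
proof -
  have "isCont (pl X) z" for z
  proof -
    obtain N :: nat where N: "\<bar>fst z\<bar> < N" "\<bar>snd z\<bar> < N"
      by (metis max_less_iff_conj reals_Archimedean2)
    define I where "I = (UNIV :: bool set) \<times> ({- int N - 2..int N + 1} \<times> {- int N - 2..int N + 1})"
    define H where "H = (\<lambda>(b, p). convex hull (node ` tri b p))"
    define U where "U = {- real N<..<real N} \<times> {- real N<..<real N}"
    have fin: "finite I" by (simp add: I_def)
    have cl: "closed (H i)" for i
      unfolding H_def by (auto split: prod.splits intro!: compact_imp_closed finite_imp_compact_convex_hull)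
    have cont: "continuous_on (H i) (pl X)" for i
    proof -
      obtain b p where i: "i = (b, p)" by (cases i) blast
      obtain L c where L: "linear L" and eq: "\<And>z. z \<in> convex hull (node ` tri b p) \<Longrightarrow> pl X z = L z + c"
        using pl_affine_on_tri[of b p X] by blast
      have "continuous_on (H i) (\<lambda>z. L z + c)"
        using linear_continuous_on[OF L[unfolded linear_conv_bounded_linear]] by (intro continuous_intros)
      then show ?thesis using eq unfolding i H_def by (simp cong: continuous_on_cong)
    qed
    have "continuous_on (\<Union>i\<in>I. H i) (pl X)"
      using continuous_on_closed_Union[OF fin, of H "pl X"] cl cont by auto
    moreover have "U \<subseteq> (\<Union>i\<in>I. H i)"
    proof
      fix w assume w: "w \<in> U"
      obtain b p where h: "w \<in> convex hull (node ` tri b p)" using ex_tri by blast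
      obtain i j where p: "p = (i, j)" by force
      have "of_int i \<le> fst w" "fst w \<le> of_int i + 1" "of_int j \<le> snd w" "snd w \<le> of_int j + 1"
        using hull_tri_box[OF h] by (simp_all add: p)
      then have "(b, p) \<in> I" using w unfolding I_def U_def p by (auto; linarith)
      then show "w \<in> (\<Union>i\<in>I. H i)" using h by (intro UN_I[of "(b, p)"]) (auto simp: H_def)
    qed
    ultimately have "continuous_on U (pl X)" by (rule continuous_on_subset)
    moreover have "open U" "z \<in> U" using N unfolding U_def by (auto intro: open_Times simp: mem_Times_iff)
    ultimately show ?thesis by (simp add: continuous_on_eq_continuous_at)
  qed
  then show ?thesis by (simp add: continuous_at_imp_continuous_on)
qed

section \<open>Flat tori triangulated by a quotient of the Kuhn triangulation\<close>

lemma diff_mem_lattice_gen: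
  assumes "u \<in> lattice_gen \<omega>1 \<omega>2" "v \<in> lattice_gen \<omega>1 \<omega>2"
  shows "u - v \<in> lattice_gen \<omega>1 \<omega>2"
proof -
  obtain a b where u: "u = of_int a * \<omega>1 + of_int b * \<omega>2" using assms(1) unfolding lattice_gen_def by auto
  obtain c d where v: "v = of_int c * \<omega>1 + of_int d * \<omega>2" using assms(2) unfolding lattice_gen_def by auto
  have "u - v = of_int (a - c) * \<omega>1 + of_int (b - d) * \<omega>2" by (simp add: u v algebra_simps)
  then show ?thesis unfolding lattice_gen_def by blast
qed

lemma torus_proj_eq_iff:
  "torus_proj (lattice_gen \<omega>1 \<omega>2) z = torus_proj (lattice_gen \<omega>1 \<omega>2) w \<longleftrightarrow> w - z \<in> lattice_gen \<omega>1 \<omega>2"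
proof
  have zero: "0 \<in> lattice_gen \<omega>1 \<omega>2" unfolding lattice_gen_def by (auto intro!: exI[of _ "0::int"])
  {
    assume "torus_proj (lattice_gen \<omega>1 \<omega>2) z = torus_proj (lattice_gen \<omega>1 \<omega>2) w"
    moreover have "w \<in> torus_proj (lattice_gen \<omega>1 \<omega>2) w" using zero by (simp add: torus_proj_def lattice_rel_def)
    ultimately show "w - z \<in> lattice_gen \<omega>1 \<omega>2" by (auto simp: torus_proj_def lattice_rel_def)
  next
    assume wz: "w - z \<in> lattice_gen \<omega>1 \<omega>2"
    have "x - z \<in> lattice_gen \<omega>1 \<omega>2 \<longleftrightarrow> x - w \<in> lattice_gen \<omega>1 \<omega>2" for x
      using diff_mem_lattice_gen[OF _ wz, of "x - z"] diff_mem_lattice_gen[OF wz, of "w - x"]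
        diff_mem_lattice_gen[OF zero, of "x - w"] by auto
    then show "torus_proj (lattice_gen \<omega>1 \<omega>2) z = torus_proj (lattice_gen \<omega>1 \<omega>2) w"
      by (auto simp: torus_proj_def lattice_rel_def)
  }
qed

lemma torus_eq_range: "torus \<Lambda> = range (torus_proj \<Lambda>)"
  by (auto simp: torus_def torus_proj_def quotient_def)

lemma topspace_torus: "topspace (torus_topology \<Lambda>) = torus \<Lambda>"
proof
  show "topspace (torus_topology \<Lambda>) \<subseteq> torus \<Lambda>"
    using openin_topspace[of "torus_topology \<Lambda>"] unfolding openin_torus_topology by simp
  have "openin (torus_topology \<Lambda>) (torus \<Lambda>)"
    unfolding openin_torus_topology torus_eq_range by (simp add: vimage_def)
  then show "torus \<Lambda> \<subseteq> topspace (torus_topology \<Lambda>)" by (rule openin_subset)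
qed

lemma int_shift_iterate:
  fixes f :: "int \<times> int \<Rightarrow> 'a::real_vector"
  assumes "\<And>p. f (p + v) = f p + w"
  shows "f (p + (k * fst v, k * snd v)) = f p + of_int k *\<^sub>R w"
proof (induction k rule: int_induct[where k = 0])
  case base show ?case by (simp add: zero_prod_def[symmetric])
next
  case (step1 i)
  have "p + ((i + 1) * fst v, (i + 1) * snd v) = (p + (i * fst v, i * snd v)) + v"
    by (simp add: prod_eq_iff algebra_simps)
  then have "f (p + ((i + 1) * fst v, (i + 1) * snd v)) = f (p + (i * fst v, i * snd v)) + w"
    by (simp only: assms)
  then show ?case unfolding step1.IH by (simp add: algebra_simps)
next
  case (step2 i)
  have "p + (i * fst v, i * snd v) = (p + ((i - 1) * fst v, (i - 1) * snd v)) + v"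
    by (simp add: prod_eq_iff algebra_simps)
  then have "f (p + (i * fst v, i * snd v)) = f (p + ((i - 1) * fst v, (i - 1) * snd v)) + w"
    by (simp only: assms)
  then show ?case unfolding step2.IH by (simp add: algebra_simps)
qed

lemma period_iterate:
  fixes f :: "int \<times> int \<Rightarrow> 'a::real_vector"
  assumes "\<And>p. f (p + (n, 0)) = f p + v" "\<And>p. f (p + (m, 2)) = f p + w"
  shows "f (p + (a * n + c * m, 2 * c)) = f p + (of_int a *\<^sub>R v + of_int c *\<^sub>R w)"
proof -
  have "f (p + (a * n, 0) + (c * m, c * 2)) = f p + of_int a *\<^sub>R v + of_int c *\<^sub>R w"
    using int_shift_iterate[of f "(n, 0)" v p a, OF assms(1)]
      int_shift_iterate[of f "(m, 2)" w "p + (a * n, 0)" c, OF assms(2)] by simp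
  then show ?thesis by (simp add: add_ac mult.commute)
qed

text \<open>
  Distances between points of a triangle depend only on the barycentric coordinates and the three edge lengths.
\<close>

lemma dist_convex_combination:
  fixes f :: "'i \<Rightarrow> 'a::real_inner" and g :: "'i \<Rightarrow> 'b::real_inner"
  assumes d: "dist (f p) (f q) = dist (g p) (g q)" "dist (f p) (f r) = dist (g p) (g r)" "dist (f q) (f r) = dist (g q) (g r)"
    and s: "\<alpha> + \<beta> + \<gamma> = 1" "\<alpha>' + \<beta>' + \<gamma>' = 1"
  shows "dist (\<alpha> *\<^sub>R f p + \<beta> *\<^sub>R f q + \<gamma> *\<^sub>R f r) (\<alpha>' *\<^sub>R f p + \<beta>' *\<^sub>R f q + \<gamma>' *\<^sub>R f r)
       = dist (\<alpha> *\<^sub>R g p + \<beta> *\<^sub>R g q + \<gamma> *\<^sub>R g r) (\<alpha>' *\<^sub>R g p + \<beta>' *\<^sub>R g q + \<gamma>' *\<^sub>R g r)"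
proof -
  have a: "\<alpha> = 1 - \<beta> - \<gamma>" "\<alpha>' = 1 - \<beta>' - \<gamma>'" using s by auto
  have expand: "(norm (s *\<^sub>R u + t *\<^sub>R v))\<^sup>2 = s\<^sup>2 * (norm u)\<^sup>2 + t\<^sup>2 * (norm v)\<^sup>2 + s * t * ((norm u)\<^sup>2 + (norm v)\<^sup>2 - (norm (u - v))\<^sup>2)"
    for s t and u v :: "'c::real_inner"
    unfolding power2_norm_eq_inner by (simp add: inner_simps inner_commute power2_eq_square algebra_simps)
  have f: "(\<alpha> *\<^sub>R f p + \<beta> *\<^sub>R f q + \<gamma> *\<^sub>R f r) - (\<alpha>' *\<^sub>R f p + \<beta>' *\<^sub>R f q + \<gamma>' *\<^sub>R f r)
      = (\<beta>' - \<beta>) *\<^sub>R (f p - f q) + (\<gamma>' - \<gamma>) *\<^sub>R (f p - f r)" for f :: "'i \<Rightarrow> 'c::real_inner"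
    unfolding a by (simp add: algebra_simps)
  have "norm ((f p - f q) - (f p - f r)) = norm ((g p - g q) - (g p - g r))"
    using d(3) by (simp add: dist_norm norm_minus_commute)
  then have "(norm ((\<beta>' - \<beta>) *\<^sub>R (f p - f q) + (\<gamma>' - \<gamma>) *\<^sub>R (f p - f r)))\<^sup>2
     = (norm ((\<beta>' - \<beta>) *\<^sub>R (g p - g q) + (\<gamma>' - \<gamma>) *\<^sub>R (g p - g r)))\<^sup>2"
    unfolding expand using d(1,2) by (simp add: dist_norm)
  then show ?thesis unfolding dist_norm f by simp
qed

lemma hull_node_shift:
  assumes "z \<in> convex hull (node ` V)"
  shows "z + node g \<in> convex hull (node ` ((\<lambda>v. v + g) ` V))"
proof -
  have "node ` ((\<lambda>v. v + g) ` V) = (\<lambda>z. node g + z) ` node ` V" by (auto simp: image_image node_add add.commute)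
  then have "convex hull (node ` ((\<lambda>v. v + g) ` V)) = (\<lambda>z. node g + z) ` (convex hull (node ` V))"
    by (simp only: convex_hull_translation)
  then have "node g + z \<in> convex hull (node ` ((\<lambda>v. v + g) ` V))" using assms by simp
  then show ?thesis by (simp only: add.commute)
qed

lemma rev_image_mono: "x \<in> f ` A \<Longrightarrow> A \<subseteq> B \<Longrightarrow> x \<in> f ` B"
  by blast

lemma tri_shift: "tri b (p + g) = (\<lambda>v. v + g) ` tri b p"
  by (auto simp: tri_def mid_def add_ac)

text \<open>
  A period of the quotient that is a difference of two edges of the triangulation vanishes; the condition on
  \<open>m\<close> excludes the short periods that go up by one pair of rows.
\<close>

lemma small_period:
  fixes a c n m :: int
  assumes n: "3 \<le> n" and shift: "m mod n \<notin> {0, 1, 2}"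
    and x: "- 2 \<le> a * n + c * m" "a * n + c * m \<le> 2" and y: "- 2 \<le> 2 * c" "2 * c \<le> 2"
    and xy: "- 2 \<le> a * n + c * m - 2 * c" "a * n + c * m - 2 * c \<le> 2"
  shows "a = 0 \<and> c = 0"
proof -
  have residue: "\<not> (0 \<le> k * n + m \<and> k * n + m \<le> 2)" for k
  proof
    assume k: "0 \<le> k * n + m \<and> k * n + m \<le> 2"
    then have "(k * n + m) mod n = k * n + m" using n by (intro mod_pos_pos_trivial) linarith+
    then have "m mod n = k * n + m" by simp
    then show False using k shift by auto
  qed
  consider "c = 0" | "c = 1" | "c = -1" using y by linarith
  then show ?thesis
  proof cases
    case 1
    have x0: "- 2 \<le> a * n" "a * n \<le> 2" using x 1 by simp_all
    have "\<not> 1 \<le> a" "\<not> a \<le> -1"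
    proof -
      show "\<not> 1 \<le> a"
      proof
        assume "1 \<le> a" then have "1 * n \<le> a * n" using n by (intro mult_right_mono) auto
        then show False using x0 n by linarith
      qed
      show "\<not> a \<le> -1"
      proof
        assume "a \<le> -1" then have "a * n \<le> -1 * n" using n by (intro mult_right_mono) auto
        then show False using x0 n by linarith
      qed
    qed
    then show ?thesis using 1 by linarith
  next
    case 2
    then show ?thesis using residue[of a] x xy by simp
  next
    case 3
    have "(- a) * n = - (a * n)" by simp
    then show ?thesis using residue[of "- a"] x xy 3 by simp
  qed
qed

text \<open>
  The integer plane with the periods \<open>(n, 0)\<close> and \<open>(m, 2)\<close> is developed by \<open>Y\<close> into the flat plane and
  folded by \<open>X\<close> into space; \<open>X\<close> and \<open>Y\<close> give the positions of the vertices.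
\<close>

locale kuhn_torus =
  fixes n m :: int and Y :: "int \<times> int \<Rightarrow> complex" and X :: "int \<times> int \<Rightarrow> complex \<times> real" and \<omega>1 \<omega>2 :: complex
  assumes n: "3 \<le> n" and shift: "m mod n \<notin> {0, 1, 2}"
    and Y1: "Y (p + (n, 0)) = Y p + \<omega>1" and Y2: "Y (p + (m, 2)) = Y p + \<omega>2"
    and X1: "X (p + (n, 0)) = X p" and X2: "X (p + (m, 2)) = X p"
    and edges: "u \<in> tri b p \<Longrightarrow> v \<in> tri b p \<Longrightarrow> dist (X u) (X v) = dist (Y u) (Y v)"
    and bijY: "bij (pl Y)"
    and injX: "pl X z = pl X z' \<Longrightarrow> \<exists>a c. z' = z + node (a * n + c * m, 2 * c)"
    and nondegY: "triangle_vertices (Y ` tri b p)" and nondegX: "triangle_vertices (X ` tri b p)"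
begin

definition per :: "int \<Rightarrow> int \<Rightarrow> int \<times> int" where "per a c = (a * n + c * m, 2 * c)"

abbreviation "\<Lambda> \<equiv> lattice_gen \<omega>1 \<omega>2"
abbreviation "\<pi>Y z \<equiv> torus_proj \<Lambda> (pl Y z)"

lemma per_diff: "per a c - per a' c' = per (a - a') (c - c')"
  by (simp add: per_def algebra_simps)

lemma Y_per: "Y (p + per a c) = Y p + (of_int a * \<omega>1 + of_int c * \<omega>2)"
  using period_iterate[of Y n \<omega>1 m \<omega>2, OF Y1 Y2] by (simp add: per_def scaleR_conv_of_real)

lemma X_per: "X (p + per a c) = X p"
  using period_iterate[of X n 0 m 0 p a c] X1 X2 by (simp add: per_def)

lemma pl_const_shift: "pl (\<lambda>p. f p + w) z = pl f z + w"
  unfolding pl_def Let_def by (auto simp: algebra_simps)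

lemma plX_per: "pl X (z + node (per a c)) = pl X z"
  by (simp add: pl_shift X_per)

lemma plY_per: "pl Y (z + node (per a c)) = pl Y z + (of_int a * \<omega>1 + of_int c * \<omega>2)"
  by (simp only: pl_shift Y_per pl_const_shift)

text \<open>
  Points of the torus are the orbits of the integer periods, which is how all questions about the torus
  are brought back to the integer plane.
\<close>

lemma \<pi>Y_eq_iff: "\<pi>Y z = \<pi>Y z' \<longleftrightarrow> (\<exists>a c. z' = z + node (per a c))"
proof -
  have "pl Y z' - pl Y z = of_int a * \<omega>1 + of_int c * \<omega>2 \<longleftrightarrow> z' = z + node (per a c)" for a c
  proof -
    have "pl Y z' - pl Y z = of_int a * \<omega>1 + of_int c * \<omega>2 \<longleftrightarrow> pl Y z' = pl Y (z + node (per a c))"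
      unfolding plY_per by (auto simp: algebra_simps)
    also have "\<dots> \<longleftrightarrow> z' = z + node (per a c)" using bijY by (meson bij_is_inj inj_eq)
    finally show ?thesis .
  qed
  then have "pl Y z' - pl Y z \<in> \<Lambda> \<longleftrightarrow> (\<exists>a c. z' = z + node (per a c))"
    unfolding lattice_gen_def by auto
  then show ?thesis by (simp only: torus_proj_eq_iff)
qed

lemma torus_eq: "torus \<Lambda> = range (\<lambda>z. \<pi>Y z)"
proof -
  have "range (\<lambda>z. \<pi>Y z) = torus_proj \<Lambda> ` range (pl Y)" by (simp only: image_image)
  then show ?thesis unfolding torus_eq_range bij_is_surj[OF bijY] by simp
qed

definition folding :: "complex set \<Rightarrow> complex \<times> real" where
  "folding A = pl X (SOME z. \<pi>Y z = A)"

lemma folding_\<pi>Y: "folding (\<pi>Y z) = pl X z"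
proof -
  have "\<pi>Y (SOME z'. \<pi>Y z' = \<pi>Y z) = \<pi>Y z" by (rule someI) (rule refl)
  then obtain a c where zz: "z = (SOME z'. \<pi>Y z' = \<pi>Y z) + node (per a c)"
    unfolding \<pi>Y_eq_iff[of "SOME z'. \<pi>Y z' = \<pi>Y z"] by blast
  have "pl X z = pl X (SOME z'. \<pi>Y z' = \<pi>Y z)" by (subst zz) (rule plX_per)
  then show ?thesis unfolding folding_def by simp
qed

lemma folding_inj: "inj_on folding (torus \<Lambda>)"
proof (rule inj_onI)
  fix A B assume "A \<in> torus \<Lambda>" "B \<in> torus \<Lambda>" and eq: "folding A = folding B"
  then obtain z z' where AB: "A = \<pi>Y z" "B = \<pi>Y z'" unfolding torus_eq by auto
  then have "pl X z = pl X z'" using eq by (simp only: folding_\<pi>Y)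
  then show "A = B" unfolding AB \<pi>Y_eq_iff per_def by (rule injX)
qed

text \<open>
  Continuity from the quotient topology means continuity on the flat plane.  The developing map is open by
  invariance of domain, so it suffices to know that the two interpolations are continuous.
\<close>

lemma folding_continuous: "continuous_map (torus_topology \<Lambda>) euclidean folding"
proof -
  have "openin (torus_topology \<Lambda>) {x \<in> torus \<Lambda>. folding x \<in> U}" if U: "open U" for U
  proof -
    have "torus_proj \<Lambda> -` {x \<in> torus \<Lambda>. folding x \<in> U} = pl Y ` (pl X -` U)"
    proof (intro equalityI subsetI)
      fix w assume w: "w \<in> torus_proj \<Lambda> -` {x \<in> torus \<Lambda>. folding x \<in> U}"
      obtain z where "w = pl Y z" using surjD[OF bij_is_surj[OF bijY]] by blast
      then show "w \<in> pl Y ` (pl X -` U)" using w by (auto simp: folding_\<pi>Y)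
    next
      fix w assume "w \<in> pl Y ` (pl X -` U)"
      then show "w \<in> torus_proj \<Lambda> -` {x \<in> torus \<Lambda>. folding x \<in> U}" by (auto simp: folding_\<pi>Y torus_eq)
    qed
    moreover have "open (pl X -` U)" using U continuous_on_pl[of X] by (simp add: continuous_on_open_vimage)
    moreover have "open (pl Y ` (pl X -` U))"
    proof (rule invariance_of_domain_gen)
      show "open (pl X -` U)" by fact
      show "continuous_on (pl X -` U) (pl Y)" using continuous_on_pl continuous_on_subset by blast
      show "inj_on (pl Y) (pl X -` U)" using bijY bij_is_inj inj_on_subset by blast
    qed simp
    ultimately show ?thesis unfolding openin_torus_topology by auto
  qed
  then show ?thesis by (simp add: continuous_map_def topspace_torus)
qed

lemma folding_image: "folding ` torus \<Lambda> = (\<Union>b p. convex hull (X ` tri b p))"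
proof -
  have "folding ` torus \<Lambda> = range (pl X)" unfolding torus_eq image_image folding_\<pi>Y ..
  also have "UNIV = (\<Union>b p. convex hull (node ` tri b p))" using ex_tri by auto
  also have "pl X ` \<dots> = (\<Union>b p. pl X ` (convex hull (node ` tri b p)))" by (simp only: image_UN)
  finally show ?thesis by (simp only: pl_hull_image[OF order_refl])
qed

definition cells :: "complex set set" where
  "cells = {Y ` tri b p | b p. p \<in> {0..<n} \<times> {0, 1}}"

lemma finite_cells: "finite cells"
proof -
  have "cells = (\<Union>b. (\<lambda>p. Y ` tri b p) ` ({0..<n} \<times> {0, 1}))" unfolding cells_def by blast
  then show ?thesis by (simp add: UNIV_bool)
qed

lemma proj_hull: "V \<subseteq> tri b p \<Longrightarrow> torus_proj \<Lambda> ` (convex hull (Y ` V)) = (\<lambda>z. \<pi>Y z) ` (convex hull (node ` V))"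
  by (simp add: pl_hull_image[where X = Y, symmetric] image_image)

lemma Y_inj: "inj Y"
proof (rule injI)
  fix p q assume "Y p = Y q"
  then have "pl Y (node p) = pl Y (node q)" by (simp only: pl_node)
  then have "node p = node q" by (rule injD[OF bij_is_inj[OF bijY]])
  then show "p = q" by (rule injD[OF inj_node])
qed

lemma proj_inj_on_cell: "inj_on (torus_proj \<Lambda>) (convex hull (Y ` tri b p))"
proof -
  have "w = w'" if w: "w \<in> convex hull (Y ` tri b p)" "w' \<in> convex hull (Y ` tri b p)" and eq: "torus_proj \<Lambda> w = torus_proj \<Lambda> w'" for w w'
  proof -
    obtain z z' where z: "z \<in> convex hull (node ` tri b p)" "z' \<in> convex hull (node ` tri b p)"
      and w: "w = pl Y z" "w' = pl Y z'" using w unfolding pl_hull_image[OF order_refl, where X = Y, symmetric] by auto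
    obtain a c where z': "z' = z + node (per a c)" using eq unfolding w \<pi>Y_eq_iff by auto
    have "\<bar>fst z' - fst z\<bar> \<le> 1" "\<bar>snd z' - snd z\<bar> \<le> 1" using hull_tri_box[OF z(1)] hull_tri_box[OF z(2)] by linarith+
    then have "- 2 \<le> real_of_int (a * n + c * m)" "real_of_int (a * n + c * m) \<le> 2"
      "- 2 \<le> real_of_int (2 * c)" "real_of_int (2 * c) \<le> 2"
      "- 2 \<le> real_of_int (a * n + c * m - 2 * c)" "real_of_int (a * n + c * m - 2 * c) \<le> 2"
      unfolding z' node_def per_def by (simp_all add: abs_le_iff)
    then have "a = 0 \<and> c = 0" by (intro small_period[OF n shift]) linarith+
    then show ?thesis unfolding w z' by (simp add: per_def node_def zero_prod_def[symmetric])
  qed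
  then show ?thesis by (rule inj_onI)
qed

text \<open>
  The difference of the two periods is also a difference of two edges of the triangulation.
\<close>

lemma period_unique:
  assumes "u \<in> tri b p" "v \<in> tri b p" "u + per a c \<in> tri b' p'" "v + per a' c' \<in> tri b' p'"
  shows "per a' c' = per a c"
proof -
  define d where "d = per (a' - a) (c' - c)"
  have range: "fst x - fst y \<le> 1 \<and> snd x - snd y \<le> 1 \<and> (fst x - snd x) - (fst y - snd y) \<le> 1"
    if "x \<in> tri b p" "y \<in> tri b p" for x y b p
    using that by (cases p) (auto simp: tri_def mid_def split: if_splits)
  have "d = (v + per a' c' - (u + per a c)) - (v - u)" unfolding d_def per_diff[symmetric] by simp
  then have fs: "fst d = (fst (v + per a' c') - fst (u + per a c)) - (fst v - fst u)"
    "snd d = (snd (v + per a' c') - snd (u + per a c)) - (snd v - snd u)" by simp_all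
  note bounds = range[OF assms(2,1)] range[OF assms(4,3)] range[OF assms(1,2)] range[OF assms(3,4)]
  have "- 2 \<le> fst d" "fst d \<le> 2" "- 2 \<le> snd d" "snd d \<le> 2" "- 2 \<le> fst d - snd d" "fst d - snd d \<le> 2"
    using bounds unfolding fs by linarith+
  then have "a' - a = 0 \<and> c' - c = 0"
    unfolding d_def per_def fst_conv snd_conv by (intro small_period[OF n shift])
  then show ?thesis by simp
qed

text \<open>
  By uniqueness of the period \<open>g\<close> that moves common vertices of the first triangle to vertices of the second,
  the two faces spanned by the common vertices have the same image in the torus.  The face is proper because
  the listed triangles are pairwise inequivalent.
\<close>

lemma cells_meet_in_face:
  assumes idx: "p \<in> {0..<n} \<times> {0, 1}" "p' \<in> {0..<n} \<times> {0, 1}" and ne: "Y ` tri b p \<noteq> Y ` tri b' p'"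
  shows "\<exists>V V'. V \<subset> Y ` tri b p \<and> V' \<subset> Y ` tri b' p' \<and>
           torus_proj \<Lambda> ` (convex hull (Y ` tri b p)) \<inter> torus_proj \<Lambda> ` (convex hull (Y ` tri b' p'))
             = torus_proj \<Lambda> ` (convex hull V) \<and>
           torus_proj \<Lambda> ` (convex hull V) = torus_proj \<Lambda> ` (convex hull V')"
proof -
  let ?T = "\<lambda>V. (\<lambda>z. \<pi>Y z) ` (convex hull (node ` V))"
  define V where "V = {v \<in> tri b p. \<exists>a c. v + per a c \<in> tri b' p'}"
  have Vsub: "V \<subseteq> tri b p" by (auto simp: V_def)
  obtain g where g: "\<exists>a c. g = per a c" and Vg: "\<And>v. v \<in> V \<Longrightarrow> v + g \<in> tri b' p'"
  proof (cases "V = {}")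
    case True then show ?thesis using that[of "per 0 0"] by blast
  next
    case False
    then obtain u a c where u: "u \<in> tri b p" "u + per a c \<in> tri b' p'" by (auto simp: V_def)
    show ?thesis
    proof (rule that[of "per a c"])
      fix v assume "v \<in> V"
      then obtain a' c' where v: "v \<in> tri b p" "v + per a' c' \<in> tri b' p'" by (auto simp: V_def)
      then show "v + per a c \<in> tri b' p'" using period_unique[OF u(1) v(1) u(2) v(2)] by simp
    qed blast
  qed
  define V' where "V' = (\<lambda>v. v + g) ` V"
  have V'sub: "V' \<subseteq> tri b' p'" using Vg by (auto simp: V'_def)
  have VV': "?T V = ?T V'"
  proof -
    have "node ` V' = (\<lambda>z. node g + z) ` node ` V" by (auto simp: image_image node_add V'_def add.commute)
    then have "convex hull (node ` V') = (\<lambda>z. node g + z) ` (convex hull (node ` V))" by (simp only: convex_hull_translation)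
    moreover have "\<pi>Y z = \<pi>Y (node g + z)" for z
      unfolding \<pi>Y_eq_iff using g by (auto simp: add.commute)
    ultimately show ?thesis by (simp add: image_image)
  qed
  have proper: "V \<noteq> tri b p"
  proof
    assume V: "V = tri b p"
    then have "card V' = 3" unfolding V'_def by (simp add: card_image card_tri)
    then have "V' = tri b' p'" using card_subset_eq[OF finite_tri V'sub] card_tri[of b' p'] by simp
    then have eq: "tri b (p + g) = tri b' p'" unfolding V'_def V tri_shift .
    have corner: "p = q \<and> b = b'" if "tri b p = tri b' q" for b b' p q
    proof -
      have "fst p = Min (fst ` tri b p)" "snd p = Min (snd ` tri b p)" for b p
        by (auto simp: tri_def mid_def)
      from this[of p b] this[of q b'] have "p = q" using that by (simp add: prod_eq_iff)
      moreover have "mid b q \<in> tri b' q" using that unfolding \<open>p = q\<close> by (metis insertCI tri_def)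
      then have "b = b'" by (cases q) (auto simp: tri_def mid_def split: if_splits)
      ultimately show ?thesis by simp
    qed
    have pg: "p + g = p'" "b = b'" using corner[OF eq] by auto
    obtain a c where "g = per a c" using g by blast
    then have p': "fst p' = fst p + a * n + c * m" "snd p' = snd p + 2 * c" using pg by (auto simp: per_def)
    then have "c = 0" using idx by (auto simp: mem_Times_iff)
    moreover have "a = 0"
    proof (rule ccontr)
      assume "a \<noteq> 0"
      then have "1 * n \<le> \<bar>a\<bar> * n" using n by (intro mult_right_mono) auto
      then have "n \<le> \<bar>a * n\<bar>" using n by (simp add: abs_mult)
      then show False using p' \<open>c = 0\<close> idx by (auto simp: mem_Times_iff)
    qed
    ultimately have "p = p'" using p' by (simp add: prod_eq_iff)
    then show False using ne pg by simp
  qed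
  have proper': "V' \<noteq> tri b' p'"
  proof
    assume "V' = tri b' p'"
    then have "card V' = 3" by (simp add: card_tri)
    then have "card V = 3" unfolding V'_def by (simp add: card_image)
    then show False using proper card_subset_eq[OF finite_tri Vsub] card_tri[of b p] by simp
  qed
  have inter: "?T (tri b p) \<inter> ?T (tri b' p')
     = ?T V"
  proof (intro equalityI subsetI)
    fix x assume "x \<in> ?T (tri b p) \<inter> ?T (tri b' p')"
    then obtain z z' where z: "z \<in> convex hull (node ` tri b p)" "x = \<pi>Y z"
      and z': "z' \<in> convex hull (node ` tri b' p')" "x = \<pi>Y z'" by auto
    have "\<pi>Y z = \<pi>Y z'" using z(2) z'(2) by simp
    then obtain a c where zz: "z' = z + node (per a c)" unfolding \<pi>Y_eq_iff by blast
    have "z \<in> convex hull (node ` tri b' (p' - per a c))"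
      using hull_node_shift[OF z'(1), of "- per a c"] unfolding tri_shift[symmetric] zz
      by (simp add: node_add[symmetric] add.assoc) (simp add: node_def zero_prod_def[symmetric])
    from tri_inter[OF z(1) this] have zi: "z \<in> convex hull (node ` (tri b p \<inter> tri b' (p' - per a c)))" .
    have "v + per a c \<in> tri b' p'" if "v \<in> tri b' (p' - per a c)" for v
      using that tri_shift[of b' "p' - per a c" "per a c"] by auto
    then have "tri b p \<inter> tri b' (p' - per a c) \<subseteq> V" unfolding V_def by blast
    then have "convex hull (node ` (tri b p \<inter> tri b' (p' - per a c))) \<subseteq> convex hull (node ` V)"
      by (intro hull_mono image_mono)
    then have "z \<in> convex hull (node ` V)" using zi by blast
    then show "x \<in> ?T V" using z by auto
  next
    fix x assume x: "x \<in> ?T V"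
    have "x \<in> ?T (tri b p)"
      using x hull_mono[OF image_mono[OF Vsub]] by (rule rev_image_mono)
    moreover have "x \<in> ?T (tri b' p')"
      using x[unfolded VV'] hull_mono[OF image_mono[OF V'sub]] by (rule rev_image_mono)
    ultimately show "x \<in> ?T (tri b p) \<inter> ?T (tri b' p')"
      by (rule IntI)
  qed
  show ?thesis
  proof (intro exI conjI)
    show "Y ` V \<subset> Y ` tri b p"
      by (rule image_strict_mono) (use Vsub proper inj_on_subset[OF Y_inj subset_UNIV] in auto)
    show "Y ` V' \<subset> Y ` tri b' p'"
      by (rule image_strict_mono) (use V'sub proper' inj_on_subset[OF Y_inj subset_UNIV] in auto)
    show "torus_proj \<Lambda> ` (convex hull (Y ` tri b p)) \<inter> torus_proj \<Lambda> ` (convex hull (Y ` tri b' p'))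
             = torus_proj \<Lambda> ` (convex hull (Y ` V))"
      unfolding proj_hull[OF order_refl] proj_hull[OF Vsub] by (rule inter)
    show "torus_proj \<Lambda> ` (convex hull (Y ` V)) = torus_proj \<Lambda> ` (convex hull (Y ` V'))"
      unfolding proj_hull[OF Vsub] proj_hull[OF V'sub] by (rule VV')
  qed
qed

lemma cells_cover: "(\<Union>S\<in>cells. torus_proj \<Lambda> ` (convex hull S)) = torus \<Lambda>"
proof (intro equalityI subsetI)
  fix x assume "x \<in> torus \<Lambda>"
  then obtain z where x: "x = \<pi>Y z" unfolding torus_eq by auto
  obtain b p where z: "z \<in> convex hull (node ` tri b p)" using ex_tri by blast
  obtain i j where p: "p = (i, j)" by force
  define c where "c = - (j div 2)"
  define a where "a = - ((i + c * m) div n)"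
  define q where "q = p + per a c"
  have "fst q = (i + c * m) mod n" by (simp add: q_def p per_def a_def minus_div_mult_eq_mod[symmetric])
  moreover have "snd q = j mod 2" by (simp add: q_def p per_def c_def minus_mult_div_eq_mod[symmetric])
  ultimately have q: "q \<in> {0..<n} \<times> {0, 1}" using n by (auto simp: mem_Times_iff)
  have "z + node (per a c) \<in> convex hull (node ` tri b q)"
    using hull_node_shift[OF z] unfolding q_def tri_shift .
  moreover have "x = \<pi>Y (z + node (per a c))" unfolding x \<pi>Y_eq_iff by blast
  ultimately have "x \<in> torus_proj \<Lambda> ` (convex hull (Y ` tri b q))" unfolding proj_hull[OF order_refl] by blast
  then show "x \<in> (\<Union>S\<in>cells. torus_proj \<Lambda> ` (convex hull S))" using q unfolding cells_def by blast
next
  fix x assume "x \<in> (\<Union>S\<in>cells. torus_proj \<Lambda> ` (convex hull S))"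
  then show "x \<in> torus \<Lambda>" unfolding torus_eq_range by auto
qed

lemma flat_triangulation_cells: "flat_triangulation \<Lambda> cells"
  unfolding flat_triangulation_def
proof (intro conjI ballI impI)
  show "finite cells" by (rule finite_cells)
  show "(\<Union>S\<in>cells. torus_proj \<Lambda> ` (convex hull S)) = torus \<Lambda>" by (rule cells_cover)
next
  fix S assume "S \<in> cells"
  then show "triangle_vertices S" "inj_on (torus_proj \<Lambda>) (convex hull S)"
    unfolding cells_def using nondegY proj_inj_on_cell by blast+
next
  fix S S' assume "S \<in> cells" "S' \<in> cells" and ne: "S \<noteq> S'"
  then obtain b p b' p' where S: "S = Y ` tri b p" "S' = Y ` tri b' p'"
    and idx: "p \<in> {0..<n} \<times> {0, 1}" "p' \<in> {0..<n} \<times> {0, 1}"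
    unfolding cells_def by blast
  show "\<exists>V V'. V \<subset> S \<and> V' \<subset> S' \<and>
     torus_proj \<Lambda> ` (convex hull S) \<inter> torus_proj \<Lambda> ` (convex hull S') = torus_proj \<Lambda> ` (convex hull V) \<and>
     torus_proj \<Lambda> ` (convex hull V) = torus_proj \<Lambda> ` (convex hull V')"
    unfolding S by (rule cells_meet_in_face[OF idx ne[unfolded S]])
qed

lemma folding_isometric_on_cell:
  assumes "w \<in> convex hull (Y ` tri b p)" "w' \<in> convex hull (Y ` tri b p)"
  shows "dist (folding (torus_proj \<Lambda> w)) (folding (torus_proj \<Lambda> w')) = dist w w'"
proof -
  obtain z z' where z: "z \<in> convex hull (node ` tri b p)" "z' \<in> convex hull (node ` tri b p)"
    and w: "w = pl Y z" "w' = pl Y z'" using assms unfolding pl_hull_image[OF order_refl, where X = Y, symmetric] by auto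
  obtain \<alpha> \<beta> \<gamma> where c: "0 \<le> \<alpha>" "0 \<le> \<beta>" "0 \<le> \<gamma>" "\<alpha> + \<beta> + \<gamma> = 1"
      and zc: "z = \<alpha> *\<^sub>R node p + \<beta> *\<^sub>R node (mid b p) + \<gamma> *\<^sub>R node (p + (1, 1))" by (rule hull_triE[OF z(1)])
  obtain \<alpha>' \<beta>' \<gamma>' where c': "0 \<le> \<alpha>'" "0 \<le> \<beta>'" "0 \<le> \<gamma>'" "\<alpha>' + \<beta>' + \<gamma>' = 1"
      and zc': "z' = \<alpha>' *\<^sub>R node p + \<beta>' *\<^sub>R node (mid b p) + \<gamma>' *\<^sub>R node (p + (1, 1))" by (rule hull_triE[OF z(2)])
  show ?thesis unfolding w folding_\<pi>Y unfolding zc zc' pl_tri[OF c] pl_tri[OF c']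
    by (rule dist_convex_combination) (use c c' in \<open>auto intro!: edges[of _ b p] simp: tri_def\<close>)
qed

theorem origami_map_folding: "origami_map \<Lambda> folding"
  unfolding origami_map_def
proof (intro conjI exI[of _ cells] ballI)
  show "continuous_map (torus_topology \<Lambda>) euclidean folding" by (rule folding_continuous)
  show "inj_on folding (torus \<Lambda>)" by (rule folding_inj)
  show "flat_triangulation \<Lambda> cells" by (rule flat_triangulation_cells)
next
  fix S z w assume S: "S \<in> cells" and zw: "z \<in> convex hull S" "w \<in> convex hull S"
  obtain b p where "S = Y ` tri b p" using S unfolding cells_def by blast
  then show "dist (folding (torus_proj \<Lambda> z)) (folding (torus_proj \<Lambda> w)) = dist z w"
    using folding_isometric_on_cell zw by simp
next
  fix S assume "S \<in> cells"
  then obtain b p where S: "S = Y ` tri b p" unfolding cells_def by blast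
  have "folding ` torus_proj \<Lambda> ` (convex hull S) = convex hull (X ` tri b p)"
  proof -
    have "folding ` torus_proj \<Lambda> ` (convex hull S) = (\<lambda>z. folding (\<pi>Y z)) ` (convex hull (node ` tri b p))"
      unfolding S by (subst proj_hull[OF order_refl]) (simp only: image_image)
    also have "\<dots> = pl X ` (convex hull (node ` tri b p))" by (intro image_cong refl folding_\<pi>Y)
    finally show ?thesis by (simp only: pl_hull_image[OF order_refl, where X = X])
  qed
  then show "\<exists>T. triangle_vertices T \<and> folding ` torus_proj \<Lambda> ` (convex hull S) = convex hull T"
    using nondegX by blast
qed

end

section \<open>Moduli of flat tori\<close>

lemma finite_short_lattice_vectors:
  assumes "Im \<tau> > 0"
  shows "finite {p :: int \<times> int. norm (of_int (fst p) * \<tau> + of_int (snd p)) \<le> 1}"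
proof -
  define N where "N = \<lceil>1 / Im \<tau>\<rceil>"
  define M where "M = \<lceil>1 + N * norm \<tau>\<rceil>"
  have "{p :: int \<times> int. norm (of_int (fst p) * \<tau> + of_int (snd p)) \<le> 1} \<subseteq> {- N..N} \<times> {- M..M}"
  proof
    fix p :: "int \<times> int" assume p: "p \<in> {p. norm (of_int (fst p) * \<tau> + of_int (snd p)) \<le> 1}"
    obtain c d where cd: "p = (c, d)" by force
    have le: "norm (of_int c * \<tau> + of_int d) \<le> 1" using p cd by simp
    have "\<bar>real_of_int c\<bar> * Im \<tau> = \<bar>Im (of_int c * \<tau> + of_int d)\<bar>" using assms by (simp add: abs_mult)
    also have "\<dots> \<le> 1" using abs_Im_le_cmod le by (meson order_trans)
    finally have c: "\<bar>real_of_int c\<bar> \<le> 1 / Im \<tau>" using assms by (simp add: field_simps)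
    then have c: "\<bar>real_of_int c\<bar> \<le> N" unfolding N_def by linarith
    have "\<bar>real_of_int d\<bar> = norm ((of_int c * \<tau> + of_int d) - of_int c * \<tau>)" by simp
    also have "\<dots> \<le> 1 + \<bar>real_of_int c\<bar> * norm \<tau>"
      using norm_triangle_ineq4[of "of_int c * \<tau> + of_int d" "of_int c * \<tau>"] le by (simp add: norm_mult)
    also have "\<dots> \<le> 1 + N * norm \<tau>" using c by (intro add_left_mono mult_right_mono) auto
    finally have "\<bar>real_of_int d\<bar> \<le> M" unfolding M_def by linarith
    then show "p \<in> {- N..N} \<times> {- M..M}" using c unfolding cd by auto
  qed
  then show ?thesis by (rule finite_subset) simp
qed

lemma lattice_vector_nonzero:
  assumes "Im \<tau> > 0" "(c, d) \<noteq> (0, 0 :: int)"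
  shows "of_int c * \<tau> + of_int d \<noteq> 0"
proof
  assume z: "of_int c * \<tau> + of_int d = 0"
  then have "Im (of_int c * \<tau> + of_int d) = 0" by simp
  then have "c = 0" using assms by simp
  then show False using z assms by simp
qed

text \<open>
  A shortest nonzero vector is primitive, since dividing by a common factor would shorten it.
\<close>

lemma shortest_lattice_vector:
  assumes "Im \<tau> > 0"
  obtains c d :: int where "coprime c d"
    "\<And>c' d'. (c', d') \<noteq> (0, 0) \<Longrightarrow> norm (of_int c * \<tau> + of_int d) \<le> norm (of_int c' * \<tau> + of_int d')"
proof -
  define f where "f p = norm (of_int (fst p) * \<tau> + of_int (snd p))" for p :: "int \<times> int"
  define S where "S = {p. f p \<le> 1 \<and> p \<noteq> (0, 0)}"
  have fin: "finite S"
    by (rule finite_subset[OF _ finite_short_lattice_vectors[OF assms]]) (auto simp: S_def f_def)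
  have one: "(0, 1) \<in> S" by (simp add: S_def f_def)
  then obtain p where p: "p \<in> S" "\<And>q. q \<in> S \<Longrightarrow> f p \<le> f q"
    using ex_is_arg_min_if_finite[OF fin, of f] unfolding is_arg_min_linorder by auto
  have min: "f p \<le> f q" if "q \<noteq> (0, 0)" for q
    using p(2)[of q] p(1) that unfolding S_def by force
  obtain c d where cd: "p = (c, d)" by force
  have pos: "f p > 0"
    using lattice_vector_nonzero[OF assms, of c d] p(1) by (simp add: S_def f_def cd)
  have "coprime c d"
  proof -
    define g where "g = gcd c d"
    obtain c' d' where c': "c = g * c'" and d': "d = g * d'" unfolding g_def by (meson dvdE gcd_dvd1 gcd_dvd2)
    have g0: "g \<ge> 0" by (simp add: g_def)
    have nz: "(c', d') \<noteq> (0, 0)" using c' d' p(1) cd by (auto simp: S_def)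
    have "f p = real_of_int g * f (c', d')"
    proof -
      have "of_int c * \<tau> + of_int d = of_int g * (of_int c' * \<tau> + of_int d')" by (simp add: c' d' algebra_simps)
      then show ?thesis using g0 by (simp add: f_def cd norm_mult)
    qed
    moreover have "f p \<le> f (c', d')" using min nz by blast
    ultimately have "\<not> 2 \<le> g"
    proof (intro notI)
      assume "2 \<le> g" and eq: "f p = real_of_int g * f (c', d')" and le: "f p \<le> f (c', d')"
      then have "2 * f (c', d') \<le> real_of_int g * f (c', d')" by (intro mult_right_mono) (auto simp: f_def)
      then show False using eq le pos by linarith
    qed
    moreover have "g \<noteq> 0" using c' d' p(1) cd by (auto simp: S_def)
    ultimately have "g = 1" using g0 by linarith
    then show ?thesis unfolding g_def by (simp add: coprime_iff_gcd_eq_1)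
  qed
  then show thesis
  proof (rule that)
    show "norm (of_int c * \<tau> + of_int d) \<le> norm (of_int c' * \<tau> + of_int d')" if "(c', d') \<noteq> (0, 0)" for c' d'
      using min[OF that] by (simp add: f_def cd)
  qed
qed

text \<open>
  Completing a shortest vector \<open>c \<tau> + d\<close> to a basis and rescaling it to \<open>1\<close> gives a lattice spanned by
  \<open>1\<close> and \<open>\<tau>'\<close> in which all nonzero vectors have length at least \<open>1\<close>.  Among \<open>\<tau>'\<close> and \<open>\<tau>' - 1\<close> one has a real part
  of absolute value at most \<open>1 / 2\<close>, and its imaginary part is bounded below by the theorem of Pythagoras.
\<close>

lemma SL2Z_reduced_representative:
  assumes "Im \<tau> > 0"
  obtains a b c d :: int and \<tau>' :: complex where "a * d - b * c = 1"
    "\<tau>' = (of_int a * \<tau> + of_int b) / (of_int c * \<tau> + of_int d)"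
    "0 \<le> Re \<tau>'" "Re \<tau>' < 1" "Im \<tau>' > 0" "(Im \<tau>')\<^sup>2 \<ge> 3 / 4"
proof -
  obtain c d :: int where cop: "coprime c d"
    and min: "\<And>c' d'. (c', d') \<noteq> (0, 0) \<Longrightarrow> norm (of_int c * \<tau> + of_int d) \<le> norm (of_int c' * \<tau> + of_int d')"
    using shortest_lattice_vector[OF assms] by metis
  obtain u v :: int where uv: "u * d + v * c = 1"
    using bezout_int[of d c] cop by (auto simp: coprime_iff_gcd_eq_1 gcd.commute)
  define w where "w = of_int c * \<tau> + of_int d"
  have w0: "w \<noteq> 0"
    unfolding w_def by (rule lattice_vector_nonzero[OF assms]) (use uv in auto)
  define \<tau>0 where "\<tau>0 = (of_int u * \<tau> - of_int v) / w"
  define k where "k = \<lfloor>Re \<tau>0\<rfloor>"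
  define \<tau>' where "\<tau>' = \<tau>0 - of_int k"
  have det: "(u - k * c) * d - (- v - k * d) * c = 1" using uv by (simp add: algebra_simps)
  have eq: "\<tau>' = (of_int (u - k * c) * \<tau> + of_int (- v - k * d)) / (of_int c * \<tau> + of_int d)"
    unfolding \<tau>'_def \<tau>0_def using w0 by (simp add: w_def field_simps)
  have re: "0 \<le> Re \<tau>'" "Re \<tau>' < 1" unfolding \<tau>'_def k_def by (simp_all add: floor_less_iff) linarith+
  have long: "1 \<le> norm (\<tau>' - of_int q)" for q :: int
  proof -
    define r where "r = u - (k + q) * c"
    define s where "s = - v - (k + q) * d"
    have "r * d - s * c = 1" using uv by (simp add: r_def s_def algebra_simps)
    then have "(r, s) \<noteq> (0, 0)" by auto
    then have "norm w \<le> norm (of_int r * \<tau> + of_int s)" using min unfolding w_def by blast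
    moreover have "\<tau>' - of_int q = (of_int r * \<tau> + of_int s) / w"
      unfolding \<tau>'_def \<tau>0_def r_def s_def using w0 by (simp add: w_def field_simps)
    ultimately show ?thesis using w0 by (simp add: norm_divide)
  qed
  have sq: "1 \<le> (Re \<tau>' - of_int q)\<^sup>2 + (Im \<tau>')\<^sup>2" for q :: int
  proof -
    have "1 \<le> (norm (\<tau>' - of_int q))\<^sup>2" using long[of q] by (simp add: one_le_power)
    then show ?thesis by (simp add: cmod_power2)
  qed
  have im2: "(Im \<tau>')\<^sup>2 \<ge> 3 / 4"
  proof (cases "Re \<tau>' \<le> 1 / 2")
    case True
    then have "(Re \<tau>')\<^sup>2 \<le> (1 / 2)\<^sup>2" using re by (intro power_mono) auto
    then show ?thesis using sq[of 0] by (simp add: power2_eq_square)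
  next
    case False
    then have "(1 - Re \<tau>')\<^sup>2 \<le> (1 / 2)\<^sup>2" using re by (intro power_mono) auto
    then show ?thesis using sq[of 1] by (simp add: power2_commute[of "Re \<tau>'" 1] power2_eq_square[of "1 / 2"])
  qed
  have "Im \<tau>' > 0"
  proof -
    have "Im \<tau>' = Im ((of_int u * \<tau> - of_int v) * cnj w) / (norm w)\<^sup>2"
      unfolding \<tau>'_def \<tau>0_def by (simp add: complex_div_cnj[of _ w] Im_divide_of_real[symmetric])
    also have "Im ((of_int u * \<tau> - of_int v) * cnj w) = real_of_int (u * d + v * c) * Im \<tau>"
      by (simp add: w_def algebra_simps)
    finally show ?thesis using assms uv w0 by simp
  qed
  then show thesis using that[OF det eq re _ im2] by blast
qed

lemma setdist_scale_le:
  fixes A B :: "complex set"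
  assumes "A \<noteq> {}" "B \<noteq> {}"
  shows "norm k * setdist A B \<le> setdist ((*) k ` A) ((*) k ` B)"
proof (rule le_setdistI)
  fix x y assume "x \<in> (*) k ` A" "y \<in> (*) k ` B"
  then obtain a b where ab: "a \<in> A" "b \<in> B" "x = k * a" "y = k * b" by auto
  have "dist x y = norm k * dist a b" by (simp add: ab dist_norm norm_mult[symmetric] algebra_simps)
  then show "norm k * setdist A B \<le> dist x y" using setdist_le_dist[OF ab(1,2)] by (simp add: mult_left_mono)
qed (use assms in auto)

lemma setdist_scale:
  fixes A B :: "complex set"
  assumes "A \<noteq> {}" "B \<noteq> {}" "k \<noteq> 0"
  shows "setdist ((*) k ` A) ((*) k ` B) = norm k * setdist A B"
proof (rule antisym)
  have "norm (1 / k) * setdist ((*) k ` A) ((*) k ` B) \<le> setdist ((*) (1 / k) ` (*) k ` A) ((*) (1 / k) ` (*) k ` B)"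
    using assms by (intro setdist_scale_le) auto
  moreover have "(*) (1 / k) ` (*) k ` A = A" "(*) (1 / k) ` (*) k ` B = B" using assms by (auto simp: image_image)
  ultimately show "setdist ((*) k ` A) ((*) k ` B) \<le> norm k * setdist A B" using assms by (simp add: norm_divide field_simps)
qed (use assms in \<open>auto intro: setdist_scale_le\<close>)

text \<open>
  Multiplication by \<open>(c \<tau> + d) / \<omega>1\<close> maps the lattice onto the one spanned by \<open>1\<close> and \<open>\<tau>\<close>.
\<close>

lemma torus_has_modulus_SL2Z:
  fixes a b c d :: int
  assumes tau: "Im \<tau> > 0" and det: "a * d - b * c = 1" and w1: "\<omega>1 \<noteq> 0"
    and w2: "\<omega>2 = \<omega>1 * ((of_int a * \<tau> + of_int b) / (of_int c * \<tau> + of_int d))"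
  shows "torus_has_modulus (lattice_gen \<omega>1 \<omega>2) \<tau>"
proof -
  define w where "w = of_int c * \<tau> + of_int d"
  have w0: "w \<noteq> 0"
    unfolding w_def by (rule lattice_vector_nonzero[OF tau]) (use det in auto)
  define k where "k = w / \<omega>1"
  have k0: "k \<noteq> 0" using w0 w1 by (simp add: k_def)
  have kw: "k * \<omega>1 = w" "k * \<omega>2 = of_int a * \<tau> + of_int b"
    using w1 w0 unfolding k_def w2 w_def[symmetric] by (auto simp: field_simps)
  have mem: "k * z \<in> lattice_gen 1 \<tau> \<longleftrightarrow> z \<in> lattice_gen \<omega>1 \<omega>2" for z
  proof
    assume "z \<in> lattice_gen \<omega>1 \<omega>2"
    then obtain p q :: int where "z = of_int p * \<omega>1 + of_int q * \<omega>2" unfolding lattice_gen_def by auto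
    then have "k * z = of_int p * (k * \<omega>1) + of_int q * (k * \<omega>2)" by (simp add: algebra_simps)
    also have "\<dots> = of_int (p * d + q * b) * 1 + of_int (p * c + q * a) * \<tau>" unfolding kw w_def by (simp add: algebra_simps)
    finally show "k * z \<in> lattice_gen 1 \<tau>" unfolding lattice_gen_def by blast
  next
    assume "k * z \<in> lattice_gen 1 \<tau>"
    then obtain x y :: int where xy: "k * z = of_int x * 1 + of_int y * \<tau>" unfolding lattice_gen_def by auto
    define p where "p = a * x - b * y"
    define q where "q = d * y - c * x"
    have "p * d + q * b = x * (a * d - b * c)" "p * c + q * a = y * (a * d - b * c)" by (simp_all add: p_def q_def algebra_simps)
    then have "p * d + q * b = x" "p * c + q * a = y" using det by simp_all
    then have "k * z = of_int (p * d + q * b) * 1 + of_int (p * c + q * a) * \<tau>" using xy by simp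
    also have "\<dots> = of_int p * (k * \<omega>1) + of_int q * (k * \<omega>2)" unfolding kw w_def by (simp add: algebra_simps)
    also have "\<dots> = k * (of_int p * \<omega>1 + of_int q * \<omega>2)" by (simp add: algebra_simps)
    finally have "z = of_int p * \<omega>1 + of_int q * \<omega>2" using k0 by simp
    then show "z \<in> lattice_gen \<omega>1 \<omega>2" unfolding lattice_gen_def by blast
  qed
  define f where "f = (\<lambda>A. (*) k ` A)"
  have proj: "f (torus_proj (lattice_gen \<omega>1 \<omega>2) z) = torus_proj (lattice_gen 1 \<tau>) (k * z)" for z
  proof (intro equalityI subsetI)
    fix x assume "x \<in> f (torus_proj (lattice_gen \<omega>1 \<omega>2) z)"
    then obtain y where y: "x = k * y" "y - z \<in> lattice_gen \<omega>1 \<omega>2" by (auto simp: f_def torus_proj_def lattice_rel_def)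
    then have "k * (y - z) \<in> lattice_gen 1 \<tau>" by (simp add: mem)
    then show "x \<in> torus_proj (lattice_gen 1 \<tau>) (k * z)" by (simp add: y torus_proj_def lattice_rel_def algebra_simps)
  next
    fix x assume "x \<in> torus_proj (lattice_gen 1 \<tau>) (k * z)"
    then have "x - k * z \<in> lattice_gen 1 \<tau>" by (simp add: torus_proj_def lattice_rel_def)
    moreover have "x - k * z = k * (x / k - z)" using k0 by (simp add: field_simps)
    ultimately have "x / k - z \<in> lattice_gen \<omega>1 \<omega>2" using mem by simp
    moreover have "x = k * (x / k)" using k0 by simp
    ultimately show "x \<in> f (torus_proj (lattice_gen \<omega>1 \<omega>2) z)" unfolding f_def torus_proj_def lattice_rel_def by blast
  qed
  have ne: "A \<noteq> {}" if A_in: "A \<in> torus (lattice_gen \<omega>1 \<omega>2)" for A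
  proof -
    obtain z where A: "A = torus_proj (lattice_gen \<omega>1 \<omega>2) z" using A_in unfolding torus_def quotient_def torus_proj_def by blast
    have "0 \<in> lattice_gen \<omega>1 \<omega>2" unfolding lattice_gen_def by (auto intro!: exI[of _ "0::int"])
    then have "z \<in> A" by (simp add: A torus_proj_def lattice_rel_def)
    then show ?thesis by blast
  qed
  have "torus_similarity (lattice_gen \<omega>1 \<omega>2) (lattice_gen 1 \<tau>) f"
    unfolding torus_similarity_def
  proof (intro conjI)
    show "bij_betw f (torus (lattice_gen \<omega>1 \<omega>2)) (torus (lattice_gen 1 \<tau>))"
    proof (rule bij_betw_imageI)
      show "inj_on f (torus (lattice_gen \<omega>1 \<omega>2))"
        using k0 by (auto intro!: inj_onI simp: f_def inj_image_eq_iff inj_on_def)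
      have "z \<in> range ((*) k)" for z using k0 by (intro image_eqI[of _ _ "z / k"]) auto
      then have "range ((*) k) = UNIV" by blast
      moreover have "f ` torus (lattice_gen \<omega>1 \<omega>2) = torus_proj (lattice_gen 1 \<tau>) ` range ((*) k)"
        unfolding torus_def quotient_def torus_proj_def[symmetric] using proj by auto
      ultimately show "f ` torus (lattice_gen \<omega>1 \<omega>2) = torus (lattice_gen 1 \<tau>)"
        by (auto simp: torus_def quotient_def torus_proj_def)
    qed
    show "\<exists>c>0. \<forall>x\<in>torus (lattice_gen \<omega>1 \<omega>2). \<forall>y\<in>torus (lattice_gen \<omega>1 \<omega>2). setdist (f x) (f y) = c * setdist x y"
      using k0 ne by (intro exI[of _ "norm k"]) (auto simp: f_def setdist_scale)
    show "\<exists>g. g holomorphic_on UNIV \<and> (\<forall>z. f (torus_proj (lattice_gen \<omega>1 \<omega>2) z) = torus_proj (lattice_gen 1 \<tau>) (g z))"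
      by (intro exI[of _ "\<lambda>z. k * z"] conjI allI proj) (intro holomorphic_intros)
  qed
  then show ?thesis unfolding torus_has_modulus_def using tau by blast
qed

lemma is_lattice_lattice_gen:
  assumes "\<omega>1 \<noteq> 0" "Im (\<omega>2 / \<omega>1) \<noteq> 0"
  shows "is_lattice (lattice_gen \<omega>1 \<omega>2)"
proof -
  have "\<omega>2 \<notin> span {\<omega>1}"
  proof
    assume "\<omega>2 \<in> span {\<omega>1}"
    then obtain k where "\<omega>2 = k *\<^sub>R \<omega>1" by (auto simp: span_singleton)
    then have "\<omega>2 / \<omega>1 = of_real k" using assms by (simp add: scaleR_conv_of_real)
    then show False using assms by simp
  qed
  moreover have "independent {\<omega>1}" using assms by simp
  moreover have ne: "\<omega>2 \<noteq> \<omega>1" using assms by auto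
  ultimately have "independent {\<omega>2, \<omega>1}" by (simp add: independent_insert)
  then show ?thesis unfolding is_lattice_def using ne by (metis insert_commute)
qed

section \<open>The torus formed by two annuli\<close>

lemma bottom_side_barycentric:
  "bottom_side \<epsilon> \<psi> a b k (a * sin \<psi> - b * sin \<epsilon> + 2 * w * sin \<epsilon>)
     = (b - w) *\<^sub>R cis (2 * k * \<epsilon>) + w *\<^sub>R cis (2 * (k + 1) * \<epsilon>) + a *\<^sub>R cis (\<psi> - \<epsilon> + 2 * (k + 1) * \<epsilon>)"
proof -
  define t where "t = (2 * k + 1) * \<epsilon>"
  have c: "cis (2 * k * \<epsilon>) = cis t * cis (- \<epsilon>)" "cis (2 * (k + 1) * \<epsilon>) = cis t * cis \<epsilon>"
    "cis (\<psi> - \<epsilon> + 2 * (k + 1) * \<epsilon>) = cis t * cis \<psi>"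
    by (simp_all add: cis_mult t_def algebra_simps)
  have "(b - w) *\<^sub>R cis (2 * k * \<epsilon>) + w *\<^sub>R cis (2 * (k + 1) * \<epsilon>) + a *\<^sub>R cis (\<psi> - \<epsilon> + 2 * (k + 1) * \<epsilon>)
      = cis t * ((b - w) *\<^sub>R cis (- \<epsilon>) + w *\<^sub>R cis \<epsilon> + a *\<^sub>R cis \<psi>)"
    unfolding c by (simp add: algebra_simps)
  also have "(b - w) *\<^sub>R cis (- \<epsilon>) + w *\<^sub>R cis \<epsilon> + a *\<^sub>R cis \<psi>
      = Complex (a * cos \<psi> + b * cos \<epsilon>) (a * sin \<psi> - b * sin \<epsilon> + 2 * w * sin \<epsilon>)"
    by (simp add: complex_eq_iff algebra_simps)
  finally show ?thesis by (simp add: bottom_side_def t_def)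
qed

lemma top_side_barycentric:
  "top_side \<epsilon> \<psi> a b k (- b * sin \<psi> - a * sin \<epsilon> + 2 * w * sin \<epsilon>)
     = b *\<^sub>R cis (2 * k * \<epsilon>) + (a - w) *\<^sub>R cis (\<psi> - \<epsilon> + 2 * k * \<epsilon>) + w *\<^sub>R cis (\<psi> - \<epsilon> + 2 * (k + 1) * \<epsilon>)"
proof -
  define t where "t = \<psi> + 2 * k * \<epsilon>"
  have c: "cis (2 * k * \<epsilon>) = cis t * cis (- \<psi>)" "cis (\<psi> - \<epsilon> + 2 * k * \<epsilon>) = cis t * cis (- \<epsilon>)"
    "cis (\<psi> - \<epsilon> + 2 * (k + 1) * \<epsilon>) = cis t * cis \<epsilon>"
    by (simp_all add: cis_mult t_def algebra_simps)
  have "b *\<^sub>R cis (2 * k * \<epsilon>) + (a - w) *\<^sub>R cis (\<psi> - \<epsilon> + 2 * k * \<epsilon>) + w *\<^sub>R cis (\<psi> - \<epsilon> + 2 * (k + 1) * \<epsilon>)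
      = cis t * (b *\<^sub>R cis (- \<psi>) + (a - w) *\<^sub>R cis (- \<epsilon>) + w *\<^sub>R cis \<epsilon>)"
    unfolding c by (simp add: algebra_simps)
  also have "b *\<^sub>R cis (- \<psi>) + (a - w) *\<^sub>R cis (- \<epsilon>) + w *\<^sub>R cis \<epsilon>
      = Complex (b * cos \<psi> + a * cos \<epsilon>) (- b * sin \<psi> - a * sin \<epsilon> + 2 * w * sin \<epsilon>)"
    by (simp add: complex_eq_iff algebra_simps)
  finally show ?thesis by (simp add: top_side_def t_def)
qed

text \<open>
  Every triangle in question has one horizontal edge and its third vertex at a different height, in space as
  well as in the developed strip.
\<close>

lemma triangle_vertices_by_height:
  fixes a b c :: "'a::real_vector"
  assumes L: "linear f" and ab: "a \<noteq> b" and h: "f a = f b" "f c \<noteq> (f a :: real)"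
  shows "triangle_vertices {a, b, c}"
proof -
  have ne: "c \<noteq> a" "c \<noteq> b" using h by auto
  have "\<not> affine_dependent {a, b, c}"
  proof
    assume "affine_dependent {a, b, c}"
    then obtain u :: "'a \<Rightarrow> real" where u: "sum u {a, b, c} = 0" "\<exists>v\<in>{a, b, c}. u v \<noteq> 0" "(\<Sum>v\<in>{a, b, c}. u v *\<^sub>R v) = 0"
      unfolding affine_dependent_explicit_finite[OF finite.insertI[OF finite.insertI[OF finite.insertI[OF finite.emptyI]]]] by blast
    have s: "u a + u b + u c = 0" using u(1) ab ne by (simp add: add.assoc)
    have v: "u a *\<^sub>R a + u b *\<^sub>R b + u c *\<^sub>R c = 0" using u(3) ab ne by (simp add: add.assoc)
    have "f (u a *\<^sub>R a + u b *\<^sub>R b + u c *\<^sub>R c) = u a * f a + u b * f b + u c * f c"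
      by (simp add: linear_add[OF L] linear_scale[OF L])
    then have "u a * f a + u b * f a + u c * f c = 0" using v linear_0[OF L] h(1) by simp
    moreover have "u a = - u b - u c" using s by simp
    ultimately have "u c * (f c - f a) = 0" by (simp add: algebra_simps)
    then have uc: "u c = 0" using h by simp
    then have ua: "u a = - u b" using s by simp
    have "u b *\<^sub>R (b - a) = 0" using v uc ua by (simp add: algebra_simps)
    then have "u b = 0" using ab by simp
    then show False using u(2) uc ua by auto
  qed
  then show ?thesis unfolding triangle_vertices_def using ab ne by auto
qed

lemma dist_cis: "(dist (cis x) (cis y))\<^sup>2 = 2 - 2 * cos (x - y)"
proof -
  have "(dist (cis x) (cis y))\<^sup>2 = (cos x - cos y)\<^sup>2 + (sin x - sin y)\<^sup>2"
    by (simp add: dist_norm cmod_power2)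
  also have "\<dots> = ((sin x)\<^sup>2 + (cos x)\<^sup>2) + ((sin y)\<^sup>2 + (cos y)\<^sup>2) - 2 * cos (x - y)"
    unfolding cos_diff by (simp add: power2_eq_square algebra_simps)
  finally show ?thesis by simp
qed

lemma dist_same_height: "dist (x, c) (y, c) = dist x y" by (simp add: dist_Pair_Pair)

text \<open>
  The vertices \<open>P k\<close> and \<open>Q \<psi> k\<close> are indexed by all integers.  Row \<open>0\<close> of the integer plane carries the bottom
  vertices and row \<open>1\<close> the top vertices; the strip between them is the first annulus and the strip above row
  \<open>1\<close> the second one, traversed downwards.  The index is displaced by \<open>l + 1\<close> whenever the row increases by
  \<open>2\<close>: \<open>l\<close> comes from the identification of top vertices, and \<open>1\<close> from the diagonals of the second
  annulus, which lean the other way when it is traversed downwards.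
\<close>

locale two_annuli =
  fixes n l :: int and \<epsilon> \<phi> h :: real
  assumes n3: "3 \<le> n" and eps: "\<epsilon> = pi / n" and l: "2 \<le> l" "l + 1 < n"
    and phi: "\<epsilon> < \<phi>" "\<phi> < pi - (l + 1) * \<epsilon>" and h0: "0 < h"
begin

definition "\<psi>r = - \<phi> - l * \<epsilon>"
definition "\<psi>s = l * \<epsilon> - \<phi>"

definition P :: "int \<Rightarrow> complex \<times> real" where "P k = (cis (2 * k * \<epsilon>), 0)"
definition Q :: "real \<Rightarrow> int \<Rightarrow> complex \<times> real" where "Q \<psi> k = (cis (\<psi> - \<epsilon> + 2 * k * \<epsilon>), h)"

definition X :: "int \<times> int \<Rightarrow> complex \<times> real" where
  "X p = (let k = fst p - snd p div 2 * (l + 1) in if even (snd p) then P k else Q \<psi>r k)"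

text \<open>
  The height of the flat strip to which an annulus unrolls, not of the annulus in space.
\<close>

definition height :: "real \<Rightarrow> real" where "height \<psi> = sqrt (h\<^sup>2 + (cos \<epsilon> - cos \<psi>)\<^sup>2)"

text \<open>
  The rows of vertices develop to horizontal rows.  \<open>E1\<close> and \<open>E2\<close> are the positions of the vertices \<open>(0, 1)\<close> and
  \<open>(0, 2)\<close> if \<open>(0, 0)\<close> is put at the origin.
\<close>

definition E1 :: complex where "E1 = Complex (sin \<psi>r - sin \<epsilon>) (height \<psi>r)"
definition E2 :: complex where "E2 = Complex (sin \<psi>r - sin \<psi>s - 2 * sin \<epsilon>) (height \<psi>r + height \<psi>s)"
definition E :: "int \<Rightarrow> complex" where "E j = of_int (j div 2) * E2 + (if even j then 0 else E1)"

definition Y :: "int \<times> int \<Rightarrow> complex" where "Y p = of_real (2 * sin \<epsilon> * fst p) + E (snd p)"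

definition \<omega>1 :: complex where "\<omega>1 = of_real (2 * sin \<epsilon> * n)"
definition \<omega>2 :: complex where "\<omega>2 = of_real (2 * sin \<epsilon> * (l + 1)) + E2"

lemma ne: "n * \<epsilon> = pi" using n3 eps by simp
lemma e0: "0 < \<epsilon>" "\<epsilon> < pi / 2" using step_angle_bounds[OF n3 eps] by auto
lemma sin_e: "0 < sin \<epsilon>" using e0 by (intro sin_gt_zero) auto
lemma height_pos: "0 < height \<psi>" unfolding height_def using h0 by (simp add: add_pos_nonneg)

lemma \<psi>_bounds: "\<bar>\<psi>r\<bar> < pi - \<epsilon>" "\<bar>\<psi>s\<bar> < pi - \<epsilon>"
proof -
  have "l * \<epsilon> + \<phi> + \<epsilon> < pi" using phi(2) by (simp add: algebra_simps)
  moreover have "0 < l * \<epsilon>" using l e0 by simp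
  ultimately show "\<bar>\<psi>r\<bar> < pi - \<epsilon>" "\<bar>\<psi>s\<bar> < pi - \<epsilon>" unfolding \<psi>r_def \<psi>s_def using phi(1) e0(1) by linarith+
qed

lemma P_period: "P (k + n * q) = P k"
  using cis_period[OF ne, of "2 * k * \<epsilon>" q] by (simp add: P_def algebra_simps)

lemma Q_period: "Q \<psi> (k + n * q) = Q \<psi> k"
  using cis_period[OF ne, of "\<psi> - \<epsilon> + 2 * k * \<epsilon>" q] by (simp add: Q_def algebra_simps)

lemma Q_shift: "Q \<psi>r (k + l) = Q \<psi>s k"
  by (simp add: Q_def \<psi>r_def \<psi>s_def algebra_simps)

lemma X_even: "X (i, 2 * q) = P (i - q * (l + 1))"
  by (simp add: X_def)

lemma X_odd: "X (i, 2 * q + 1) = Q \<psi>s (i - q * (l + 1) - l)"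
  using Q_shift[of "i - q * (l + 1) - l"] by (simp add: X_def)

lemma X_odd': "X (i, 2 * q + 1) = Q \<psi>r (i - q * (l + 1))"
  by (simp add: X_def)

lemma X1: "X (p + (n, 0)) = X p"
  using P_period[of "fst p - snd p div 2 * (l + 1)" 1] Q_period[of \<psi>r "fst p - snd p div 2 * (l + 1)" 1]
  by (simp add: X_def Let_def algebra_simps)

lemma X2: "X (p + (l + 1, 2)) = X p"
proof -
  have index: "fst (p + (l + 1, 2)) - snd (p + (l + 1, 2)) div 2 * (l + 1) = fst p - snd p div 2 * (l + 1)"
    by (simp add: algebra_simps)
  have parity: "even (snd (p + (l + 1, 2))) = even (snd p)" by simp
  show ?thesis unfolding X_def Let_def index parity ..
qed

lemma Y1: "Y (p + (n, 0)) = Y p + \<omega>1" by (simp add: Y_def \<omega>1_def algebra_simps)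
lemma Y2: "Y (p + (l + 1, 2)) = Y p + \<omega>2" by (simp add: Y_def \<omega>2_def E_def algebra_simps)

lemma row_cases:
  obtains q where "j = 2 * q" | q where "j = 2 * q + (1 :: int)"
  by (meson evenE oddE)

lemma dist_chord: "dist (cis x) (cis (x + 2 * \<epsilon>)) = 2 * sin \<epsilon>"
proof -
  have "(dist (cis x) (cis (x + 2 * \<epsilon>)))\<^sup>2 = 2 - 2 * cos (- (2 * \<epsilon>))" by (simp add: dist_cis)
  also have "\<dots> = (2 * sin \<epsilon>)\<^sup>2" by (simp add: cos_double_sin power2_eq_square)
  finally show ?thesis by (rule power2_eq_imp_eq) (use sin_e in auto)
qed

lemma dist_PP: "dist (P k) (P (k + 1)) = 2 * sin \<epsilon>"
proof -
  have next_angle: "2 * real_of_int (k + 1) * \<epsilon> = 2 * real_of_int k * \<epsilon> + 2 * \<epsilon>" by (simp add: algebra_simps)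
  show ?thesis by (simp only: P_def next_angle dist_same_height dist_chord)
qed

lemma dist_QQ: "dist (Q \<psi> k) (Q \<psi> (k + 1)) = 2 * sin \<epsilon>"
proof -
  have next_angle: "\<psi> - \<epsilon> + 2 * real_of_int (k + 1) * \<epsilon> = \<psi> - \<epsilon> + 2 * real_of_int k * \<epsilon> + 2 * \<epsilon>" by (simp add: algebra_simps)
  show ?thesis by (simp only: Q_def next_angle dist_same_height dist_chord)
qed

text \<open>
  In the unrolled strip the edges \<open>P\<^sub>k Q\<^sub>k\<close> and \<open>P\<^sub>k Q\<^sub>k\<^sub>+\<^sub>1\<close> have the horizontal components
  \<open>sin \<psi> - sin \<epsilon>\<close> and \<open>sin \<psi> + sin \<epsilon>\<close>, and they have the same lengths as in space.
\<close>

lemma strip_length: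
  "(sin \<psi> - sin \<epsilon>)\<^sup>2 + (height \<psi>)\<^sup>2 = 2 - 2 * cos (\<psi> - \<epsilon>) + h\<^sup>2"
  "(sin \<psi> + sin \<epsilon>)\<^sup>2 + (height \<psi>)\<^sup>2 = 2 - 2 * cos (\<psi> + \<epsilon>) + h\<^sup>2"
proof -
  have *: "(sin x)\<^sup>2 = 1 - (cos x)\<^sup>2" for x :: real by (simp add: sin_squared_eq)
  have hh: "(height \<psi>)\<^sup>2 = h\<^sup>2 + (cos \<epsilon> - cos \<psi>)\<^sup>2" by (simp add: height_def)
  show "(sin \<psi> - sin \<epsilon>)\<^sup>2 + (height \<psi>)\<^sup>2 = 2 - 2 * cos (\<psi> - \<epsilon>) + h\<^sup>2"
    "(sin \<psi> + sin \<epsilon>)\<^sup>2 + (height \<psi>)\<^sup>2 = 2 - 2 * cos (\<psi> + \<epsilon>) + h\<^sup>2"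
    unfolding hh by (simp_all add: power2_sum power2_diff * cos_add cos_diff algebra_simps)
qed

lemma dist_PQ: "dist (P k) (Q \<psi> k) = norm (Complex (sin \<psi> - sin \<epsilon>) (height \<psi>))"
proof -
  have "(dist (P k) (Q \<psi> k))\<^sup>2 = (2 - 2 * cos (2 * k * \<epsilon> - (\<psi> - \<epsilon> + 2 * k * \<epsilon>))) + h\<^sup>2"
    by (simp add: P_def Q_def dist_Pair_Pair dist_cis)
  also have "2 * k * \<epsilon> - (\<psi> - \<epsilon> + 2 * k * \<epsilon>) = - (\<psi> - \<epsilon>)" by simp
  also have "2 - 2 * cos (- (\<psi> - \<epsilon>)) + h\<^sup>2 = (norm (Complex (sin \<psi> - sin \<epsilon>) (height \<psi>)))\<^sup>2"
    unfolding cos_minus using strip_length(1)[of \<psi>] by (simp add: cmod_power2)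
  finally show ?thesis by (simp add: power2_eq_iff_nonneg)
qed

lemma dist_PQ_next: "dist (P k) (Q \<psi> (k + 1)) = norm (Complex (sin \<psi> + sin \<epsilon>) (height \<psi>))"
proof -
  have "(dist (P k) (Q \<psi> (k + 1)))\<^sup>2 = (2 - 2 * cos (2 * k * \<epsilon> - (\<psi> - \<epsilon> + 2 * (k + 1) * \<epsilon>))) + h\<^sup>2"
    by (simp add: P_def Q_def dist_Pair_Pair dist_cis)
  also have "2 * k * \<epsilon> - (\<psi> - \<epsilon> + 2 * (k + 1) * \<epsilon>) = - (\<psi> + \<epsilon>)" by (simp add: algebra_simps)
  also have "2 - 2 * cos (- (\<psi> + \<epsilon>)) + h\<^sup>2 = (norm (Complex (sin \<psi> + sin \<epsilon>) (height \<psi>)))\<^sup>2"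
    unfolding cos_minus using strip_length(2)[of \<psi>] by (simp add: cmod_power2)
  finally show ?thesis by (simp add: power2_eq_iff_nonneg)
qed

lemma dist_horizontal: "dist (X p) (X (p + (1, 0))) = dist (Y p) (Y (p + (1, 0)))"
proof -
  obtain i j where p: "p = (i, j)" by (cases p) blast
  have "dist (Y p) (Y (p + (1, 0))) = norm (of_real (- (2 * sin \<epsilon>)) :: complex)"
    unfolding p by (simp add: Y_def dist_norm algebra_simps)
  also have "\<dots> = 2 * sin \<epsilon>" using sin_e unfolding norm_of_real by simp
  finally have Y: "dist (Y p) (Y (p + (1, 0))) = 2 * sin \<epsilon>" .
  show ?thesis
  proof (cases j rule: row_cases)
    case (1 q)
    then show ?thesis unfolding Y unfolding p
      using dist_PP[of "i - q * (l + 1)"] X_even[of i q] X_even[of "i + 1" q] by (simp add: algebra_simps)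
  next
    case (2 q)
    then show ?thesis unfolding Y unfolding p
      using dist_QQ[of \<psi>r "i - q * (l + 1)"] X_odd'[of i q] X_odd'[of "i + 1" q] by (simp add: algebra_simps)
  qed
qed

lemma E_step_even: "E (2 * q + 1) - E (2 * q) = E1" by (simp add: E_def)
lemma E_step_odd: "E (2 * q + 2) - E (2 * q + 1) = E2 - E1"
proof -
  have "(2 * q + 2) div 2 = q + 1" "even (2 * q + 2)" by simp_all
  then show ?thesis by (simp add: E_def algebra_simps)
qed

lemma dist_vertical: "dist (X p) (X (p + (0, 1))) = dist (Y p) (Y (p + (0, 1)))"
proof -
  obtain i j where p: "p = (i, j)" by (cases p) blast
  have Y: "dist (Y p) (Y (p + (0, 1))) = norm (E (j + 1) - E j)"
    unfolding p by (simp add: Y_def dist_norm norm_minus_commute)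
  show ?thesis
  proof (cases j rule: row_cases)
    case (1 q)
    have "dist (Y p) (Y (p + (0, 1))) = norm E1" unfolding Y 1 E_step_even ..
    moreover have "dist (X p) (X (p + (0, 1))) = dist (P (i - q * (l + 1))) (Q \<psi>r (i - q * (l + 1)))"
      unfolding p 1 using X_even[of i q] X_odd'[of i q] by simp
    ultimately show ?thesis unfolding E1_def dist_PQ by simp
  next
    case (2 q)
    define k where "k = i - (q + 1) * (l + 1)"
    have "dist (Y p) (Y (p + (0, 1))) = norm (E2 - E1)" unfolding Y 2 using E_step_odd[of q] by (simp add: add.assoc)
    also have "E2 - E1 = - cnj (Complex (sin \<psi>s + sin \<epsilon>) (height \<psi>s))"
      by (simp add: E1_def E2_def complex_eq_iff)
    finally have "dist (Y p) (Y (p + (0, 1))) = norm (Complex (sin \<psi>s + sin \<epsilon>) (height \<psi>s))"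
      by (simp only: norm_minus_cancel complex_mod_cnj)
    moreover have "dist (X p) (X (p + (0, 1))) = dist (Q \<psi>s (k + 1)) (P k)"
      unfolding p 2 using X_odd[of i q] X_even[of i "q + 1"] by (simp add: k_def algebra_simps)
    ultimately show ?thesis unfolding dist_commute[of "Q \<psi>s (k + 1)"] dist_PQ_next by simp
  qed
qed

lemma dist_diagonal: "dist (X p) (X (p + (1, 1))) = dist (Y p) (Y (p + (1, 1)))"
proof -
  obtain i j where p: "p = (i, j)" by (cases p) blast
  have "Y (p + (1, 1)) - Y p = E (j + 1) - E j + of_real (2 * sin \<epsilon>)"
    unfolding p by (simp add: Y_def algebra_simps)
  moreover have "dist (Y p) (Y (p + (1, 1))) = norm (Y (p + (1, 1)) - Y p)"
    by (simp add: dist_norm norm_minus_commute)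
  ultimately have Y: "dist (Y p) (Y (p + (1, 1))) = norm (E (j + 1) - E j + of_real (2 * sin \<epsilon>))"
    by (simp only:)
  show ?thesis
  proof (cases j rule: row_cases)
    case (1 q)
    have "dist (Y p) (Y (p + (1, 1))) = norm (E1 + of_real (2 * sin \<epsilon>))" unfolding Y 1 E_step_even ..
    also have "E1 + of_real (2 * sin \<epsilon>) = Complex (sin \<psi>r + sin \<epsilon>) (height \<psi>r)" by (simp add: E1_def complex_eq_iff)
    finally have "dist (Y p) (Y (p + (1, 1))) = norm (Complex (sin \<psi>r + sin \<epsilon>) (height \<psi>r))" .
    moreover have "dist (X p) (X (p + (1, 1))) = dist (P (i - q * (l + 1))) (Q \<psi>r (i - q * (l + 1) + 1))"
      unfolding p 1 using X_even[of i q] X_odd'[of "i + 1" q] by (simp add: algebra_simps)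
    ultimately show ?thesis unfolding dist_PQ_next by simp
  next
    case (2 q)
    define k where "k = i - q * (l + 1) - l"
    have "dist (Y p) (Y (p + (1, 1))) = norm (E2 - E1 + of_real (2 * sin \<epsilon>))"
      unfolding Y 2 using E_step_odd[of q] by (simp add: add.assoc)
    also have "E2 - E1 + of_real (2 * sin \<epsilon>) = - cnj (Complex (sin \<psi>s - sin \<epsilon>) (height \<psi>s))"
      by (simp add: E1_def E2_def complex_eq_iff)
    finally have "dist (Y p) (Y (p + (1, 1))) = norm (Complex (sin \<psi>s - sin \<epsilon>) (height \<psi>s))"
      by (simp only: norm_minus_cancel complex_mod_cnj)
    moreover have "dist (X p) (X (p + (1, 1))) = dist (Q \<psi>s k) (P k)"
      unfolding p 2 using X_odd[of i q] X_even[of "i + 1" "q + 1"] by (simp add: k_def algebra_simps)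
    ultimately show ?thesis unfolding dist_commute[of "Q \<psi>s k"] dist_PQ by simp
  qed
qed

lemma edges:
  assumes "u \<in> tri b p" "v \<in> tri b p"
  shows "dist (X u) (X v) = dist (Y u) (Y v)"
proof -
  have m: "dist (X p) (X (mid b p)) = dist (Y p) (Y (mid b p))"
    using dist_horizontal dist_vertical by (simp add: mid_def)
  have "p + (1, 1) = mid b p + (if b then (0, 1) else (1, 0))" by (cases p) (simp add: mid_def)
  then have d: "dist (X (mid b p)) (X (p + (1, 1))) = dist (Y (mid b p)) (Y (p + (1, 1)))"
    using dist_horizontal dist_vertical by simp
  show ?thesis using assms m d dist_diagonal[of p] unfolding tri_def by (auto simp: dist_commute)
qed

lemma Im_E_step: "Im (E j) < Im (E (j + 1))"
proof (cases j rule: row_cases)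
  case (1 q)
  have "Im (E (j + 1) - E j) = height \<psi>r" unfolding 1 E_step_even by (simp add: E1_def)
  then show ?thesis using height_pos[of \<psi>r] by simp
next
  case (2 q)
  have "Im (E (j + 1) - E j) = height \<psi>s" using E_step_odd[of q] unfolding 2 by (simp add: E1_def E2_def add.assoc)
  then show ?thesis using height_pos[of \<psi>s] by simp
qed

lemma Im_Y: "Im (Y p) = Im (E (snd p))" by (simp add: Y_def)

lemma Y_horizontal_neq: "Y p \<noteq> Y (p + (1, 0))"
  using sin_e by (simp add: Y_def algebra_simps)

lemma X_horizontal_neq: "X p \<noteq> X (p + (1, 0))"
  using Y_horizontal_neq[of p] dist_horizontal[of p] by auto

lemma snd_X: "snd (X p) = (if even (snd p) then 0 else h)"
  by (simp add: X_def Let_def P_def Q_def)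

lemma nondegenerate:
  "triangle_vertices (Y ` tri b p)" "triangle_vertices (X ` tri b p)"
proof -
  have im: "linear Im" and sn: "linear (snd :: complex \<times> real \<Rightarrow> real)" by (auto intro!: linearI)
  have eq: "p + (0, 1) + (1, 0) = p + (1, 1)" by (cases p) simp
  have "Y ` tri True p = {Y p, Y (p + (1, 0)), Y (p + (1, 1))}" "X ` tri True p = {X p, X (p + (1, 0)), X (p + (1, 1))}"
    by (simp_all add: tri_def mid_def)
  moreover have "Y ` tri False p = {Y (p + (0, 1)), Y (p + (0, 1) + (1, 0)), Y p}"
    "X ` tri False p = {X (p + (0, 1)), X (p + (0, 1) + (1, 0)), X p}"
    by (auto simp: tri_def mid_def eq)
  moreover have "triangle_vertices {Y p, Y (p + (1, 0)), Y (p + (1, 1))}"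
    by (rule triangle_vertices_by_height[OF im Y_horizontal_neq]) (use Im_E_step[of "snd p"] in \<open>auto simp: Im_Y\<close>)
  moreover have "triangle_vertices {Y (p + (0, 1)), Y (p + (0, 1) + (1, 0)), Y p}"
    by (rule triangle_vertices_by_height[OF im Y_horizontal_neq]) (use Im_E_step[of "snd p"] in \<open>auto simp: Im_Y\<close>)
  moreover have "triangle_vertices {X p, X (p + (1, 0)), X (p + (1, 1))}"
    by (rule triangle_vertices_by_height[OF sn X_horizontal_neq]) (use h0 in \<open>auto simp: snd_X\<close>)
  moreover have "triangle_vertices {X (p + (0, 1)), X (p + (0, 1) + (1, 0)), X p}"
    by (rule triangle_vertices_by_height[OF sn X_horizontal_neq]) (use h0 in \<open>auto simp: snd_X\<close>)
  ultimately show "triangle_vertices (Y ` tri b p)" "triangle_vertices (X ` tri b p)" by (cases b; simp)+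
qed

lemma pl_Y: "pl Y z = of_real (2 * sin \<epsilon> * fst z)
    + ((1 - frac (snd z)) *\<^sub>R E \<lfloor>snd z\<rfloor> + frac (snd z) *\<^sub>R E (\<lfloor>snd z\<rfloor> + 1))"
proof -
  obtain x y where z: "z = (x, y)" by (cases z) blast
  have x: "x = of_int \<lfloor>x\<rfloor> + frac x" by (simp add: frac_def)
  define i u j v where "i = \<lfloor>x\<rfloor>" and "u = frac x" and "j = \<lfloor>y\<rfloor>" and "v = frac y"
  have x: "x = of_int i + u" by (simp add: frac_def i_def u_def)
  show ?thesis unfolding z pl_def Let_def fst_conv snd_conv i_def[symmetric] u_def[symmetric] j_def[symmetric] v_def[symmetric]
    unfolding x by (auto simp: mid_def Y_def algebra_simps scaleR_conv_of_real)
qed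

text \<open>
  The development preserves horizontal lines and is a translation on each, up to the factor \<open>2 sin \<epsilon>\<close>; the height
  of a line is a strictly increasing and unbounded function \<open>H\<close> of the ordinate.
\<close>

lemma bij_pl_Y: "bij (pl Y)"
proof -
  define e where "e j = Im (E j)" for j
  define H where "H y = (1 - frac y) * e \<lfloor>y\<rfloor> + frac y * e (\<lfloor>y\<rfloor> + 1)" for y
  have Im_pl: "Im (pl Y z) = H (snd z)" for z by (simp add: pl_Y H_def e_def)
  have step: "e j < e (j + 1)" for j unfolding e_def by (rule Im_E_step)
  have mono: "e i \<le> e j" if "i \<le> j" for i j
    using that
  proof (induction j rule: int_ge_induct)
    case (step k) then show ?case using \<open>\<And>j. e j < e (j + 1)\<close>[of k] by simp
  qed simp
  have H_bounds: "e \<lfloor>y\<rfloor> \<le> H y" "H y < e (\<lfloor>y\<rfloor> + 1)" for y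
  proof -
    have f: "0 \<le> frac y" "frac y < 1" by (simp_all add: frac_lt_1)
    have "H y = e \<lfloor>y\<rfloor> + frac y * (e (\<lfloor>y\<rfloor> + 1) - e \<lfloor>y\<rfloor>)" by (simp add: H_def algebra_simps)
    then show "e \<lfloor>y\<rfloor> \<le> H y" using f step[of "\<lfloor>y\<rfloor>"] by simp
    have "e (\<lfloor>y\<rfloor> + 1) - H y = (1 - frac y) * (e (\<lfloor>y\<rfloor> + 1) - e \<lfloor>y\<rfloor>)" by (simp add: H_def algebra_simps)
    then show "H y < e (\<lfloor>y\<rfloor> + 1)" using f step[of "\<lfloor>y\<rfloor>"] by (smt (verit) mult_pos_pos)
  qed
  have H_less: "H y < H y'" if "y < y'" for y y'
  proof (cases "\<lfloor>y\<rfloor> = \<lfloor>y'\<rfloor>")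
    case True
    have "H y' - H y = (frac y' - frac y) * (e (\<lfloor>y\<rfloor> + 1) - e \<lfloor>y\<rfloor>)" using True by (simp add: H_def algebra_simps)
    moreover have "frac y < frac y'" using that True by (simp add: frac_def)
    ultimately show ?thesis using step[of "\<lfloor>y\<rfloor>"] by (smt (verit) mult_pos_pos)
  next
    case False
    then have "\<lfloor>y\<rfloor> + 1 \<le> \<lfloor>y'\<rfloor>" using that floor_mono[of y y'] by simp
    then show ?thesis using mono[of "\<lfloor>y\<rfloor> + 1" "\<lfloor>y'\<rfloor>"] H_bounds[of y] H_bounds[of y'] by linarith
  qed
  have "inj (pl Y)"
  proof (rule injI)
    fix z z' assume eq: "pl Y z = pl Y z'"
    then have "H (snd z) = H (snd z')" using Im_pl by metis
    then have y: "snd z = snd z'" using H_less by (metis less_irrefl linorder_less_linear)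
    then have "of_real (2 * sin \<epsilon> * fst z) = (of_real (2 * sin \<epsilon> * fst z') :: complex)" using eq unfolding pl_Y by simp
    then have "fst z = fst z'" using sin_e by (simp only: of_real_eq_iff) simp
    then show "z = z'" using y by (simp add: prod_eq_iff)
  qed
  moreover have "surj (pl Y)"
  proof (rule surjI)
    have E2: "e (2 * q) = q * Im E2" for q by (simp add: e_def E_def)
    have E2_pos: "Im E2 > 0" using height_pos[of \<psi>r] height_pos[of \<psi>s] by (simp add: E2_def)
    have H_int: "H (of_int j) = e j" for j by (simp add: H_def)
    have "continuous_on UNIV (\<lambda>y. pl Y (0, y))"
      by (rule continuous_on_compose2[OF continuous_on_pl]) (auto intro!: continuous_intros)
    then have "continuous_on UNIV (\<lambda>y. Im (pl Y (0, y)))" by (rule continuous_on_Im)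
    then have contH: "continuous_on UNIV H" by (simp add: Im_pl)
    have H_surj: "\<exists>y. H y = t" for t
    proof -
      define q where "q = \<lfloor>t / Im E2\<rfloor>"
      have "q * Im E2 \<le> t" "t \<le> (q + 1) * Im E2"
      proof -
        have "q \<le> t / Im E2" "t / Im E2 \<le> q + 1" unfolding q_def by linarith+
        then show "q * Im E2 \<le> t" "t \<le> (q + 1) * Im E2" using E2_pos by (simp_all add: field_simps)
      qed
      then have "H (of_int (2 * q)) \<le> t" "t \<le> H (of_int (2 * (q + 1)))" unfolding H_int E2 by simp_all
      moreover have "real_of_int (2 * q) \<le> of_int (2 * (q + 1))" by simp
      moreover have "continuous_on {of_int (2 * q)..of_int (2 * (q + 1))} H" using contH continuous_on_subset by blast
      ultimately show ?thesis using IVT'[of H "of_int (2 * q)" t "of_int (2 * (q + 1))"] by blast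
    qed
    define y where "y t = (SOME y. H y = t)" for t
    have y: "H (y t) = t" for t unfolding y_def using someI_ex[OF H_surj] .
    show "pl Y ((Re w - Re (pl Y (0, y (Im w)))) / (2 * sin \<epsilon>), y (Im w)) = w" for w
    proof (rule complex_eqI)
      show "Im (pl Y ((Re w - Re (pl Y (0, y (Im w)))) / (2 * sin \<epsilon>), y (Im w))) = Im w" by (simp add: Im_pl y)
      show "Re (pl Y ((Re w - Re (pl Y (0, y (Im w)))) / (2 * sin \<epsilon>), y (Im w))) = Re w"
        using sin_e unfolding pl_Y by simp
    qed
  qed
  ultimately show ?thesis by (simp add: bij_def)
qed

text \<open>
  Horizontal lines of the first strip are mapped to the polygons of the first annulus.
\<close>

lemma row0:
  assumes z: "z = (of_int i + u, v)" and u: "0 \<le> u" "u < 1" and v: "0 \<le> v" "v < 1"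
  shows "pl X z = (level_curve \<epsilon> \<psi>r v (1 - v) i u, v * h)"
proof -
  have fl: "\<lfloor>fst z\<rfloor> = i" "frac (fst z) = u" "\<lfloor>snd z\<rfloor> = 0" "frac (snd z) = v"
    using floor_frac_unique[OF u, of i] floor_frac_unique[OF v, of 0] by (simp_all add: z)
  have X: "X (i, 0) = P i" "X (i + 1, 0) = P (i + 1)" "X (i, 1) = Q \<psi>r i" "X (i + 1, 1) = Q \<psi>r (i + 1)"
    using X_even[of _ 0] X_odd'[of _ 0] by simp_all
  show ?thesis
  proof (cases "v \<le> u")
    case True
    then have "pl X z = (1 - u) *\<^sub>R P i + (u - v) *\<^sub>R P (i + 1) + v *\<^sub>R Q \<psi>r (i + 1)"
      by (simp add: pl_def Let_def fl mid_def X)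
    also have "\<dots> = (level_curve \<epsilon> \<psi>r v (1 - v) i u, v * h)"
      using True bottom_side_barycentric[of \<epsilon> \<psi>r v "1 - v" i "u - v"]
      by (simp add: level_curve_def P_def Q_def algebra_simps)
    finally show ?thesis .
  next
    case False
    then have "pl X z = (1 - v) *\<^sub>R P i + (v - u) *\<^sub>R Q \<psi>r i + u *\<^sub>R Q \<psi>r (i + 1)"
      by (simp add: pl_def Let_def fl mid_def X)
    also have "\<dots> = (level_curve \<epsilon> \<psi>r v (1 - v) i u, v * h)"
      using False top_side_barycentric[of \<epsilon> \<psi>r v "1 - v" i u]
      by (simp add: level_curve_def P_def Q_def algebra_simps)
    finally show ?thesis .
  qed
qed

text \<open>
  In the second strip the diagonals and the vertical edges have exchanged roles, so the period of the polygon
  that starts at the diagonal is cut by the vertical edge.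
\<close>

lemma row1:
  assumes z: "z = (of_int i + u, 1 + v)" and u: "0 \<le> u" "u < 1" and v: "0 \<le> v" "v < 1"
  shows "pl X z = (if v \<le> u then level_curve \<epsilon> \<psi>s (1 - v) v (i - l) (u - v)
      else level_curve \<epsilon> \<psi>s (1 - v) v (i - l - 1) (u - v + 1), (1 - v) * h)"
proof -
  have fl: "\<lfloor>fst z\<rfloor> = i" "frac (fst z) = u" "\<lfloor>snd z\<rfloor> = 1" "frac (snd z) = v"
    using floor_frac_unique[OF u, of i] floor_frac_unique[OF v, of 1] by (simp_all add: z)
  have X: "X (i, 1) = Q \<psi>s (i - l)" "X (i + 1, 1) = Q \<psi>s (i - l + 1)" "X (i, 2) = P (i - l - 1)" "X (i + 1, 2) = P (i - l)"
    using X_even[of i 1] X_even[of "i + 1" 1] X_odd[of i 0] X_odd[of "i + 1" 0] by (simp_all add: algebra_simps)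
  show ?thesis
  proof (cases "v \<le> u")
    case True
    then have "pl X z = (1 - u) *\<^sub>R Q \<psi>s (i - l) + (u - v) *\<^sub>R Q \<psi>s (i - l + 1) + v *\<^sub>R P (i - l)"
      by (simp add: pl_def Let_def fl mid_def X)
    also have "\<dots> = (level_curve \<epsilon> \<psi>s (1 - v) v (i - l) (u - v), (1 - v) * h)"
      using True u top_side_barycentric[of \<epsilon> \<psi>s "1 - v" v "i - l" "u - v"]
      by (simp add: level_curve_def P_def Q_def algebra_simps)
    finally show ?thesis using True by simp
  next
    case False
    then have "pl X z = (1 - v) *\<^sub>R Q \<psi>s (i - l) + (v - u) *\<^sub>R P (i - l - 1) + u *\<^sub>R P (i - l)"
      by (simp add: pl_def Let_def fl mid_def X)
    also have "\<dots> = (level_curve \<epsilon> \<psi>s (1 - v) v (i - l - 1) (u - v + 1), (1 - v) * h)"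
      using False u bottom_side_barycentric[of \<epsilon> \<psi>s "1 - v" v "i - l - 1" u]
      by (simp add: level_curve_def P_def Q_def algebra_simps)
    finally show ?thesis using False by simp
  qed
qed

lemma rows_disjoint:
  assumes u: "0 \<le> u" "u < 1" "0 \<le> u'" "u' < 1" and v: "0 \<le> v" "v < 1" "0 \<le> v'" "v' < 1"
  shows "pl X (of_int i + u, v) \<noteq> pl X (of_int i' + u', 1 + v')"
proof
  assume eq: "pl X (of_int i + u, v) = pl X (of_int i' + u', 1 + v')"
  then have "v * h = (1 - v') * h" unfolding row0[OF refl u(1,2) v(1,2)] row1[OF refl u(3,4) v(3,4)] by simp
  then have vv: "1 - v' = v" "v' = 1 - v" using h0 by simp_all
  define w where "w = (if v' \<le> u' then u' - v' else u' - v' + 1)"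
  define k where "k = (if v' \<le> u' then i' - l else i' - l - 1)"
  have "level_curve \<epsilon> \<psi>r v (1 - v) i u = level_curve \<epsilon> \<psi>s v (1 - v) k w"
    using eq unfolding row0[OF refl u(1,2) v(1,2)] row1[OF refl u(3,4) v(3,4)] w_def k_def vv(1) vv(2)[symmetric]
    by (auto simp: vv split: if_splits)
  moreover have "level_curve \<epsilon> \<psi>r v (1 - v) i u \<in> level_polygon \<epsilon> \<psi>r v (1 - v)"
    using sin_e u by (intro level_curve_mem) auto
  moreover have "level_curve \<epsilon> \<psi>s v (1 - v) k w \<in> level_polygon \<epsilon> \<psi>s v (1 - v)"
    using sin_e u v by (intro level_curve_mem) (auto simp: w_def)
  ultimately have "level_polygon \<epsilon> \<psi>r v (1 - v) \<inter> level_polygon \<epsilon> \<psi>s v (1 - v) \<noteq> {}" by auto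
  moreover have "0 < v" "0 < 1 - v" using v vv by linarith+
  ultimately show False
    using level_polygons_disjoint[OF n3 eps l phi] unfolding \<psi>r_def \<psi>s_def by blast
qed

lemma injective_on_rows:
  assumes z: "z = (of_int i + u, of_int j + v)" "z' = (of_int i' + u', of_int j' + v')"
    and j: "j \<in> {0, 1}" "j' \<in> {0, 1}"
    and u: "0 \<le> u" "u < 1" "0 \<le> u'" "u' < 1" and v: "0 \<le> v" "v < 1" "0 \<le> v'" "v' < 1"
    and eq: "pl X z = pl X z'"
  shows "n dvd i' - i \<and> u = u' \<and> j = j' \<and> v = v'"
proof -
  consider "j = 0" "j' = 0" | "j = 1" "j' = 1" | "j = 0" "j' = 1" | "j = 1" "j' = 0" using j by auto
  then show ?thesis
  proof cases
    case 1
    have z1: "z = (of_int i + u, v)" "z' = (of_int i' + u', v')" using z 1 by auto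
    have e: "level_curve \<epsilon> \<psi>r v (1 - v) i u = level_curve \<epsilon> \<psi>r v' (1 - v') i' u'" "v = v'"
      using eq h0 unfolding row0[OF z1(1) u(1,2) v(1,2)] row0[OF z1(2) u(3,4) v(3,4)] by auto
    have "n dvd i - i' \<and> u = u'"
      by (rule level_curve_inj[OF n3 eps \<psi>_bounds(1), of v "1 - v"]) (use e u v in auto)
    then show ?thesis using 1 e by (simp add: dvd_diff_commute)
  next
    case 2
    have z1: "z = (of_int i + u, 1 + v)" "z' = (of_int i' + u', 1 + v')" using z 2 by auto
    define w where "w = (if v \<le> u then u - v else u - v + 1)"
    define k where "k = (if v \<le> u then i - l else i - l - 1)"
    define w' where "w' = (if v' \<le> u' then u' - v' else u' - v' + 1)"
    define k' where "k' = (if v' \<le> u' then i' - l else i' - l - 1)"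
    have e: "level_curve \<epsilon> \<psi>s (1 - v) v k w = level_curve \<epsilon> \<psi>s (1 - v') v' k' w'" "v = v'"
      using eq h0 unfolding row1[OF z1(1) u(1,2) v(1,2)] row1[OF z1(2) u(3,4) v(3,4)]
      by (auto simp: w_def w'_def k_def k'_def)
    have kw: "n dvd k - k' \<and> w = w'"
      by (rule level_curve_inj[OF n3 eps \<psi>_bounds(2), of "1 - v" v]) (use e u v in \<open>auto simp: w_def w'_def\<close>)
    then have "v \<le> u \<longleftrightarrow> v' \<le> u'" using u e(2) by (auto simp: w_def w'_def split: if_splits)
    then have "n dvd i - i' \<and> u = u'" using kw e(2) by (auto simp: w_def w'_def k_def k'_def split: if_splits)
    then show ?thesis using 2 e by (simp add: dvd_diff_commute)
  next
    case 3
    then show ?thesis using rows_disjoint[OF u v, of i i'] eq z by simp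
  next
    case 4
    then show ?thesis using rows_disjoint[OF u(3,4,1,2) v(3,4,1,2), of i' i] eq z by simp
  qed
qed

lemma pl_X_period: "pl X (z + node (a * n + c * (l + 1), 2 * c)) = pl X z"
proof -
  have "X (p + (a * n + c * (l + 1), 2 * c)) = X p" for p
    using period_iterate[of X n 0 "l + 1" 0 p a c] X1 X2 by simp
  then show ?thesis by (simp add: pl_shift)
qed

lemma injective_modulo_periods:
  assumes eq: "pl X z = pl X z'"
  shows "\<exists>a c. z' = z + node (a * n + c * (l + 1), 2 * c)"
proof -
  define i j c u v where "i = \<lfloor>fst z\<rfloor>" and "j = \<lfloor>snd z\<rfloor>" and "c = \<lfloor>snd z\<rfloor> div 2" and "u = frac (fst z)" and "v = frac (snd z)"
  define i' j' c' u' v' where "i' = \<lfloor>fst z'\<rfloor>" and "j' = \<lfloor>snd z'\<rfloor>" and "c' = \<lfloor>snd z'\<rfloor> div 2" and "u' = frac (fst z')" and "v' = frac (snd z')"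
  define w where "w = (of_int (i - c * (l + 1)) + u, of_int (j mod 2) + v)"
  define w' where "w' = (of_int (i' - c' * (l + 1)) + u', of_int (j' mod 2) + v')"
  have jj: "real_of_int j = real_of_int (j mod 2) + 2 * real_of_int c" "real_of_int j' = real_of_int (j' mod 2) + 2 * real_of_int c'"
    unfolding c_def c'_def j_def[symmetric] j'_def[symmetric] by (metis mod_mult_div_eq of_int_add of_int_mult of_int_numeral)+
  have z: "z = w + node (0 * n + c * (l + 1), 2 * c)"
    using jj(1) by (simp add: w_def node_def prod_eq_iff i_def j_def u_def v_def frac_def)
  have z': "z' = w' + node (0 * n + c' * (l + 1), 2 * c')"
    using jj(2) by (simp add: w'_def node_def prod_eq_iff i'_def j'_def u'_def v'_def frac_def)
  have "pl X w = pl X w'" using eq unfolding z z' pl_X_period .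
  then have "n dvd (i' - c' * (l + 1)) - (i - c * (l + 1)) \<and> u = u' \<and> j mod 2 = j' mod 2 \<and> v = v'"
    by (rule injective_on_rows[OF w_def w'_def, rotated -1]) (auto simp: u_def u'_def v_def v'_def frac_lt_1)
  then obtain a where a: "(i' - c' * (l + 1)) - (i - c * (l + 1)) = n * a" and uv: "u = u'" "j mod 2 = j' mod 2" "v = v'" by auto
  have "i' - c' * (l + 1) = i - c * (l + 1) + a * n" using a by (simp add: algebra_simps)
  then have "w' = w + node (a * n, 0)" using uv unfolding w_def w'_def by (simp add: node_def)
  then have "z' = z + node (a * n + (c' - c) * (l + 1), 2 * (c' - c))"
    unfolding z z' by (simp add: node_def prod_eq_iff algebra_simps)
  then show ?thesis by blast
qed

lemma shift_mod: "(l + 1) mod n \<notin> {0, 1, 2}"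
proof -
  have "(l + 1) mod n = l + 1" using l by (intro mod_pos_pos_trivial) auto
  then show ?thesis using l by simp
qed

sublocale kuhn_torus n "l + 1" Y X \<omega>1 \<omega>2
  using n3 shift_mod Y1 Y2 X1 X2 edges bij_pl_Y injective_modulo_periods nondegenerate
  by unfold_locales auto

lemma hulls_eq_annulus:
  fixes \<rho> :: real
  assumes rho: "2 * pi * \<rho> = \<psi> - \<epsilon>"
  shows "(\<Union>k. convex hull {P k, P (k + 1), Q \<psi> (k + 1)} \<union> convex hull {Q \<psi> (k + 1), Q \<psi> k, P k}) = annulus (nat n) h \<rho>"
proof -
  define T where "T k = convex hull {P k, P (k + 1), Q \<psi> (k + 1)} \<union> convex hull {Q \<psi> (k + 1), Q \<psi> k, P k}" for k
  have nn: "real (nat n) = of_int n" using n3 by simp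
  have angle: "2 * pi * real k / real_of_int n = 2 * real_of_int (int k) * \<epsilon>" for k by (simp add: eps)
  have P: "P_pt (nat n) k = P (int k)" for k
    unfolding P_pt_def P_def nn angle ..
  have Q: "Q_pt (nat n) h \<rho> k = Q \<psi> (int k)" for k
    unfolding Q_pt_def Q_def rho nn angle ..
  have T_period: "T (k mod n) = T k" for k
  proof -
    have k: "k = k mod n + n * (k div n)" by simp
    have "P (k mod n) = P k" "Q \<psi> (k mod n) = Q \<psi> k"
      using P_period[of "k mod n" "k div n"] Q_period[of \<psi> "k mod n" "k div n"] by simp_all
    moreover have k1: "k mod n + 1 + n * (k div n) = k + 1" using k by linarith
    have "P (k mod n + 1) = P (k + 1)" "Q \<psi> (k mod n + 1) = Q \<psi> (k + 1)"
      using P_period[of "k mod n + 1" "k div n"] Q_period[of \<psi> "k mod n + 1" "k div n"] unfolding k1 by simp_all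
    ultimately show ?thesis by (simp add: T_def)
  qed
  have "annulus (nat n) h \<rho> = (\<Union>k<nat n. T (int k))"
    unfolding annulus_def P Q T_def by (simp add: add.commute)
  also have "\<dots> = (\<Union>k. T k)"
  proof (intro equalityI subsetI)
    fix x assume "x \<in> (\<Union>k. T k)"
    then obtain k where "x \<in> T k" by blast
    then have "x \<in> T (int (nat (k mod n)))" using T_period[of k] n3 by simp
    moreover have "nat (k mod n) < nat n" using n3 by simp
    ultimately show "x \<in> (\<Union>k<nat n. T (int k))" by blast
  qed blast
  finally show ?thesis unfolding T_def by simp
qed

lemma X_even_triangles:
  "X ` tri True (i, 2 * q) = {P (i - q * (l + 1)), P (i - q * (l + 1) + 1), Q \<psi>r (i - q * (l + 1) + 1)}"
  "X ` tri False (i, 2 * q) = {Q \<psi>r (i - q * (l + 1) + 1), Q \<psi>r (i - q * (l + 1)), P (i - q * (l + 1))}"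
  using X_even[of i q] X_even[of "i + 1" q] X_odd'[of i q] X_odd'[of "i + 1" q]
  by (auto simp: tri_def mid_def algebra_simps)

lemma X_odd_triangles:
  "X ` tri True (i, 2 * q + 1) = {Q \<psi>s (i - q * (l + 1) - l + 1), Q \<psi>s (i - q * (l + 1) - l), P (i - q * (l + 1) - l)}"
  "X ` tri False (i, 2 * q + 1) = {P (i - q * (l + 1) - l - 1), P (i - q * (l + 1) - l), Q \<psi>s (i - q * (l + 1) - l)}"
  using X_odd[of i q] X_odd[of "i + 1" q] X_even[of i "q + 1"] X_even[of "i + 1" "q + 1"]
  by (auto simp: tri_def mid_def algebra_simps)

lemma folding_image_eq_annuli:
  assumes "2 * pi * \<rho> = \<psi>r - \<epsilon>" "2 * pi * \<sigma> = \<psi>s - \<epsilon>"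
  shows "folding ` torus \<Lambda> = annulus (nat n) h \<rho> \<union> annulus (nat n) h \<sigma>"
proof -
  define A where "A = (\<Union>k. convex hull {P k, P (k + 1), Q \<psi>r (k + 1)} \<union> convex hull {Q \<psi>r (k + 1), Q \<psi>r k, P k})"
  define B where "B = (\<Union>k. convex hull {P k, P (k + 1), Q \<psi>s (k + 1)} \<union> convex hull {Q \<psi>s (k + 1), Q \<psi>s k, P k})"
  have "(\<Union>b p. convex hull (X ` tri b p)) = A \<union> B"
  proof (intro equalityI subsetI)
    fix x assume "x \<in> (\<Union>b p. convex hull (X ` tri b p))"
    then obtain b p where x: "x \<in> convex hull (X ` tri b p)" by blast
    obtain i j where p: "p = (i, j)" by (cases p) blast
    show "x \<in> A \<union> B"
    proof (cases j rule: row_cases)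
      case (1 q)
      define k where "k = i - q * (l + 1)"
      have "x \<in> convex hull {P k, P (k + 1), Q \<psi>r (k + 1)} \<union> convex hull {Q \<psi>r (k + 1), Q \<psi>r k, P k}"
        using x unfolding p 1 by (cases b) (simp_all add: X_even_triangles k_def)
      then show ?thesis unfolding A_def by blast
    next
      case (2 q)
      show ?thesis
      proof (cases b)
        case True
        define k where "k = i - q * (l + 1) - l"
        have "x \<in> convex hull {Q \<psi>s (k + 1), Q \<psi>s k, P k}"
          using x True unfolding p 2 by (simp add: X_odd_triangles k_def)
        then show ?thesis unfolding B_def by blast
      next
        case False
        define k where "k = i - q * (l + 1) - l - 1"
        have "x \<in> convex hull {P k, P (k + 1), Q \<psi>s (k + 1)}"
          using x False unfolding p 2 by (simp add: X_odd_triangles k_def)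
        then show ?thesis unfolding B_def by blast
      qed
    qed
  next
    fix x assume "x \<in> A \<union> B"
    then consider k where "x \<in> convex hull {P k, P (k + 1), Q \<psi>r (k + 1)}" | k where "x \<in> convex hull {Q \<psi>r (k + 1), Q \<psi>r k, P k}"
      | k where "x \<in> convex hull {P k, P (k + 1), Q \<psi>s (k + 1)}" | k where "x \<in> convex hull {Q \<psi>s (k + 1), Q \<psi>s k, P k}"
      unfolding A_def B_def by blast
    then obtain b p where "x \<in> convex hull (X ` tri b p)"
    proof cases
      case (1 k) then show ?thesis using that[of True "(k, 2 * 0)"] by (simp only: X_even_triangles) simp
    next
      case (2 k) then show ?thesis using that[of False "(k, 2 * 0)"] by (simp only: X_even_triangles) simp
    next
      case (3 k) then show ?thesis using that[of False "(k + l + 1, 2 * 0 + 1)"] by (simp only: X_odd_triangles) simp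
    next
      case (4 k) then show ?thesis using that[of True "(k + l, 2 * 0 + 1)"] by (simp only: X_odd_triangles) simp
    qed
    then show "x \<in> (\<Union>b p. convex hull (X ` tri b p))" by blast
  qed
  then show ?thesis unfolding folding_image A_def B_def hulls_eq_annulus[OF assms(1)] hulls_eq_annulus[OF assms(2)] .
qed

lemma \<omega>1_neq_0: "\<omega>1 \<noteq> 0" using sin_e n3 by (simp add: \<omega>1_def)

lemma \<omega>2_eq: "\<omega>2 = \<omega>1 * Complex ((2 * sin \<epsilon> * l - 2 * cos \<phi> * sin (l * \<epsilon>)) / (2 * n * sin \<epsilon>))
                          ((height \<psi>r + height \<psi>s) / (2 * n * sin \<epsilon>))"
proof -
  have "sin \<psi>r - sin \<psi>s = - (2 * cos \<phi> * sin (l * \<epsilon>))"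
    unfolding \<psi>r_def \<psi>s_def by (simp add: sin_diff algebra_simps)
  then have "\<omega>2 = Complex (2 * sin \<epsilon> * l - 2 * cos \<phi> * sin (l * \<epsilon>)) (height \<psi>r + height \<psi>s)"
    by (simp add: \<omega>2_def E2_def complex_eq_iff algebra_simps)
  moreover have "2 * n * sin \<epsilon> \<noteq> 0" using sin_e n3 by simp
  ultimately show ?thesis by (simp add: \<omega>1_def complex_eq_iff)
qed

text \<open>
  The origami torus has modulus \<open>\<omega>2 / \<omega>1 = \<tau>'\<close>, and so the modulus \<open>\<tau>\<close>, whenever the parameters match a
  representative \<open>\<tau>'\<close> of \<open>\<tau>\<close>.
\<close>

lemma origami_annuli:
  fixes a b c d :: int
  assumes rho: "2 * pi * \<rho> = \<psi>r - \<epsilon>" "2 * pi * \<sigma> = \<psi>s - \<epsilon>"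
    and tau: "Im \<tau> > 0" and det: "a * d - b * c = 1"
    and re: "Re \<tau>' = (2 * sin \<epsilon> * l - 2 * cos \<phi> * sin (l * \<epsilon>)) / (2 * n * sin \<epsilon>)"
    and im: "Im \<tau>' = (height \<psi>r + height \<psi>s) / (2 * n * sin \<epsilon>)"
    and tau': "\<tau>' = (of_int a * \<tau> + of_int b) / (of_int c * \<tau> + of_int d)"
  shows "origami_embedded_flat_torus \<tau> (annulus (nat n) h \<rho> \<union> annulus (nat n) h \<sigma>)"
proof -
  have w2: "\<omega>2 = \<omega>1 * \<tau>'" unfolding \<omega>2_eq re[symmetric] im[symmetric] by simp
  have "Im \<tau>' \<noteq> 0" unfolding im using height_pos[of \<psi>r] height_pos[of \<psi>s] sin_e n3 by simp
  then have "is_lattice \<Lambda>"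
    using \<omega>1_neq_0 w2 by (intro is_lattice_lattice_gen) simp_all
  moreover have "torus_has_modulus \<Lambda> \<tau>"
    by (rule torus_has_modulus_SL2Z[OF tau det \<omega>1_neq_0]) (simp only: w2 tau')
  ultimately show ?thesis
    unfolding origami_embedded_flat_torus_def
    using origami_map_folding folding_image_eq_annuli[OF rho] by blast
qed

end

section \<open>Choice of the parameters\<close>

lemma pi_over_n_tendsto: "(\<lambda>n. pi / real n) \<longlonglongrightarrow> 0"
  using tendsto_mult[OF tendsto_const[of pi] lim_1_over_n[where 'a = real]] by simp

lemma n_sin_pi_over_n_tendsto: "(\<lambda>n. real n * sin (pi / real n)) \<longlonglongrightarrow> pi"
proof -
  have "((\<lambda>h::real. (sin (0 + h) - sin 0) / h) \<longlongrightarrow> cos 0) (at 0)"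
    using DERIV_sin[of "0::real"] unfolding DERIV_def .
  then have lim: "((\<lambda>h::real. sin h / h) \<longlongrightarrow> 1) (at 0)" by simp
  have "filterlim (\<lambda>n. pi / real n) (at 0) sequentially"
    unfolding filterlim_at using pi_over_n_tendsto eventually_gt_at_top[of 0]
    by (auto elim: eventually_mono)
  from filterlim_compose[OF lim this]
  have "(\<lambda>n. pi * (sin (pi / real n) / (pi / real n))) \<longlonglongrightarrow> pi * 1"
    by (intro tendsto_mult tendsto_const)
  then show ?thesis by (simp add: mult.commute)
qed

lemma eventually_real_greater: "\<forall>\<^sub>F n in sequentially. x < real n"
  using filterlim_real_sequentially unfolding filterlim_at_top_dense by blast

lemma exists_height:
  fixes A B T :: real
  assumes "\<bar>A\<bar> + \<bar>B\<bar> < T"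
  shows "\<exists>h>0. sqrt (h\<^sup>2 + A\<^sup>2) + sqrt (h\<^sup>2 + B\<^sup>2) = T"
proof -
  define g where "g h = sqrt (h\<^sup>2 + A\<^sup>2) + sqrt (h\<^sup>2 + B\<^sup>2)" for h
  have T0: "T > 0" using assms by linarith
  have "T \<le> sqrt (T\<^sup>2 + A\<^sup>2)" by (rule real_le_rsqrt) simp
  then have "T \<le> g T" unfolding g_def by (simp add: add_increasing2)
  moreover have g0: "g 0 < T" using assms by (simp add: g_def)
  moreover have "continuous_on {0..T} g" unfolding g_def by (intro continuous_intros)
  ultimately obtain h where h: "0 \<le> h" "g h = T" using IVT'[of g 0 T T] T0 by force
  have "h \<noteq> 0" using h g0 by auto
  then show ?thesis using h unfolding g_def by (intro exI[of _ h]) auto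
qed

text \<open>
  The ratio is the limit of \<open>cos \<phi>\<close> that produces the real part \<open>r\<close> when \<open>l / n\<close> tends to \<open>t\<close>.  Asking
  for the midpoint \<open>(1 - cos (\<pi> t)) / 2\<close> of the admissible interval defines \<open>r\<close> as a continuous function of
  \<open>t\<close> with the values \<open>0\<close> and \<open>1\<close> at the ends, so \<open>t\<close> exists by the intermediate value theorem.
\<close>

lemma exists_turning_ratio:
  fixes r :: real
  assumes "0 < r" "r < 1"
  obtains t where "0 < t" "t < 1" "- cos (pi * t) < (t - r) * pi / sin (pi * t)" "(t - r) * pi / sin (pi * t) < 1"
proof -
  define G where "G t = t - (1 - cos (pi * t)) / 2 * sin (pi * t) / pi" for t
  have "continuous_on {0..1} G" unfolding G_def by (intro continuous_intros) auto
  moreover have "G 0 = 0" "G 1 = 1" by (auto simp: G_def)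
  ultimately obtain t where t: "0 \<le> t" "t \<le> 1" "G t = r" using IVT'[of G 0 r 1] assms by force
  have "t \<noteq> 0" "t \<noteq> 1" using t assms by (auto simp: G_def)
  then have t01: "0 < t" "t < 1" using t by auto
  have s: "sin (pi * t) > 0" using t01 by (intro sin_gt_zero) auto
  have "(t - r) * pi = (1 - cos (pi * t)) / 2 * sin (pi * t)" using t(3) by (simp add: G_def field_simps)
  then have c: "(t - r) * pi / sin (pi * t) = (1 - cos (pi * t)) / 2" using s by (simp add: field_simps)
  have "cos pi < cos (pi * t)" using t01 by (intro cos_monotone_0_pi) auto
  then have "- 1 < cos (pi * t)" by simp
  then show thesis using that[OF t01] c by simp
qed

text \<open>
  With \<open>l\<close> the integer part of \<open>t n\<close>, the required value \<open>C n\<close> of \<open>cos \<phi>\<close> converges into the interior of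
  the limit of its admissible interval.  The bound \<open>5 / 2\<close> on \<open>n sin \<epsilon>\<close> is what makes the imaginary part at
  \<open>h = 0\<close> smaller than \<open>4 / 5\<close>, hence smaller than \<open>y\<close>.
\<close>

lemma exists_parameters:
  fixes r y :: real
  assumes r: "0 < r" "r < 1" and y: "0 < y" "y\<^sup>2 \<ge> 3 / 4"
  obtains n l :: nat and \<epsilon> \<phi> h :: real where "5 \<le> n" "2 \<le> l" "l + 3 \<le> n" "\<epsilon> = pi / n" "0 < h"
    "\<epsilon> < \<phi>" "\<phi> < pi - (l + 1) * \<epsilon>"
    "r = (2 * sin \<epsilon> * l - 2 * cos \<phi> * sin (l * \<epsilon>)) / (2 * n * sin \<epsilon>)"
    "y = (sqrt (h\<^sup>2 + (cos \<epsilon> - cos (- \<phi> - l * \<epsilon>))\<^sup>2) + sqrt (h\<^sup>2 + (cos \<epsilon> - cos (l * \<epsilon> - \<phi>))\<^sup>2)) / (2 * n * sin \<epsilon>)"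
proof -
  obtain t where t: "0 < t" "t < 1"
    and c: "- cos (pi * t) < (t - r) * pi / sin (pi * t)" "(t - r) * pi / sin (pi * t) < 1"
    using exists_turning_ratio[OF r] by blast
  have s: "sin (pi * t) > 0" using t by (intro sin_gt_zero) auto
  define l where "l n = nat \<lfloor>t * real n\<rfloor>" for n
  have l_bounds: "t * real n - 1 < real (l n)" "real (l n) \<le> t * real n" for n
  proof -
    have "0 \<le> t * real n" using t by simp
    then have "real (l n) = of_int \<lfloor>t * real n\<rfloor>" by (simp add: l_def)
    then show "t * real n - 1 < real (l n)" "real (l n) \<le> t * real n" by linarith+
  qed
  have ratio: "(\<lambda>n. real (l n) / real n) \<longlonglongrightarrow> t"
  proof (rule tendsto_sandwich[of "\<lambda>n. t - 1 / real n" _ _ "\<lambda>n. t"])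
    show "(\<lambda>n. t - 1 / real n) \<longlonglongrightarrow> t"
      using tendsto_diff[OF tendsto_const[of t] lim_1_over_n[where 'a = real]] by simp
    show "\<forall>\<^sub>F n in sequentially. t - 1 / real n \<le> real (l n) / real n"
      using eventually_gt_at_top[of 0]
    proof eventually_elim
      case (elim n)
      have "t - 1 / real n = (t * real n - 1) / real n" using elim by (simp add: diff_divide_distrib)
      also have "\<dots> \<le> real (l n) / real n" using l_bounds(1)[of n] by (intro divide_right_mono) auto
      finally show ?case .
    qed
    show "\<forall>\<^sub>F n in sequentially. real (l n) / real n \<le> t"
      using eventually_gt_at_top[of 0]
    proof eventually_elim
      case (elim n)
      then show ?case using l_bounds(2)[of n] by (simp add: field_simps)
    qed
  qed simp
  have sn: "(\<lambda>n. real n * sin (pi / real n)) \<longlonglongrightarrow> pi" by (rule n_sin_pi_over_n_tendsto)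
  have e: "(\<lambda>n. pi / real n) \<longlonglongrightarrow> 0" by (rule pi_over_n_tendsto)
  have le: "(\<lambda>n. real (l n) * (pi / real n)) \<longlonglongrightarrow> pi * t"
    using tendsto_mult[OF tendsto_const[of pi] ratio] by (simp add: mult_ac)
  define C where "C n = (real (l n) / real n - r) * (real n * sin (pi / real n)) / sin (real (l n) * (pi / real n))" for n
  have C: "C \<longlonglongrightarrow> (t - r) * pi / sin (pi * t)"
    unfolding C_def using s by (intro tendsto_intros ratio sn le) auto
  have cos_e: "(\<lambda>n. cos (pi / real n)) \<longlonglongrightarrow> 1" using tendsto_cos[OF e] by simp
  have "(\<lambda>n. real (l n) * (pi / real n) + pi / real n) \<longlonglongrightarrow> pi * t + 0" by (intro tendsto_add le e)
  then have "(\<lambda>n. - cos (real (l n) * (pi / real n) + pi / real n)) \<longlonglongrightarrow> - cos (pi * t + 0)"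
    by (intro tendsto_minus tendsto_cos)
  then have cos_l: "(\<lambda>n. - cos ((real (l n) + 1) * (pi / real n))) \<longlonglongrightarrow> - cos (pi * t)"
    by (simp only: distrib_right mult_1 add_0_right)
  have "\<forall>\<^sub>F n in sequentially. C n < cos (pi / real n)"
    using order_tendstoD(1)[OF tendsto_diff[OF cos_e C], of 0] c by simp
  moreover have "\<forall>\<^sub>F n in sequentially. - cos ((real (l n) + 1) * (pi / real n)) < C n"
  proof -
    have "\<forall>\<^sub>F n in sequentially. 0 < C n - - cos ((real (l n) + 1) * (pi / real n))"
      using c(1) by (intro order_tendstoD(1)[OF tendsto_diff[OF C cos_l]]) simp
    then show ?thesis by eventually_elim linarith
  qed
  moreover have "\<forall>\<^sub>F n in sequentially. real n * sin (pi / real n) > 5 / 2"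
    using pi_gt3 by (intro order_tendstoD(1)[OF sn]) simp
  moreover have "\<forall>\<^sub>F n in sequentially. 3 / t < real n" by (rule eventually_real_greater)
  moreover have "\<forall>\<^sub>F n in sequentially. 3 / (1 - t) < real n" by (rule eventually_real_greater)
  moreover have "\<forall>\<^sub>F n in sequentially. 5 \<le> n" by (rule eventually_ge_at_top)
  ultimately have "\<forall>\<^sub>F n in sequentially. C n < cos (pi / real n) \<and> - cos ((real (l n) + 1) * (pi / real n)) < C n \<and>
     real n * sin (pi / real n) > 5 / 2 \<and> 3 / t < real n \<and> 3 / (1 - t) < real n \<and> 5 \<le> n"
    by eventually_elim auto
  then obtain n where n: "C n < cos (pi / real n)" "- cos ((real (l n) + 1) * (pi / real n)) < C n"
     "real n * sin (pi / real n) > 5 / 2" "3 / t < real n" "3 / (1 - t) < real n" "5 \<le> n"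
    by (auto dest!: eventually_happens)
  define \<epsilon> where "\<epsilon> = pi / real n"
  have ne: "real n * \<epsilon> = pi" using n by (simp add: \<epsilon>_def)
  have e0: "\<epsilon> > 0" "\<epsilon> < pi" using n by (auto simp: \<epsilon>_def field_simps)
  have l2: "2 \<le> l n" using l_bounds(1)[of n] n(4) t by (simp add: field_simps)
  have l3: "l n + 3 \<le> n"
  proof -
    have "3 < real n - t * real n" using n(5) t by (simp add: field_simps)
    then have "real (l n) + 3 < real n" using l_bounds(2)[of n] by linarith
    then show ?thesis by linarith
  qed
  have l1: "(real (l n) + 1) * \<epsilon> < pi"
  proof -
    have "(real (l n) + 1) * \<epsilon> < real n * \<epsilon>" using l3 e0 by (intro mult_strict_right_mono) linarith+
    then show ?thesis using ne by simp
  qed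
  \<comment> \<open>the inequalities for \<open>C n\<close> are the bounds for \<open>\<phi>\<close>, read off through the decreasing function \<open>arccos\<close>\<close>
  define \<phi> where "\<phi> = arccos (C n)"
  have Cb: "- 1 < C n" "C n < 1"
    using n(1,2) cos_le_one[of "(real (l n) + 1) * (pi / real n)"] cos_le_one[of "pi / real n"] by linarith+
  have cphi: "cos \<phi> = C n" using Cb by (simp add: \<phi>_def)
  have phi1: "\<epsilon> < \<phi>"
  proof -
    have "arccos (cos \<epsilon>) < arccos (C n)" using n(1) Cb by (intro arccos_less_arccos) (auto simp: \<epsilon>_def)
    then show ?thesis using e0 by (simp add: arccos_cos \<phi>_def)
  qed
  have phi2: "\<phi> < pi - (real (l n) + 1) * \<epsilon>"
  proof -
    have "cos (pi - (real (l n) + 1) * \<epsilon>) < C n" using n(2) by (simp add: \<epsilon>_def)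
    then have "arccos (C n) < arccos (cos (pi - (real (l n) + 1) * \<epsilon>))" using Cb by (intro arccos_less_arccos) auto
    also have "\<dots> = pi - (real (l n) + 1) * \<epsilon>" using l1 e0 by (intro arccos_cos) auto
    finally show ?thesis by (simp add: \<phi>_def)
  qed
  have sl: "sin (real (l n) * \<epsilon>) > 0"
    using l1 l2 e0 by (intro sin_gt_zero) (auto simp: algebra_simps)
  have se: "sin \<epsilon> > 0" using e0 by (intro sin_gt_zero) auto
  have "C n * sin (real (l n) * \<epsilon>) = (real (l n) / real n - r) * (real n * sin \<epsilon>)"
    using sl unfolding C_def \<epsilon>_def by simp
  also have "\<dots> = (real (l n) - r * real n) * sin \<epsilon>" using n(6) by (simp add: field_simps)
  finally have "2 * real n * sin \<epsilon> * r = 2 * sin \<epsilon> * real (l n) - 2 * cos \<phi> * sin (real (l n) * \<epsilon>)"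
    unfolding cphi by (simp add: algebra_simps)
  then have req: "r = (2 * sin \<epsilon> * real (l n) - 2 * cos \<phi> * sin (real (l n) * \<epsilon>)) / (2 * real n * sin \<epsilon>)"
    using se n(6) by (simp add: field_simps)
  define A where "A = cos \<epsilon> - cos (- \<phi> - real (l n) * \<epsilon>)"
  define B where "B = cos \<epsilon> - cos (real (l n) * \<epsilon> - \<phi>)"
  have AB: "\<bar>A\<bar> \<le> 2" "\<bar>B\<bar> \<le> 2"
    unfolding A_def B_def using abs_cos_le_one[of \<epsilon>] abs_cos_le_one[of "- \<phi> - real (l n) * \<epsilon>"] abs_cos_le_one[of "real (l n) * \<epsilon> - \<phi>"]
    by linarith+
  have y8: "4 / 5 < y"
  proof (rule ccontr)
    assume "\<not> 4 / 5 < y"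
    then have "y\<^sup>2 \<le> (4 / 5)\<^sup>2" using y by (intro power_mono) auto
    then show False using y by (simp add: power2_eq_square)
  qed
  have "(5 / 2) * (4 / 5) < (real n * sin \<epsilon>) * y" using n(3) y8 unfolding \<epsilon>_def[symmetric] by (intro mult_strict_mono) auto
  then have "\<bar>A\<bar> + \<bar>B\<bar> < 2 * real n * sin \<epsilon> * y" using AB by simp
  then obtain h where h: "h > 0" "sqrt (h\<^sup>2 + A\<^sup>2) + sqrt (h\<^sup>2 + B\<^sup>2) = 2 * real n * sin \<epsilon> * y"
    using exists_height by blast
  have yeq: "y = (sqrt (h\<^sup>2 + A\<^sup>2) + sqrt (h\<^sup>2 + B\<^sup>2)) / (2 * real n * sin \<epsilon>)"
    unfolding h(2) using se n(6) by (simp add: field_simps)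
  have "\<phi> < pi - real (l n + 1) * \<epsilon>" using phi2 by (simp add: algebra_simps)
  then show thesis
    using that[of n "l n" \<epsilon> h \<phi>] n(6) l2 l3 \<epsilon>_def h(1) phi1 req yeq unfolding A_def B_def by simp
qed

theorem theorem4p1:
  fixes \<tau> :: complex
  assumes "Im \<tau> > 0"
    and "\<not> (\<exists>t::real. t > 0 \<and> SL2Z_equivalent \<tau> (\<i> * of_real t))"
  shows "\<exists>(n::nat) (h::real) (l::nat) (\<rho>::real) (\<sigma>::real).
           n \<ge> 5 \<and> h > 0 \<and> l \<in> {2..n - 3} \<and>
           ((\<sigma> = \<rho> + real l / real n \<and>
             - 1 / 2 < \<rho> \<and> \<rho> < - (real l / (2 * real n)) - 1 / real n) \<or>
            (\<sigma> = \<rho> - real l / real n \<and>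
             real l / (2 * real n) < \<rho> \<and> \<rho> < 1 / 2 - 1 / real n)) \<and>
           origami_embedded_flat_torus \<tau> (annulus n h \<rho> \<union> annulus n h \<sigma>)"
proof -
  obtain a b c d :: int and \<tau>' where det: "a * d - b * c = 1"
    and tau': "\<tau>' = (of_int a * \<tau> + of_int b) / (of_int c * \<tau> + of_int d)"
    and re: "0 \<le> Re \<tau>'" "Re \<tau>' < 1" and im: "Im \<tau>' > 0" "(Im \<tau>')\<^sup>2 \<ge> 3 / 4"
    by (rule SL2Z_reduced_representative[OF assms(1)])
  have "Re \<tau>' \<noteq> 0"
  proof
    assume "Re \<tau>' = 0"
    then have "\<i> * of_real (Im \<tau>') = \<tau>'" by (simp add: complex_eq_iff)
    then have "SL2Z_equivalent \<tau> (\<i> * of_real (Im \<tau>'))" unfolding SL2Z_equivalent_def using det tau' by metis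
    then show False using assms(2) im(1) by blast
  qed
  then have re0: "0 < Re \<tau>'" using re by simp
  obtain n l :: nat and \<epsilon> \<phi> h :: real where n5: "5 \<le> n" and l_bounds: "2 \<le> l" "l + 3 \<le> n" and eps: "\<epsilon> = pi / n" and h: "0 < h"
    and phi: "\<epsilon> < \<phi>" "\<phi> < pi - (l + 1) * \<epsilon>"
    and r: "Re \<tau>' = (2 * sin \<epsilon> * l - 2 * cos \<phi> * sin (l * \<epsilon>)) / (2 * n * sin \<epsilon>)"
    and y: "Im \<tau>' = (sqrt (h\<^sup>2 + (cos \<epsilon> - cos (- \<phi> - l * \<epsilon>))\<^sup>2) + sqrt (h\<^sup>2 + (cos \<epsilon> - cos (l * \<epsilon> - \<phi>))\<^sup>2)) / (2 * n * sin \<epsilon>)"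
    by (rule exists_parameters[OF re0 re(2) im])
  interpret two_annuli "int n" "int l" \<epsilon> \<phi> h
    by unfold_locales (use n5 l_bounds eps h phi in \<open>simp_all add: add.commute\<close>)
  define \<rho> where "\<rho> = - (\<phi> + (l + 1) * \<epsilon>) / (2 * pi)"
  define \<sigma> where "\<sigma> = \<rho> + real l / real n"
  have angle: "2 * pi * \<rho> = - (\<phi> + (real l + 1) * \<epsilon>)" by (simp add: \<rho>_def add.commute)
  have rho: "2 * pi * \<rho> = \<psi>r - \<epsilon>" unfolding angle by (simp add: \<psi>r_def algebra_simps)
  have "2 * pi * \<sigma> = 2 * pi * \<rho> + 2 * (real l * \<epsilon>)" by (simp add: \<sigma>_def eps algebra_simps)
  then have sigma: "2 * pi * \<sigma> = \<psi>s - \<epsilon>" unfolding rho by (simp add: \<psi>r_def \<psi>s_def)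
  from rho sigma have "origami_embedded_flat_torus \<tau> (annulus (nat (int n)) h \<rho> \<union> annulus (nat (int n)) h \<sigma>)"
    using assms(1) det _ _ tau' by (rule origami_annuli) (use r y in \<open>simp_all add: height_def \<psi>r_def \<psi>s_def\<close>)
  then have "origami_embedded_flat_torus \<tau> (annulus n h \<rho> \<union> annulus n h \<sigma>)" by simp
  moreover have "- 1 / 2 < \<rho>"
    using phi(2) by (simp add: \<rho>_def field_simps)
  moreover have "\<rho> < - (real l / (2 * real n)) - 1 / real n"
  proof -
    have "real l / (2 * real n) + 1 / real n = (l + 2) * \<epsilon> / (2 * pi)" using n5 by (simp add: eps field_simps)
    also have "\<dots> < (\<phi> + (l + 1) * \<epsilon>) / (2 * pi)"
      using phi(1) by (intro divide_strict_right_mono) (auto simp: algebra_simps)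
    finally show ?thesis unfolding \<rho>_def minus_divide_left[symmetric] by linarith
  qed
  ultimately show ?thesis
    using n5 h l_bounds \<sigma>_def by (intro exI[of _ n] exI[of _ h] exI[of _ l] exI[of _ \<rho>] exI[of _ \<sigma>]) auto
qed


end
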